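(* Assume that $H_0,H_1\in(0,1)$ satisfy $\frac32<2H_0+H_1<2$. Then the following assertions hold true. (i) For every $\alpha>2-(2H_0+H_1)$, the sequence $(\Psi^{(n)})_{n\ge1}$ converges a.s. to some limit $\Psi$ in $\mathcal C(\mathbb R;W^{-\alpha,p}(\mathbb T))$ for all $1\le p\le\infty$. (ii) For every $\alpha<2-(2H_0+H_1)$ and every $T>0$, one has $\mathbb E\Big[\|\Psi^{(n)}\|^2_{L^2([0,T];H^{-\alpha}(\mathbb T))}\Big]\to\infty$ as $n\to\infty$.
   Context: Notation: $\mathbb T=\mathbb R/2\pi\mathbb Z$; $\varphi_k:=\frac1{2\pi}\int_0^{2\pi}e^{-\imath kx}\varphi(x)\,dx$; for $s\in\mathbb R$, $1\le p\le\infty$, $W^{s,p}(\mathbb T)=\{u\in\mathcal S'(\mathbb T):(1-\Delta)^{s/2}u\in L^p(\mathbb T)\}$ with its natural norm, and $H^s(\mathbb T)=W^{s,2}(\mathbb T)$, $\|\varphi\|_{H^s}^2=\sum_k\langle k\rangle^{2s}|\varphi_k|^2$, $\langle k\rangle=(1+k^2)^{1/2}$. $\chi:\mathbb R\to[0,1]$ is a fixed smooth even function with $\chi=1$ on $[-1,1]$ and $\chi(t)=0$ for $|t|\ge2$. Noise: on a complete probability space let $\widehat W$ be the Fourier transform of a Brownian field (white noise) on $\mathbb R^2$ (complex centered Gaussian measure, $\widehat W(-d\xi,-d\eta)=\overline{\widehat W(d\xi,d\eta)}$, $\mathbb E[\int f\,d\widehat W\,\overline{\int g\,d\widehat W}]=\int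 f\bar g$). For $n\ge1$, $B^{(n)}(t,x):=c_H\int_{|\xi|\le2^{2n}}\int_{|\eta|\le2^n}\frac{e^{\imath t\xi}-1}{|\xi|^{H_0+1/2}}\frac{e^{\imath x\eta}-1}{|\eta|^{H_1+1/2}}\widehat W(d\xi,d\eta)$ and $\dot B^{(n)}:=\partial_t\partial_xB^{(n)}$, with $c_H>0$ a fixed normalizing constant (chosen so that $B^{(n)}$ converges a.s. locally uniformly to a fractional sheet of index $(H_0,H_1)$). The noise is viewed on $\mathbb R\times\mathbb T$ through $\dot B^{(n)}_k(r)=\frac1{2\pi}\int_0^{2\pi}e^{-\imath ky}\dot B^{(n)}(r,y)\,dy$. $\Psi^{(n)}(t):=-\imath\chi(t)\int_0^t\chi(r)e^{\imath r\Delta}\dot B^{(n)}(r)\,dr$, i.e. $\Psi^{(n)}_k(t)=-\imath\chi(t)\int_0^t\chi(r)e^{-\imath r|k|^2}\dot B^{(n)}_k(r)\,dr$. *)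

theory Defs
  imports "HOL-Probability.Probability"
begin

text \<open>
  A function on \<open>\<real>/2\<pi>\<int>\<close> is represented by its restriction to the fundamental domain
  \<open>[0, 2\<pi>]\<close>. The measure is normalised to mass one, so that the \<open>W\<^sup>s\<^sup>,\<^sup>2\<close> norm below is the
  \<open>H\<^sup>s\<close> norm \<open>\<Sum>\<^sub>k \<langle>k\<rangle>\<^sup>2\<^sup>s |u\<^sub>k|\<^sup>2\<close> exactly, with no factor \<open>2\<pi>\<close>.
\<close>

definition torus :: "real measure" where
  "torus = uniform_measure lborel {0..2 * pi}"

definition fourier_coeff :: "(real \<Rightarrow> complex) \<Rightarrow> int \<Rightarrow> complex" where
  "fourier_coeff f k = (LBINT x=0..2 * pi. cis (- (real_of_int k * x)) * f x) / (2 * pi)"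

definition Lp :: "ereal \<Rightarrow> (real \<Rightarrow> complex) set" where
  "Lp p = {f \<in> borel_measurable torus.
     if p = \<infinity> then \<exists>C. AE x in torus. cmod (f x) \<le> C
     else integrable torus (\<lambda>x. cmod (f x) powr real_of_ereal p)}"

definition Lp_norm :: "ereal \<Rightarrow> (real \<Rightarrow> complex) \<Rightarrow> real" where
  "Lp_norm p f =
     (if p = \<infinity> then real_of_ereal (esssup torus (\<lambda>x. ereal (cmod (f x))))
      else (LINT x|torus. cmod (f x) powr real_of_ereal p) powr (1 / real_of_ereal p))"

definition bracket :: "int \<Rightarrow> real" where
  "bracket k = sqrt (1 + (real_of_int k)\<^sup>2)"

text \<open>
  An element of \<open>\<S>'(\<T>)\<close> is represented by its sequence of Fourier coefficients; the sequences
  that occur are exactly those of at most polynomial growth.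
\<close>

type_synonym torus_distr = "int \<Rightarrow> complex"

definition tempered :: "torus_distr \<Rightarrow> bool" where
  "tempered u \<longleftrightarrow> (\<exists>C N. \<forall>k. cmod (u k) \<le> C * bracket k ^ N)"

text \<open>The operator \<open>(1 - \<Delta>)\<^sup>s\<^sup>/\<^sup>2\<close>.\<close>

definition bessel :: "real \<Rightarrow> torus_distr \<Rightarrow> torus_distr" where
  "bessel s u = (\<lambda>k. complex_of_real (bracket k powr s) * u k)"

definition sobolev :: "real \<Rightarrow> ereal \<Rightarrow> torus_distr set" where
  "sobolev s p = {u. tempered u \<and> (\<exists>f\<in>Lp p. fourier_coeff f = bessel s u)}"

text \<open>The chosen \<open>f\<close> is unique up to null sets, so the norm does not depend on the choice.\<close>

definition sobolev_norm :: "real \<Rightarrow> ereal \<Rightarrow> torus_distr \<Rightarrow> real" where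
  "sobolev_norm s p u = Lp_norm p (SOME f. f \<in> Lp p \<and> fourier_coeff f = bessel s u)"

text \<open>The squared \<open>H\<^sup>s\<close> norm, with value \<open>\<infinity>\<close> outside \<open>H\<^sup>s\<close>.\<close>

definition H_norm_sq :: "real \<Rightarrow> torus_distr \<Rightarrow> ennreal" where
  "H_norm_sq s u = (\<Sum>\<^sub>\<infinity>k. ennreal (bracket k powr (2 * s) * (cmod (u k))\<^sup>2))"

definition C_sobolev :: "real \<Rightarrow> ereal \<Rightarrow> (real \<Rightarrow> torus_distr) set" where
  "C_sobolev s p = {u. (\<forall>t. u t \<in> sobolev s p) \<and>
     (\<forall>t. ((\<lambda>r. sobolev_norm s p (\<lambda>k. u r k - u t k)) \<longlongrightarrow> 0) (at t))}"

text \<open>Convergence in \<open>C(\<real>; W\<^sup>s\<^sup>,\<^sup>p)\<close>: uniform convergence on compact sets of times.\<close>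

definition C_sobolev_tendsto ::
    "real \<Rightarrow> ereal \<Rightarrow> (nat \<Rightarrow> real \<Rightarrow> torus_distr) \<Rightarrow> (real \<Rightarrow> torus_distr) \<Rightarrow> bool" where
  "C_sobolev_tendsto s p u v \<longleftrightarrow>
     (\<forall>n\<ge>1. u n \<in> C_sobolev s p) \<and> v \<in> C_sobolev s p \<and>
     (\<forall>K. compact K \<longrightarrow>
        uniform_limit K (\<lambda>n t. sobolev_norm s p (\<lambda>k. u n t k - v t k)) (\<lambda>_. 0) sequentially)"

definition square_integrable :: "(real \<times> real \<Rightarrow> complex) set" where
  "square_integrable =
     {f \<in> borel_measurable lborel. integrable lborel (\<lambda>z. (cmod (f z))\<^sup>2)}"

definition centered_gaussian :: "'a measure \<Rightarrow> ('a \<Rightarrow> real) \<Rightarrow> bool" where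
  "centered_gaussian M X \<longleftrightarrow> X \<in> borel_measurable M \<and>
     ((AE \<omega> in M. X \<omega> = 0) \<or> (\<exists>\<sigma>>0. distributed M lborel X (normal_density 0 \<sigma>)))"

text \<open>
  \<open>What f\<close> is the stochastic integral \<open>\<integral> f d\<W>\<close> of a square integrable \<open>f\<close> against the
  Fourier transform of a real white noise on the plane. By complex linearity, the condition on real
  parts says that all the variables \<open>Re (What f)\<close>, \<open>Im (What f)\<close> are jointly centered Gaussian.
  The conjugation condition is the integrated form of the symmetry \<open>\<W>(-dz) = cnj \<W>(dz)\<close>.
\<close>

definition fourier_white_noise ::
    "'a measure \<Rightarrow> ((real \<times> real \<Rightarrow> complex) \<Rightarrow> 'a \<Rightarrow> complex) \<Rightarrow> bool" where
  "fourier_white_noise M What \<longleftrightarrow>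
     (\<forall>f\<in>square_integrable. What f \<in> borel_measurable M) \<and>
     (\<forall>f\<in>square_integrable. \<forall>g\<in>square_integrable. \<forall>a b.
        AE \<omega> in M. What (\<lambda>z. a * f z + b * g z) \<omega> = a * What f \<omega> + b * What g \<omega>) \<and>
     (\<forall>f\<in>square_integrable. centered_gaussian M (\<lambda>\<omega>. Re (What f \<omega>))) \<and>
     (\<forall>f\<in>square_integrable. AE \<omega> in M. What (\<lambda>z. cnj (f (- z))) \<omega> = cnj (What f \<omega>)) \<and>
     (\<forall>f\<in>square_integrable. \<forall>g\<in>square_integrable.
        (LINT \<omega>|M. What f \<omega> * cnj (What g \<omega>)) = (LINT z|lborel. f z * cnj (g z)))"

definition sheet_kernel ::
    "real \<Rightarrow> real \<Rightarrow> nat \<Rightarrow> real \<Rightarrow> real \<Rightarrow> real \<times> real \<Rightarrow> complex" where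
  "sheet_kernel H0 H1 n t x = (\<lambda>(\<xi>, \<eta>).
     if \<bar>\<xi>\<bar> \<le> 2 ^ (2 * n) \<and> \<bar>\<eta>\<bar> \<le> 2 ^ n
     then (cis (t * \<xi>) - 1) / complex_of_real (\<bar>\<xi>\<bar> powr (H0 + 1/2)) *
          ((cis (x * \<eta>) - 1) / complex_of_real (\<bar>\<eta>\<bar> powr (H1 + 1/2)))
     else 0)"

text \<open>\<open>\<partial>\<^sub>t \<partial>\<^sub>x b\<close> for a field \<open>b\<close> on the plane, with arguments \<open>b t x\<close>.\<close>

definition mixed_deriv :: "(real \<Rightarrow> real \<Rightarrow> complex) \<Rightarrow> real \<Rightarrow> real \<Rightarrow> complex" where
  "mixed_deriv b t x = vector_derivative (\<lambda>s. vector_derivative (b s) (at x)) (at t)"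

definition has_continuous_mixed_deriv :: "(real \<Rightarrow> real \<Rightarrow> complex) \<Rightarrow> bool" where
  "has_continuous_mixed_deriv b \<longleftrightarrow>
     (\<forall>t x. b t differentiable (at x)) \<and>
     (\<forall>t x. (\<lambda>s. vector_derivative (b s) (at x)) differentiable (at t)) \<and>
     continuous_on UNIV (\<lambda>(t, x). mixed_deriv b t x)"

text \<open>
  The stochastic integral defining \<open>B\<^sup>(\<^sup>n\<^sup>)(t,x)\<close> is only determined up to a null set depending on
  \<open>(t,x)\<close>. As the kernel is band-limited, there is a version with smooth paths, and this is the one
  meant when the mixed derivative is taken. Continuity makes it unique up to indistinguishability.
\<close>

definition sheet_approx ::
    "'a measure \<Rightarrow> ((real \<times> real \<Rightarrow> complex) \<Rightarrow> 'a \<Rightarrow> complex) \<Rightarrow> real \<Rightarrow> real \<Rightarrow> real \<Rightarrow> nat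
      \<Rightarrow> ('a \<Rightarrow> real \<Rightarrow> real \<Rightarrow> complex) \<Rightarrow> bool" where
  "sheet_approx M What c H0 H1 n B \<longleftrightarrow>
     (\<forall>t x. AE \<omega> in M. B \<omega> t x = complex_of_real c * What (sheet_kernel H0 H1 n t x) \<omega>) \<and>
     (AE \<omega> in M. continuous_on UNIV (\<lambda>(t, x). B \<omega> t x) \<and> has_continuous_mixed_deriv (B \<omega>))"

definition cutoff :: "(real \<Rightarrow> real) \<Rightarrow> bool" where
  "cutoff chi \<longleftrightarrow>
     (\<forall>j t. (deriv ^^ j) chi differentiable (at t)) \<and>
     (\<forall>t. 0 \<le> chi t \<and> chi t \<le> 1) \<and>
     (\<forall>t. chi (- t) = chi t) \<and>
     (\<forall>t. \<bar>t\<bar> \<le> 1 \<longrightarrow> chi t = 1) \<and>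
     (\<forall>t. 2 \<le> \<bar>t\<bar> \<longrightarrow> chi t = 0)"

text \<open>
  The Fourier coefficients of \<open>\<Psi>(t) = - \<i> chi(t) \<integral>\<^sub>0\<^sup>t chi(r) e\<^sup>i\<^sup>r\<^sup>\<Delta> \<partial>\<^sub>t \<partial>\<^sub>x b(r) dr\<close> for a path \<open>b\<close>.
  The noise is not periodic in space; it is seen on the torus through its coefficients on \<open>[0, 2\<pi>]\<close>.
\<close>

definition Psi :: "(real \<Rightarrow> real) \<Rightarrow> (real \<Rightarrow> real \<Rightarrow> complex) \<Rightarrow> real \<Rightarrow> torus_distr" where
  "Psi chi b t k = - \<i> * complex_of_real (chi t) *
     (LBINT r=0..t. complex_of_real (chi r) * cis (- (r * (real_of_int k)\<^sup>2)) *
        fourier_coeff (mixed_deriv b r) k)"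

end

theory Submission
  imports Defs
begin

text \<open>
  The process \<open>\<Psi>\<^sub>k(t)\<close> at level \<open>n\<close> is the stochastic integral of an explicit kernel, the product of
  the amplitude \<open>|\<xi>|^(1/2 - H0) |\<eta>|^(1/2 - H1)\<close> cut off at level \<open>n\<close>, of a window in \<open>\<eta>\<close> which decays
  like \<open>1/|\<eta> - k|\<close>, and of an oscillatory integral which decays like \<open>1/|\<xi> - k^2|\<close>. Hence
  \<open>E|\<Psi>\<^sub>k(t)|^2\<close> is of order \<open>k^(2(1 - 2 H0) + 1 - 2 H1)\<close>, and its sum over \<open>k\<close> with weights \<open>k^(-2\<alpha>)\<close>
  converges exactly when \<open>\<alpha> > 2 - (2 H0 + H1)\<close>. Integrating only over the resonant set
  \<open>|\<xi> - k^2| \<le> 1/2\<close>, \<open>|\<eta> - k| \<le> 1/16\<close> gives the lower bound needed for (ii).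

  For (i), the increment from level \<open>n\<close> to level \<open>n + 1\<close> is split into dyadic frequency blocks \<open>j\<close>. At
  each point \<open>(t, x)\<close> the block has variance at most \<open>C 2^(-\<kappa>(n + j))\<close>. Gaussian moments of high order
  turn this into a summable bound for the maximum over a grid with \<open>2^O(n + j)\<close> points, hence into
  almost sure uniform convergence in \<open>(t, x)\<close>, which gives all \<open>p\<close> simultaneously. That the norm of
  \<open>W\<^sup>s\<^sup>,\<^sup>p\<close> may be read off this particular representative rests on the uniqueness of Fourier
  coefficients of integrable functions.
\<close>

section \<open>Uniqueness of Fourier coefficients\<close>

text \<open>The critical exponent is the value of \<alpha> at which the sum over k of k^(-2 \<alpha>
  + 2 (1 - 2 H0) + 1 - 2 H1) becomes harmonic. Two obstacles shape the upper bound. The noise is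
  read off one period of a field that is not periodic, so different k are correlated and sums over k
  cannot be treated by orthogonality. Moreover \<Psi> is defined path by path, through derivatives
  and integrals of a version of the sheet that agrees with stochastic integrals only almost surely
  at each point (t, x). Each derivative or integral is therefore approached by finite linear
  combinations, which commute with the white noise almost surely, and an L^2 envelope of the kernels
  identifies the limit. Completeness of the probability space makes such versions measurable.
  Between grid points the paths are controlled deterministically by the square integral of the noise
  coefficients over [-2, 2], whose mean grows only exponentially in n. Almost sure summability is
  deduced from finite expectation of the whole double series.\<close>

lemma sets_torus [measurable_cong, simp]: "sets torus = sets borel"
  by (simp add: torus_def)

lemma space_torus [simp]: "space torus = UNIV"
  by (simp add: torus_def)

lemma torus_density:
  "torus = density lborel (\<lambda>x. ennreal (indicator {0..2*pi} x / (2*pi)))"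
proof -
  have "indicator {0..2*pi} x / emeasure lborel {0..2*pi} = ennreal (indicator {0..2*pi} x /
    (2*pi))" for x
    by (auto simp: indicator_def divide_ennreal[symmetric] ennreal_1[symmetric] simp del: ennreal_1)
  then show ?thesis unfolding torus_def uniform_measure_def by simp
qed

interpretation torus: prob_space torus
  unfolding torus_def by (rule prob_space_uniform_measure) auto

lemma integral_torus:
  fixes f :: "real \<Rightarrow> 'b::{banach, second_countable_topology}"
  assumes [measurable]: "f \<in> borel_measurable borel"
  shows "(LINT x|torus. f x) = (1 / (2*pi)) *\<^sub>R (LBINT x:{0..2*pi}. f x)"
proof -
  have "(LINT x|torus. f x) = (LINT x|lborel. (indicator {0..2*pi} x / (2*pi)) *\<^sub>R f x)"
    unfolding torus_density by (subst integral_density) auto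
  also have "\<dots> = (LINT x|lborel. (1/(2*pi)) *\<^sub>R (indicator {0..2*pi} x *\<^sub>R f x))"
    by (simp add: field_simps)
  also have "\<dots> = (1 / (2*pi)) *\<^sub>R (LBINT x:{0..2*pi}. f x)"
    unfolding set_lebesgue_integral_def by (rule integral_scaleR_right)
  finally show ?thesis .
qed

lemma AE_torus: "(AE x in torus. P x) \<longleftrightarrow> (AE x in lborel. x \<in> {0..2*pi} \<longrightarrow> P x)"
  unfolding torus_density by (subst AE_density) (auto simp: indicator_def)

lemma fourier_coeff_torus:
  assumes [measurable]: "f \<in> borel_measurable borel"
  shows "fourier_coeff f k = (LINT x|torus. cis (- (real_of_int k * x)) * f x)"
proof -
  have [measurable]: "cis \<in> borel_measurable borel"
    by (intro borel_measurable_continuous_onI continuous_intros)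
  have "(LBINT x=0..2 * pi. cis (- (real_of_int k * x)) * f x)
    = (LBINT x:{0..2*pi}. cis (- (real_of_int k * x)) * f x)"
    using interval_integral_Icc[of 0 "2*pi" "\<lambda>x. cis (- (real_of_int k * x)) * f x"]
      by (simp add: zero_ereal_def)
  then show ?thesis
    unfolding fourier_coeff_def by (subst integral_torus) (auto simp: scaleR_conv_of_real)
qed

text \<open>The sign in the exponent is immaterial because \<open>k\<close> runs over all integers.
  Integrability is included so that the class is stable under characters and linear
  combinations.\<close>

definition fourier_null :: "(real \<Rightarrow> complex) \<Rightarrow> bool" where
  "fourier_null f \<longleftrightarrow> integrable torus f \<and> (\<forall>k::int. (LINT x|torus. cis (real_of_int k * x) * f x)
    = 0)"

lemma cis_measurable [measurable]: "cis \<in> borel_measurable borel"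
  by (intro borel_measurable_continuous_onI continuous_intros)

lemma integrable_cis_mult:
  assumes "integrable torus f"
  shows "integrable torus (\<lambda>x. cis (a * x) * f x)"
  by (rule Bochner_Integration.integrable_bound[OF assms]) (use assms in \<open>auto simp: norm_mult\<close>)

lemma fourier_null_cis:
  assumes "fourier_null f" shows "fourier_null (\<lambda>x. cis (real_of_int j * x) * f x)"
proof -
  have "cis (real_of_int k * x) * (cis (real_of_int j * x) * f x) = cis (real_of_int (k+j) * x) * f
    x" for k x
    by (simp add: cis_mult[symmetric] ring_distribs mult.assoc)
  then have "(LINT x|torus. cis (real_of_int k * x) * (cis (real_of_int j * x) * f x))
    = (LINT x|torus. cis (real_of_int (k+j) * x) * f x)" for k
    by (simp only:)
  then show ?thesis using assms unfolding fourier_null_def by (simp only: integrable_cis_mult) simp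
qed

lemma fourier_null_lin:
  assumes f: "fourier_null f" and g: "fourier_null g" shows "fourier_null (\<lambda>x. a * f x + b * g x)"
proof -
  have i: "integrable torus (\<lambda>x. cis (real_of_int k * x) * f x)" "integrable torus
    (\<lambda>x. cis (real_of_int k * x) * g x)" for k
    using f g by (auto simp: fourier_null_def intro!: integrable_cis_mult)
  have "(LINT x|torus. cis (real_of_int k * x) * (a * f x + b * g x)) =
     (LINT x|torus. a * (cis (real_of_int k * x) * f x) + b * (cis (real_of_int k * x) * g x))" for
       k
    by (simp add: algebra_simps)
  also have "\<dots> k = a * (LINT x|torus. cis (real_of_int k * x) * f x)
    + b * (LINT x|torus. cis (real_of_int k * x) * g x)" for k
    using i by simp
  finally show ?thesis using f g by (simp add: fourier_null_def)
qed

text \<open>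
  The set of functions which preserve \<^const>\<open>fourier_null\<close> under multiplication is an algebra, so it is
  enough to treat linear functions of \<open>cis x\<close>; Stone--Weierstrass then gives all continuous ones.
\<close>

lemma fourier_null_polynomial:
  fixes g :: "complex \<Rightarrow> real"
  assumes "real_polynomial_function g"
  shows "fourier_null f \<Longrightarrow> fourier_null (\<lambda>x. of_real (g (cis x)) * f x)"
  using assms
proof (induction arbitrary: f)
  case (linear h)
  interpret h: bounded_linear h by fact
  \<comment> \<open>A real-linear \<open>h\<close> sends \<open>cis x\<close> to h(1) cos x +
    h(\<i>) sin x; Euler's formulas turn this into the characters of frequency 1 and -1.\<close>
  have *: "of_real (h (cis x)) * f x =
     ((of_real (h 1) - \<i> * of_real (h \<i>)) / 2) * (cis (real_of_int 1 * x) * f x) +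
     ((of_real (h 1) + \<i> * of_real (h \<i>)) / 2) * (cis (real_of_int (-1) * x) * f x)" for x
  proof -
    have "cis x = cos x *\<^sub>R 1 + sin x *\<^sub>R \<i>" by (simp add: complex_eq_iff)
    then have "h (cis x) = cos x * h 1 + sin x * h \<i>" by (simp only: h.add h.scaleR) simp
    then show ?thesis by (simp add: complex_eq_iff) (simp add: field_simps)
  qed
  show ?case unfolding * by (intro fourier_null_lin fourier_null_cis linear)
next
  case (const c)
  then show ?case using fourier_null_lin[OF const const, of "of_real c" 0] by simp
next
  case (add g h)
  then show ?case using fourier_null_lin[OF add.IH(1)[OF add.prems] add.IH(2)[OF add.prems], of 1 1]
    by (simp add: algebra_simps)
next
  case (mult g h)
  then show ?case using mult.IH(1)[OF mult.IH(2)[OF mult.prems]] by (simp add: mult.assoc)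
qed

lemma fourier_null_continuous:
  fixes \<phi> :: "complex \<Rightarrow> real"
  assumes f: "fourier_null f" and c: "continuous_on UNIV \<phi>"
  shows "(LINT x|torus. of_real (\<phi> (cis x)) * f x) = 0"
proof -
  have i: "integrable torus f" using f by (simp add: fourier_null_def)
  have c': "continuous_on (sphere 0 1) \<phi>" using c continuous_on_subset by blast
  have [measurable]: "\<phi> \<in> borel_measurable borel" using c by (rule borel_measurable_continuous_onI)
  have bd: "bounded (\<phi> ` sphere 0 1)"
    using compact_continuous_image[OF c'] compact_imp_bounded by auto
  then obtain C where C: "\<And>z. cmod z = 1 \<Longrightarrow> \<bar>\<phi> z\<bar> \<le> C" by (force simp: bounded_iff)
  have ip: "integrable torus (\<lambda>x. of_real (\<phi> (cis x)) * f x)"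
    by (rule Bochner_Integration.integrable_bound[of _ "\<lambda>x. C *\<^sub>R norm (f x)"])
       (use i C in \<open>auto simp: norm_mult abs_mult intro!: mult_right_mono AE_I2 order_trans[OF C]\<close>)
  \<comment> \<open>A polynomial within \<open>e\<close> of \<phi> on the unit circle changes the
    integral by at most \<open>e\<close> times the L^1 norm of \<open>f\<close>, and its own
    integral against \<open>f\<close> vanishes.\<close>
  have "norm (LINT x|torus. of_real (\<phi> (cis x)) * f x) \<le> e * (LINT x|torus. norm (f x))" if
    "e > 0" for e
  proof -
    obtain g where g: "real_polynomial_function g" "\<And>x. x \<in> sphere 0 1 \<Longrightarrow> \<bar>\<phi> x - g x\<bar> < e"
      using Stone_Weierstrass_real_polynomial_function[OF _ c' \<open>e > 0\<close>] by auto
    have gn: "fourier_null (\<lambda>x. of_real (g (cis x)) * f x)"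
      by (rule fourier_null_polynomial[OF g(1) f])
    then have ig: "integrable torus (\<lambda>x. of_real (g (cis x)) * f x)"
      and "(LINT x|torus. cis (real_of_int 0 * x) * (of_real (g (cis x)) * f x)) = 0"
        unfolding fourier_null_def by blast+
    then have z: "(LINT x|torus. of_real (g (cis x)) * f x) = 0" by simp
    have "(LINT x|torus. of_real (\<phi> (cis x)) * f x) = (LINT x|torus. of_real (\<phi> (cis x)) * f x -
      of_real (g (cis x)) * f x)"
      using ip ig z by simp
    also have "norm \<dots> \<le> (LINT x|torus. norm (of_real (\<phi> (cis x)) * f x - of_real (g (cis x)) * f
      x))"
      by (rule integral_norm_bound)
    also have "\<dots> \<le> (LINT x|torus. e * norm (f x))"
    proof (rule integral_mono)
      fix x
      have "norm (of_real (\<phi> (cis x)) * f x - of_real (g (cis x)) * f x) = \<bar>\<phi> (cis x) - g (cis x)\<bar> *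
        norm (f x)"
        by (metis left_diff_distrib norm_mult norm_of_real of_real_diff real_norm_def)
      then show "norm (of_real (\<phi> (cis x)) * f x - of_real (g (cis x)) * f x) \<le> e * norm (f x)"
        using g(2)[of "cis x"] by (auto intro!: mult_right_mono)
    qed (use i ip ig in auto)
    finally show ?thesis by simp
  qed
  note b = this
  show ?thesis
  proof (rule ccontr)
    assume n: "(LINT x|torus. of_real (\<phi> (cis x)) * f x) \<noteq> 0"
    let ?I = "LINT x|torus. norm (f x)" and ?N = "norm (LINT x|torus. of_real (\<phi> (cis x)) * f x)"
    have I0: "0 \<le> ?I" by (rule Bochner_Integration.integral_nonneg) simp
    \<comment> \<open>This value of \<open>e\<close> forces \<open>?N\<close> below its own half;
      the added 1 keeps the denominator positive when \<open>?I\<close> is zero.\<close>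
    have "?N \<le> ?N / (2 * (?I + 1)) * ?I"
      by (rule b) (use n I0 in \<open>simp add: add_nonneg_pos\<close>)
    moreover have "?N / (2 * (?I + 1)) * ?I \<le> ?N / 2"
    proof -
      have "y / (y+1) \<le> 1" if "0 \<le> y" for y :: real using that by (simp add: divide_le_eq)
      then have "?I / (?I+1) \<le> 1" using I0 by blast
      then have "?N/2 * (?I / (?I+1)) \<le> ?N/2 * 1" by (intro mult_left_mono) auto
      then show ?thesis by simp
    qed
    ultimately have "?N \<le> ?N / 2" by (rule order_trans)
    then show False using n by simp
  qed
qed

text \<open>The indicator of an open arc is the increasing limit of min 1 (m d), where d is the
  distance to the complementary closed arc. These are continuous on the circle, so dominated
  convergence applies.\<close>

lemma fourier_null_interval:
  assumes f: "fourier_null f" and ab: "0 \<le> a" "b \<le> 2 * pi"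
  shows "(LINT x:{a<..<b}|torus. f x) = 0"
proof -
  have i: "integrable torus f" using f by (simp add: fourier_null_def)
  define C where "C = cis ` ({0..a} \<union> {b..2*pi})"
  have "compact C" unfolding C_def by (intro compact_continuous_image compact_Un continuous_intros)
    auto
  then have cl: "closed C" by (rule compact_imp_closed)
  show ?thesis
  proof (cases "a < b")
    case False then show ?thesis by (simp add: set_lebesgue_integral_def)
  next
    case True
    have ne: "C \<noteq> {}" using True ab by (auto simp: C_def)
    \<comment> \<open>Within one period \<open>cis\<close> identifies only 0 and 2 pi, and both lie
      outside the open interval; hence \<open>C\<close> separates the interval from its
      complement.\<close>
    have mem: "cis x \<in> C \<longleftrightarrow> x \<notin> {a<..<b}" if "x \<in> {0..2*pi}" for x
    proof
      assume "x \<notin> {a<..<b}" then show "cis x \<in> C" using that by (auto simp: C_def)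
    next
      assume "cis x \<in> C"
      then obtain y where y: "y \<in> {0..a} \<union> {b..2*pi}" "cis x = cis y" unfolding C_def by blast
      show "x \<notin> {a<..<b}"
      proof
        assume x: "x \<in> {a<..<b}"
        from y(2) have "sin x = sin y \<and> cos x = cos y" by (simp add: complex_eq_iff)
        then obtain n where n: "x = y + 2 * pi * real_of_int n" using sin_cos_eq_iff by blast
        have "\<bar>x - y\<bar> < 2*pi" using x y(1) ab by auto
        then have "\<bar>of_int n\<bar> * (2*pi) < 1 * (2*pi)" using n by (simp add: abs_mult)
        then have "\<bar>of_int n :: real\<bar> < 1" by (subst (asm) mult_less_cancel_right_pos) auto
        then have "n = 0" by linarith
        then show False using n x y(1) by auto
      qed
    qed
    let ?p = "\<lambda>m::nat. \<lambda>z. min 1 (real m * infdist z C)"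
    have lim: "(\<lambda>m. LINT x|torus. of_real (?p m (cis x)) * f x) \<longlonglongrightarrow> (LINT x|torus. indicator {a<..<b}
      x *\<^sub>R f x)"
    proof (rule integral_dominated_convergence[where w="\<lambda>x. norm (f x)"])
      have [measurable]: "(\<lambda>z. infdist z C) \<in> borel_measurable borel"
        by (intro borel_measurable_continuous_onI continuous_intros)
      show "(\<lambda>x. of_real (?p m (cis x)) * f x) \<in> borel_measurable torus" for m using i by measurable
      show "AE x in torus. (\<lambda>m. of_real (?p m (cis x)) * f x) \<longlonglongrightarrow> indicator {a<..<b} x *\<^sub>R f x"
        unfolding AE_torus
      proof (rule AE_I2, rule impI)
        fix x assume x: "x \<in> {0..2*pi}"
        show "(\<lambda>m. of_real (?p m (cis x)) * f x) \<longlonglongrightarrow> indicator {a<..<b} x *\<^sub>R f x"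
        proof (cases "x \<in> {a<..<b}")
          case False
          then have "infdist (cis x) C = 0" using mem[OF x] by simp
          then show ?thesis using False by simp
        next
          case True
          then have "infdist (cis x) C > 0" using mem[OF x] infdist_pos_not_in_closed[OF cl ne]
            by simp
          then obtain N :: nat where N: "1 < real N * infdist (cis x) C" using reals_Archimedean3
            by blast
          have "eventually (\<lambda>m. of_real (?p m (cis x)) * f x = indicator {a<..<b} x *\<^sub>R f x)
            sequentially"
            using eventually_ge_at_top[of N]
          proof eventually_elim
            case (elim m)
            have "1 \<le> real m * infdist (cis x) C"
              using N mult_right_mono[of "real N" "real m" "infdist (cis x) C"] elim infdist_nonneg
                by fastforce
            then show ?case using True by (simp add: min_def)
          qed
          then show ?thesis by (rule tendsto_eventually)
        qed
      qed
      show "AE x in torus. norm (of_real (?p m (cis x)) * f x) \<le> norm (f x)" for m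
      proof (rule AE_I2)
        fix x
        have "\<bar>?p m (cis x)\<bar> \<le> 1" by (simp add: infdist_nonneg min_def)
        then show "norm (of_real (?p m (cis x)) * f x) \<le> norm (f x)"
          by (simp only: norm_mult norm_of_real real_norm_def) (metis mult_left_le_one_le
            norm_ge_zero abs_ge_zero)
      qed
    qed (use i in auto)
    have z: "(LINT x|torus. of_real (?p m (cis x)) * f x) = 0" for m
      by (rule fourier_null_continuous[OF f]) (intro continuous_intros)
    have "(LINT x|torus. indicator {a<..<b} x *\<^sub>R f x) = 0"
      using lim unfolding z LIMSEQ_const_iff by (rule sym)
    then show ?thesis by (simp add: set_lebesgue_integral_def)
  qed
qed

text \<open>The Borel sets over which \<open>f\<close> integrates to zero include the intervals and
  are closed under complements and disjoint countable unions, so they are all Borel sets. An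
  integrable function with zero integral over every set vanishes almost everywhere.\<close>

lemma fourier_null_AE_zero:
  assumes f: "fourier_null f" shows "AE x in torus. f x = 0"
proof -
  have i: "integrable torus f" using f by (simp add: fourier_null_def)
  have tot: "(LINT x:{a..b}|torus. f x) = 0" for a b
  proof -
    \<comment> \<open>Endpoints are null and the measure has no mass outside the period, so the
      interval may be clipped and opened.\<close>
    have "(LINT x:{a..b}|torus. f x) = (LINT x:{max 0 a<..<min (2*pi) b}|torus. f x)"
      unfolding set_lebesgue_integral_def
    proof (rule integral_cong_AE)
      have "AE x in lborel. x \<notin> {0, 2*pi, a, b}"
        by (rule AE_not_in) (auto simp: null_sets_def emeasure_lborel_countable)
      then show "AE x in torus. indicat_real {a..b} x *\<^sub>R f x
        = indicat_real {max 0 a<..<min (2 * pi) b} x *\<^sub>R f x"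
        unfolding AE_torus by eventually_elim (auto simp: indicator_def)
    qed (use i in measurable)
    then show ?thesis using fourier_null_interval[OF f] by simp
  qed
  have total: "(LINT x|torus. f x) = 0"
    using f[unfolded fourier_null_def, THEN conjunct2, rule_format, of 0] by simp
  have "(LINT x:A|torus. f x) = 0" if "A \<in> sets borel" for A
    using that
  proof (induction rule: borel_set_induct)
    case empty show ?case by (simp add: set_lebesgue_integral_def)
  next
    case (interval a b) show ?case by (rule tot)
  next
    case (compl A)
    have "(LINT x:-A|torus. f x) = (LINT x|torus. f x - indicator A x *\<^sub>R f x)"
      unfolding set_lebesgue_integral_def by (rule Bochner_Integration.integral_cong)
        (auto simp: indicator_def)
    also have "\<dots> = (LINT x|torus. f x) - (LINT x:A|torus. f x)"
      unfolding set_lebesgue_integral_def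
      by (rule Bochner_Integration.integral_diff)
        (use i compl in \<open>auto intro!: integrable_mult_indicator\<close>)
    finally show ?case using compl total by simp
  next
    case (union A)
    have "(LINT x:(\<Union>n. A n)|torus. f x) = (\<Sum>n. (LINT x:A n|torus. f x))"
      using union(1,2) i by (intro lebesgue_integral_countable_add)
        (auto simp: disjoint_family_on_def set_integrable_def intro!: integrable_mult_indicator)
    then show ?case using union by simp
  qed
  then show ?thesis using torus.density_zero[OF i] by simp
qed

text \<open>This makes the choice inside \<open>sobolev_norm\<close> harmless: two admissible
  representatives differ only on a null set.\<close>

lemma fourier_coeff_inj_AE:
  assumes f: "integrable torus f" and g: "integrable torus g" and eq: "fourier_coeff f
    = fourier_coeff g"
  shows "AE x in torus. f x = g x"
proof -
  have [measurable]: "f \<in> borel_measurable borel" "g \<in> borel_measurable borel"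
    using borel_measurable_integrable[OF f] borel_measurable_integrable[OF g] by auto
  have "(LINT x|torus. cis (real_of_int k * x) * f x - cis (real_of_int k * x) * g x) =
    fourier_coeff f (-k) - fourier_coeff g (-k)" for k
    using integrable_cis_mult[OF f, of "real_of_int k"] integrable_cis_mult[OF g, of
      "real_of_int k"] by (simp add: fourier_coeff_torus)
  then have "fourier_null (\<lambda>x. f x - g x)"
    using f g eq by (simp add: fourier_null_def right_diff_distrib)
  from fourier_null_AE_zero[OF this] show ?thesis by simp
qed

section \<open>Sobolev spaces and uniform convergence\<close>

lemma integral_cis_torus:
  "(LINT x|torus. cis (real_of_int m * x)) = (if m = 0 then 1 else 0)"
proof (cases "m = 0")
  case False
  have d: "((\<lambda>x. cis (real_of_int m * x) / (\<i> * of_int m)) has_vector_derivative cis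
    (real_of_int m * x)) (at x within {0..2*pi})" for x
  proof -
    have "((\<lambda>x. cis (real_of_int m * x)) has_vector_derivative (real_of_int m *\<^sub>R
      (\<i> * cis (real_of_int m * x)))) (at x within {0..2*pi})"
      unfolding has_vector_derivative_def
      by (auto intro!: derivative_eq_intros simp: scaleR_conv_of_real)
    from has_vector_derivative_divide[OF this, of "\<i> * of_int m"] show ?thesis using False
      by (simp add: scaleR_conv_of_real)
  qed
  have "(LINT x|lborel. indicator {0..2*pi} x *\<^sub>R cis (real_of_int m * x)) =
     cis (real_of_int m * (2*pi)) / (\<i> * of_int m) - cis (real_of_int m * 0) / (\<i> * of_int m)"
    by (rule integral_FTC_atLeastAtMost[OF _ d]) (auto intro!: continuous_intros)
  also have "cis (real_of_int m * (2*pi)) = 1"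
    using cis_multiple_2pi[of "real_of_int m"] by (simp add: mult.commute)
  finally have "(LINT x:{0..2*pi}|lborel. cis (real_of_int m * x)) = 0"
    unfolding set_lebesgue_integral_def by simp
  then show ?thesis using False by (subst integral_torus) auto
qed (simp add: torus.prob_space[simplified])

lemma integrable_torus_bounded:
  fixes f :: "real \<Rightarrow> complex"
  assumes "f \<in> borel_measurable borel" "\<And>x. cmod (f x) \<le> C"
  shows "integrable torus f"
  by (rule torus.integrable_const_bound[of _ C]) (use assms in auto)

lemma fourier_coeff_diff_le:
  assumes f: "integrable torus f" and g: "integrable torus g" and le: "\<And>x. cmod (f x - g x) \<le> e"
  shows "cmod (fourier_coeff f k - fourier_coeff g k) \<le> e"
proof -
  have [measurable]: "f \<in> borel_measurable borel" "g \<in> borel_measurable borel"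
    using borel_measurable_integrable[OF f] borel_measurable_integrable[OF g] by auto
  have i: "integrable torus (\<lambda>x. cis (- (real_of_int k * x)) * f x)" "integrable torus
    (\<lambda>x. cis (- (real_of_int k * x)) * g x)"
    using integrable_cis_mult[OF f, of "- real_of_int k"] integrable_cis_mult[OF g, of
      "- real_of_int k"] by auto
  have "fourier_coeff f k - fourier_coeff g k = (LINT x|torus. cis (- (real_of_int k * x)) * f x -
    cis (- (real_of_int k * x)) * g x)"
    using i by (simp add: fourier_coeff_torus)
  also have "cmod \<dots> \<le> (LINT x|torus. cmod (cis (- (real_of_int k * x)) * f x - cis
    (- (real_of_int k * x)) * g x))"
    by (rule integral_norm_bound)
  also have "\<dots> \<le> (LINT x|torus. e)"
  proof (rule integral_mono)
    fix x
    have "cmod (cis (- (real_of_int k * x)) * f x - cis (- (real_of_int k * x)) * g x)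
      = cmod (f x - g x)"
      by (metis mult.left_neutral norm_cis norm_mult right_diff_distrib)
    then show "cmod (cis (- (real_of_int k * x)) * f x - cis (- (real_of_int k * x)) * g x) \<le> e"
      using le by simp
  qed (use i in auto)
  also have "\<dots> = e" by (simp add: torus.prob_space[simplified])
  finally show ?thesis .
qed

lemma fourier_coeff_zero [simp]: "fourier_coeff (\<lambda>x. 0) k = 0"
  by (simp add: fourier_coeff_def)

lemma fourier_coeff_trig:
  assumes "finite K"
  shows "fourier_coeff (\<lambda>x. \<Sum>k\<in>K. c k * cis (real_of_int k * x)) m = (if m \<in> K then c m else 0)"
proof -
  have "fourier_coeff (\<lambda>x. \<Sum>k\<in>K. c k * cis (real_of_int k * x)) m =
     (LINT x|torus. (\<Sum>k\<in>K. c k * cis (real_of_int (k - m) * x)))"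
    by (subst fourier_coeff_torus, measurable)
       (intro Bochner_Integration.integral_cong refl,
         auto simp: sum_distrib_left cis_mult algebra_simps intro!: sum.cong)
  also have "\<dots> = (\<Sum>k\<in>K. c k * (LINT x|torus. cis (real_of_int (k - m) * x)))"
    by (subst Bochner_Integration.integral_sum)
       (auto intro!: integrable_torus_bounded[where C="cmod (c k)" for k] simp: norm_mult simp del:
         of_int_diff)
  also have "\<dots> = (\<Sum>k\<in>K. if k = m then c k else 0)"
    by (intro sum.cong refl, subst integral_cis_torus) auto
  finally show ?thesis using assms by (simp add: sum.delta)
qed

lemma bracket_ge_1: "1 \<le> bracket k"
  by (simp add: bracket_def)

text \<open>The measure is finite, so y \<le> 1 + y^r for r \<ge> 1 is enough.\<close>

lemma Lp_integrable:
  assumes p: "1 \<le> p" and f: "f \<in> Lp p"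
  shows "integrable torus f"
proof (cases "p = \<infinity>")
  case True
  then obtain C where "AE x in torus. cmod (f x) \<le> C" "f \<in> borel_measurable torus" using f
    by (auto simp: Lp_def)
  then show ?thesis by (intro torus.integrable_const_bound[of _ C]) auto
next
  case False
  with p obtain r where r: "p = ereal r" "1 \<le> r" by (cases p) auto
  have i: "integrable torus (\<lambda>x. cmod (f x) powr r)" and m: "f \<in> borel_measurable torus"
    using f r by (auto simp: Lp_def)
  show ?thesis
  proof (rule Bochner_Integration.integrable_bound[of _ "\<lambda>x. 1 + cmod (f x) powr r"])
    show "AE x in torus. cmod (f x) \<le> norm (1 + cmod (f x) powr r)"
    proof (rule AE_I2)
      fix x
      show "cmod (f x) \<le> norm (1 + cmod (f x) powr r)"
      proof (cases "cmod (f x) \<le> 1")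
        case True then show ?thesis by (auto intro: order_trans)
      next
        case False
        then have "cmod (f x) powr 1 \<le> cmod (f x) powr r" using r by (intro powr_mono) auto
        then show ?thesis using False by simp
      qed
    qed
  qed (use i m in auto)
qed

text \<open>The representative selected by \<open>SOME\<close> has the coefficients of the bounded
  function \<open>F\<close>, hence equals it almost everywhere. As the measure has mass one, a
  uniform bound controls all L^p norms with constant one; this is how all \<open>p\<close> are
  handled together.\<close>

lemma sobolev_normI:
  assumes p: "1 \<le> p" and m [measurable]: "F \<in> borel_measurable borel" and le: "\<And>x. cmod (F x) \<le> C"
    and eq: "fourier_coeff F = bessel s u"
  shows "u \<in> sobolev s p" "0 \<le> sobolev_norm s p u" "sobolev_norm s p u \<le> C"
proof -
  have C0: "0 \<le> C" using le[of 0] norm_ge_zero order_trans by blast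
  have iF: "integrable torus F" by (rule integrable_torus_bounded[OF m le])
  have FL: "F \<in> Lp p"
  proof (cases "p = \<infinity>")
    case True then show ?thesis using le by (auto simp: Lp_def)
  next
    case False
    with p obtain r where r: "p = ereal r" "1 \<le> r" by (cases p) auto
    have "integrable torus (\<lambda>x. cmod (F x) powr r)"
      by (rule torus.integrable_const_bound[of _ "C powr r"]) (use le r in \<open>auto intro!: powr_mono2
        AE_I2\<close>)
    then show ?thesis using r by (simp add: Lp_def)
  qed
  \<comment> \<open>Coefficients of a bounded function are bounded, so undoing the Bessel weight
    costs at most the power ceiling of |s| of the bracket, and \<open>u\<close> is tempered.\<close>
  have b: "cmod (u k) \<le> C * bracket k ^ nat \<lceil>\<bar>s\<bar>\<rceil>" for k
  proof -
    have "cmod (bessel s u k) \<le> C"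
      using fourier_coeff_diff_le[OF iF, of "\<lambda>_. 0" C k] le eq by simp
    then have "bracket k powr s * cmod (u k) \<le> C" by (simp add: bessel_def norm_mult)
    then have "bracket k powr (-s) * (bracket k powr s * cmod (u k)) \<le> bracket k powr (-s) * C"
      by (intro mult_left_mono) auto
    moreover have "bracket k powr (-s) * (bracket k powr s * cmod (u k)) = cmod (u k)"
      using bracket_ge_1[of k] by (simp add: mult.assoc[symmetric] powr_add[symmetric])
    moreover have "bracket k powr (-s) \<le> bracket k powr real (nat \<lceil>\<bar>s\<bar>\<rceil>)"
      using bracket_ge_1[of k] by (intro powr_mono) linarith+
    moreover have "bracket k powr real (nat \<lceil>\<bar>s\<bar>\<rceil>) = bracket k ^ nat \<lceil>\<bar>s\<bar>\<rceil>"
      using bracket_ge_1[of k] by (subst powr_realpow) auto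
    ultimately show ?thesis using mult_right_mono[OF _ C0] by (metis mult.commute order_trans)
  qed
  then have "tempered u" unfolding tempered_def by blast
  then show "u \<in> sobolev s p" using FL eq by (auto simp: sobolev_def)
  define f where "f = (SOME f. f \<in> Lp p \<and> fourier_coeff f = bessel s u)"
  have f: "f \<in> Lp p \<and> fourier_coeff f = bessel s u"
    unfolding f_def by (rule someI[of _ F]) (use FL eq in simp)
  have i: "integrable torus f" using Lp_integrable[OF p] f by blast
  then have [measurable]: "f \<in> borel_measurable borel" using borel_measurable_integrable by force
  have "AE x in torus. f x = F x" by (rule fourier_coeff_inj_AE[OF i iF]) (use f eq in simp)
  then have ae: "AE x in torus. cmod (f x) \<le> C" by eventually_elim (use le in simp)
  have norm: "sobolev_norm s p u = Lp_norm p f" by (simp add: sobolev_norm_def f_def)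
  have "0 \<le> Lp_norm p f \<and> Lp_norm p f \<le> C"
  proof (cases "p = \<infinity>")
    case True
    let ?e = "esssup torus (\<lambda>x. ereal (cmod (f x)))"
    have 1: "?e \<le> ereal C" by (rule esssup_I) (use ae in auto)
    have "esssup torus (\<lambda>x. 0::ereal) \<le> ?e" by (rule esssup_mono) auto
    moreover have "esssup torus (\<lambda>x. 0::ereal) = 0"
      by (rule esssup_const) (use torus.emeasure_space_1 in simp)
    ultimately have 2: "0 \<le> ?e" by simp
    show ?thesis using 1 2 True by (cases ?e) (auto simp: Lp_norm_def)
  next
    case False
    with p obtain r where r: "p = ereal r" "1 \<le> r" by (cases p) auto
    have i: "integrable torus (\<lambda>x. cmod (f x) powr r)" using f r by (auto simp: Lp_def)
    have "(LINT x|torus. cmod (f x) powr r) \<le> (LINT x|torus. C powr r)"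
      by (rule integral_mono_AE) (use ae r i in \<open>auto elim!: eventually_mono intro!: powr_mono2\<close>)
    also have "\<dots> = C powr r" by (simp add: torus.prob_space[simplified])
    finally have "(LINT x|torus. cmod (f x) powr r) powr (1/r) \<le> (C powr r) powr (1/r)"
      using r by (intro powr_mono2) auto
    also have "\<dots> = C" using r C0 by (simp add: powr_powr)
    finally show ?thesis using r by (simp add: Lp_norm_def)
  qed
  then show "0 \<le> sobolev_norm s p u" "sobolev_norm s p u \<le> C" by (auto simp: norm)
qed

text \<open>
  \<open>F (t, x)\<close> represents \<open>(1 - \<Delta>)\<^sup>s\<^sup>/\<^sup>2 u(t)\<close>, and its uniform norm controls all \<open>W\<^sup>s\<^sup>,\<^sup>p\<close> norms at once.
\<close>

definition field_rep :: "real \<Rightarrow> (real \<Rightarrow> torus_distr) \<Rightarrow> (real \<times> real \<Rightarrow> complex) \<Rightarrow> bool" where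
  "field_rep s u F \<longleftrightarrow>
     (\<forall>t. (\<lambda>x. F (t, x)) \<in> borel_measurable borel \<and> fourier_coeff (\<lambda>x. F (t, x)) = bessel s (u t)) \<and>
     bounded (range F) \<and> (\<forall>t. uniform_limit UNIV (\<lambda>r x. F (r, x)) (\<lambda>x. F (t, x)) (at t))"

lemma field_rep_integrable:
  assumes "field_rep s u F" shows "integrable torus (\<lambda>x. F (t, x))"
proof -
  obtain C where "\<forall>z. cmod (F z) \<le> C" using assms unfolding field_rep_def bounded_iff by blast
  then show ?thesis using assms by (intro integrable_torus_bounded[of _ C])
    (auto simp: field_rep_def)
qed

text \<open>Two fields and two times are allowed at once: equal fields give continuity in time,
  equal times give convergence.\<close>

lemma sobolev_norm_diff:
  assumes p: "1 \<le> p" and u: "field_rep s u F" and v: "field_rep s v G"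
    and le: "\<And>x. cmod (F (r, x) - G (t, x)) \<le> e"
  shows "0 \<le> sobolev_norm s p (\<lambda>k. u r k - v t k)" "sobolev_norm s p (\<lambda>k. u r k - v t k) \<le> e"
proof -
  have m [measurable]: "(\<lambda>x. F (r, x)) \<in> borel_measurable borel" "(\<lambda>x. G (t, x)) \<in> borel_measurable
    borel"
    using u v by (auto simp: field_rep_def)
  have i: "integrable torus (\<lambda>x. F (r, x))" "integrable torus (\<lambda>x. G (t, x))"
    using u v by (auto intro: field_rep_integrable)
  have "fourier_coeff (\<lambda>x. F (r, x) - G (t, x)) k = bessel s (\<lambda>k. u r k - v t k) k" for k
  proof -
    have "fourier_coeff (\<lambda>x. F (r, x) - G (t, x)) k = fourier_coeff (\<lambda>x. F (r, x)) k - fourier_coeff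
      (\<lambda>x. G (t, x)) k"
      using integrable_cis_mult[OF i(1), of "- real_of_int k"] integrable_cis_mult[OF i(2), of
        "- real_of_int k"]
      by (simp add: fourier_coeff_torus right_diff_distrib)
    then show ?thesis using u v by (simp add: field_rep_def bessel_def algebra_simps)
  qed
  then have eq: "fourier_coeff (\<lambda>x. F (r, x) - G (t, x)) = bessel s (\<lambda>k. u r k - v t k)" by auto
  show "0 \<le> sobolev_norm s p (\<lambda>k. u r k - v t k)" "sobolev_norm s p (\<lambda>k. u r k - v t k) \<le> e"
    using sobolev_normI[OF p _ le eq] by auto
qed

lemma field_rep_C_sobolev:
  assumes p: "1 \<le> p" and u: "field_rep s u F"
  shows "u \<in> C_sobolev s p"
proof -
  obtain C where C: "\<forall>z. cmod (F z) \<le> C" using u unfolding field_rep_def bounded_iff by blast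
  have "u t \<in> sobolev s p" for t
    using u C by (intro sobolev_normI(1)[OF p, of "\<lambda>x. F (t, x)" C]) (auto simp: field_rep_def)
  moreover have "((\<lambda>r. sobolev_norm s p (\<lambda>k. u r k - u t k)) \<longlongrightarrow> 0) (at t)" for t
  proof (rule tendstoI)
    fix e :: real assume "e > 0"
    have "uniform_limit UNIV (\<lambda>r x. F (r, x)) (\<lambda>x. F (t, x)) (at t)" using u
      by (simp add: field_rep_def)
    then have "\<forall>\<^sub>F r in at t. \<forall>x\<in>UNIV. dist (F (r, x)) (F (t, x)) < e/2"
      by (rule uniform_limitD) (use \<open>e > 0\<close> in simp)
    then show "\<forall>\<^sub>F r in at t. dist (sobolev_norm s p (\<lambda>k. u r k - u t k)) 0 < e"
    proof eventually_elim
      case (elim r)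
      then have le: "cmod (F (r, x) - F (t, x)) \<le> e/2" for x by (auto simp: dist_norm less_imp_le)
      show ?case using sobolev_norm_diff[OF p u u le] \<open>e > 0\<close> by simp
    qed
  qed
  ultimately show ?thesis by (simp add: C_sobolev_def)
qed

text \<open>Boundedness, measurability and Fourier coefficients survive uniform limits, and
  continuity in time does so by the three-term estimate. The coefficientwise limit \<open>v\<close>
  names the distribution that \<open>G\<close> represents.\<close>

lemma field_rep_uniform_limit:
  assumes u: "\<And>n. field_rep s (u n) (F n)" and lim: "uniform_limit UNIV F G sequentially"
    and v: "\<And>t k. (\<lambda>n. u n t k) \<longlonglongrightarrow> v t k"
  shows "field_rep s v G"
proof -
  have ev: "\<forall>\<^sub>F n in sequentially. \<forall>z. cmod (F n z - G z) < e" if "e > 0" for e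
    using uniform_limitD[OF lim that] by (simp add: dist_norm)
  have bd: "bounded (range G)"
  proof -
    obtain n where n: "\<forall>z. cmod (F n z - G z) < 1" using eventually_happens[OF ev[of 1]] by auto
    obtain C where C: "\<forall>z. cmod (F n z) \<le> C" using u[of n] unfolding field_rep_def bounded_iff
      by blast
    have "cmod (G z) \<le> C + 1" for z
      using n[rule_format, of z] C[rule_format, of z] norm_triangle_sub[of "G z" "F n z"]
        norm_minus_commute[of "F n z" "G z"] by linarith
    then show ?thesis by (auto simp: bounded_iff)
  qed
  have m: "(\<lambda>x. G (t, x)) \<in> borel_measurable borel" for t
  proof (rule borel_measurable_LIMSEQ_metric)
    show "(\<lambda>x. F n (t, x)) \<in> borel_measurable borel" for n using u by (simp add: field_rep_def)
    show "(\<lambda>n. F n (t, x)) \<longlonglongrightarrow> G (t, x)" for x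
      using tendsto_uniform_limitI[OF lim] by blast
  qed
  obtain C where C: "\<forall>z. cmod (G z) \<le> C" using bd unfolding bounded_iff by blast
  have iG: "integrable torus (\<lambda>x. G (t, x))" for t by (rule integrable_torus_bounded[OF m])
    (use C in blast)
  have "fourier_coeff (\<lambda>x. G (t, x)) k = bessel s (v t) k" for t k
  proof -
    have "(\<lambda>n. fourier_coeff (\<lambda>x. F n (t, x)) k) \<longlonglongrightarrow> fourier_coeff (\<lambda>x. G (t, x)) k"
    proof (rule LIMSEQ_I)
      fix e :: real assume "e > 0"
      then have "e/2 > 0" by simp
      from ev[OF this] obtain N where N: "\<forall>n\<ge>N. \<forall>z. cmod (F n z - G z) < e/2"
        unfolding eventually_sequentially by blast
      have "cmod (fourier_coeff (\<lambda>x. F n (t, x)) k - fourier_coeff (\<lambda>x. G (t, x)) k) \<le> e/2" if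
        "n \<ge> N" for n
        by (rule fourier_coeff_diff_le[OF field_rep_integrable[OF u] iG])
          (use N that less_imp_le in blast)
      then show "\<exists>N. \<forall>n\<ge>N. cmod (fourier_coeff (\<lambda>x. F n (t, x)) k - fourier_coeff (\<lambda>x. G (t, x)) k)
        < e"
        using \<open>e > 0\<close> by (intro exI[of _ N]) (fastforce)
    qed
    moreover have "(\<lambda>n. fourier_coeff (\<lambda>x. F n (t, x)) k) \<longlonglongrightarrow> bessel s (v t) k"
      using u v by (auto simp: field_rep_def bessel_def intro!: tendsto_intros)
    ultimately show ?thesis by (rule LIMSEQ_unique)
  qed
  then have fc: "fourier_coeff (\<lambda>x. G (t, x)) = bessel s (v t)" for t by auto
  have "uniform_limit UNIV (\<lambda>r x. G (r, x)) (\<lambda>x. G (t, x)) (at t)" for t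
  proof (rule uniform_limitI)
    fix e :: real assume "e > 0"
    then obtain n where n: "\<forall>z. cmod (F n z - G z) < e/3" using eventually_happens[OF ev[of "e/3"]]
      by auto
    have "uniform_limit UNIV (\<lambda>r x. F n (r, x)) (\<lambda>x. F n (t, x)) (at t)" using u
      by (simp add: field_rep_def)
    then have "\<forall>\<^sub>F r in at t. \<forall>x\<in>UNIV. dist (F n (r, x)) (F n (t, x)) < e/3"
      by (rule uniform_limitD) (use \<open>e > 0\<close> in simp)
    then show "\<forall>\<^sub>F r in at t. \<forall>x\<in>UNIV. dist (G (r, x)) (G (t, x)) < e"
    proof eventually_elim
      case (elim r)
      show ?case
      proof
        fix x
        have "dist (G (r, x)) (G (t, x)) \<le> dist (G (r,x)) (F n (r,x)) + dist (F n (r,x)) (F n (t,x))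
          + dist (F n (t,x)) (G (t,x))"
          by (meson add_mono_thms_linordered_semiring(3) dist_triangle order_trans)
        then show "dist (G (r, x)) (G (t, x)) < e"
          using elim[rule_format, of x] n[rule_format, of "(r,x)"] n[rule_format, of "(t,x)"]
            dist_commute[of "G (r,x)" "F n (r,x)"] unfolding dist_norm by simp
      qed
    qed
  qed
  then show ?thesis using bd m fc by (simp add: field_rep_def)
qed

lemma field_rep_tendsto:
  assumes p: "1 \<le> p" and u: "\<And>n. field_rep s (u n) (F n)" and lim: "uniform_limit UNIV F G
    sequentially"
    and v: "field_rep s v G"
  shows "C_sobolev_tendsto s p u v"
  unfolding C_sobolev_tendsto_def
proof (intro conjI allI impI)
  show "u n \<in> C_sobolev s p" for n by (rule field_rep_C_sobolev[OF p u])
  show "v \<in> C_sobolev s p" by (rule field_rep_C_sobolev[OF p v])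
  fix K :: "real set"
  show "uniform_limit K (\<lambda>n t. sobolev_norm s p (\<lambda>k. u n t k - v t k)) (\<lambda>_. 0) sequentially"
  proof (rule uniform_limitI)
    fix e :: real assume "e > 0"
    then have "e/2 > 0" by simp
    from uniform_limitD[OF lim this]
    show "\<forall>\<^sub>F n in sequentially. \<forall>t\<in>K. dist (sobolev_norm s p (\<lambda>k. u n t k - v t k)) 0 < e"
    proof eventually_elim
      case (elim n)
      then have le: "cmod (F n (t, x) - G (t, x)) \<le> e/2" for t x
        by (auto simp: dist_norm less_imp_le)
      show ?case
      proof
        fix t
        show "dist (sobolev_norm s p (\<lambda>k. u n t k - v t k)) 0 < e"
          using sobolev_norm_diff[OF p u v le, of t] \<open>e > 0\<close> by simp
      qed
    qed
  qed
qed

lemma field_rep_trig: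
  assumes fin: "finite K" and c: "\<And>k. continuous_on UNIV (\<lambda>t. u t k)" and b: "\<And>k t. cmod (u t k)
    \<le> C k"
  shows "field_rep s (\<lambda>t k. if k \<in> K then u t k else 0) (\<lambda>(t, x). \<Sum>k\<in>K. complex_of_real
    (bracket k powr s) * u t k * cis (real_of_int k * x))"
  unfolding field_rep_def
proof (intro conjI allI)
  fix t
  show "(\<lambda>x. case (t, x) of (t, x) \<Rightarrow> \<Sum>k\<in>K. complex_of_real (bracket k powr s) * u t k * cis
    (real_of_int k * x)) \<in> borel_measurable borel"
    by simp
  show "fourier_coeff (\<lambda>x. case (t, x) of (t, x) \<Rightarrow> \<Sum>k\<in>K. complex_of_real (bracket k powr s) * u t
    k * cis (real_of_int k * x)) = bessel s (\<lambda>k. if k \<in> K then u t k else 0)"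
    using fourier_coeff_trig[OF fin] by (auto simp: bessel_def)
  show "uniform_limit UNIV (\<lambda>r x. case (r, x) of (t, x) \<Rightarrow> \<Sum>k\<in>K. complex_of_real (bracket k powr s) *
    u t k * cis (real_of_int k * x))
     (\<lambda>x. case (t, x) of (t, x) \<Rightarrow> \<Sum>k\<in>K. complex_of_real (bracket k powr s) * u t k * cis
       (real_of_int k * x)) (at t)"
  proof (rule uniform_limitI)
    fix e :: real assume "e > 0"
    have "((\<lambda>r. \<Sum>k\<in>K. bracket k powr s * cmod (u r k - u t k)) \<longlongrightarrow> (\<Sum>k\<in>K. bracket k powr s * cmod
      (u t k - u t k))) (at t)"
      using c by (intro tendsto_intros) (auto simp: continuous_on_def)
    then have "((\<lambda>r. \<Sum>k\<in>K. bracket k powr s * cmod (u r k - u t k)) \<longlongrightarrow> 0) (at t)" by simp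
    from order_tendstoD(2)[OF this \<open>e > 0\<close>]
    show "\<forall>\<^sub>F r in at t. \<forall>x\<in>UNIV. dist (case (r, x) of (t, x) \<Rightarrow> \<Sum>k\<in>K. complex_of_real
      (bracket k powr s) * u t k * cis (real_of_int k * x))
     (case (t, x) of (t, x) \<Rightarrow> \<Sum>k\<in>K. complex_of_real (bracket k powr s) * u t k * cis
       (real_of_int k * x)) < e"
    proof eventually_elim
      case (elim r)
      show ?case
      proof
        fix x
        have "cmod ((\<Sum>k\<in>K. complex_of_real (bracket k powr s) * u r k * cis (real_of_int k * x)) -
          (\<Sum>k\<in>K. complex_of_real (bracket k powr s) * u t k * cis (real_of_int k * x)))
          = cmod (\<Sum>k\<in>K. complex_of_real (bracket k powr s) * (u r k - u t k) * cis (real_of_int k *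
            x))"
          by (simp add: sum_subtractf[symmetric] algebra_simps)
        also have "\<dots> \<le> (\<Sum>k\<in>K. cmod (complex_of_real (bracket k powr s) * (u r k - u t k) * cis
          (real_of_int k * x)))"
          by (rule norm_sum)
        also have "\<dots> = (\<Sum>k\<in>K. bracket k powr s * cmod (u r k - u t k))" by (simp add: norm_mult)
        finally show "dist (case (r, x) of (t, x) \<Rightarrow> \<Sum>k\<in>K. complex_of_real (bracket k powr s) * u t
          k * cis (real_of_int k * x))
     (case (t, x) of (t, x) \<Rightarrow> \<Sum>k\<in>K. complex_of_real (bracket k powr s) * u t k * cis
       (real_of_int k * x)) < e"
          using elim by (simp add: dist_norm)
      qed
    qed
  qed
next
  have "cmod (\<Sum>k\<in>K. complex_of_real (bracket k powr s) * u t k * cis (real_of_int k * x))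
    \<le> (\<Sum>k\<in>K. bracket k powr s * C k)" for t x
    by (rule order_trans[OF norm_sum]) (auto simp: norm_mult intro!: sum_mono mult_left_mono b)
  then show "bounded (range (\<lambda>(t, x). \<Sum>k\<in>K. complex_of_real (bracket k powr s) * u t k * cis
    (real_of_int k * x)))"
    by (auto simp: bounded_iff)
qed

text \<open>The estimate is only assumed frequency block by frequency block: the sum over \<open>n\<close> gives the limit,
  the sum over \<open>j\<close> the continuity of each \<open>u n\<close>.\<close>

lemma C_sobolev_tendsto_blocks:
  fixes u :: "nat \<Rightarrow> real \<Rightarrow> torus_distr" and A :: "nat \<Rightarrow> int set" and U :: "nat \<Rightarrow> nat \<Rightarrow> real"
  assumes fin: "\<And>j. finite (A j)" and disj: "disjoint_family A" and cover: "(\<Union>j. A j) = UNIV"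
    and c: "\<And>n k. continuous_on UNIV (\<lambda>t. u n t k)" and zero: "\<And>t k. u 0 t k = 0"
    and b: "\<And>n j t x. cmod (\<Sum>k\<in>A j. complex_of_real (bracket k powr s) * (u (Suc n) t k - u n t k) *
      cis (real_of_int k * x)) \<le> U n j"
    and U: "\<And>n. summable (U n)" "summable (\<lambda>n. \<Sum>j. U n j)"
  shows "\<exists>v. \<forall>p\<ge>1. C_sobolev_tendsto s p u v"
proof -
  define D where "D n j z = (\<Sum>k\<in>A j. complex_of_real (bracket k powr s) * (u (Suc n) (fst z) k - u n
    (fst z) k) * cis (real_of_int k * snd z))" for n j and z :: "real \<times> real"
  have D: "cmod (D n j z) \<le> U n j" for n j z unfolding D_def by (rule b)
  have U0: "0 \<le> U n j" for n j using D[of n j "(0,0)"] norm_ge_zero order_trans by blast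
  \<comment> \<open>A single coefficient is at most the uniform norm of its block, so the bound on
    the block passes to every frequency in it.\<close>
  have coeff: "bracket k powr s * cmod (u (Suc n) t k - u n t k) \<le> U n j" if "k \<in> A j" for n j k t
  proof -
    let ?f = "\<lambda>x. \<Sum>k\<in>A j. (complex_of_real (bracket k powr s) * (u (Suc n) t k - u n t k)) * cis
      (real_of_int k * x)"
    have "integrable torus ?f" by (rule integrable_torus_bounded[of _ "U n j"]) (use b in auto)
    from fourier_coeff_diff_le[OF this, of "\<lambda>_. 0" "U n j" k] b
    have "cmod (fourier_coeff ?f k) \<le> U n j" by simp
    then show ?thesis using fourier_coeff_trig[OF fin[of j]] that by (simp add: norm_mult)
  qed
  have incr: "\<exists>C. \<forall>n t. cmod (u (Suc n) t k - u n t k) \<le> C n \<and> 0 \<le> C n \<and> summable C" for k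
  proof -
    obtain j where j: "k \<in> A j" using cover by blast
    have "summable (\<lambda>n. U n j)"
    proof (rule summable_comparison_test[OF _ U(2)], intro exI allI impI)
      show "norm (U n j) \<le> (\<Sum>j. U n j)" for n
        using U0 sum_le_suminf[OF U(1), of "{j}" n] by simp
    qed
    then have "summable (\<lambda>n. bracket k powr (-s) * U n j)" by (rule summable_mult)
    moreover have "cmod (u (Suc n) t k - u n t k) \<le> bracket k powr (-s) * U n j" for n t
    proof -
      have "bracket k powr (-s) * (bracket k powr s * cmod (u (Suc n) t k - u n t k))
        \<le> bracket k powr (-s) * U n j"
        by (intro mult_left_mono coeff[OF j]) auto
      moreover have "bracket k powr (-s) * (bracket k powr s * cmod (u (Suc n) t k - u n t k))
        = cmod (u (Suc n) t k - u n t k)"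
        using bracket_ge_1[of k] by (simp add: mult.assoc[symmetric] powr_add[symmetric])
      ultimately show ?thesis by simp
    qed
    ultimately show ?thesis using U0 by (intro exI[of _ "\<lambda>n. bracket k powr (-s) * U n j"]) auto
  qed
  then obtain C where C: "\<And>k n t. cmod (u (Suc n) t k - u n t k) \<le> C k n" "\<And>k n. 0 \<le> C k n"
    "\<And>k. summable (C k)"
    by metis
  have tele: "u n t k = (\<Sum>m<n. u (Suc m) t k - u m t k)" for n t k
    by (induction n) (auto simp: zero)
  have ub: "cmod (u n t k) \<le> (\<Sum>m<n. C k m)" for n t k
    unfolding tele[of n] by (rule order_trans[OF norm_sum]) (intro sum_mono C)
  \<comment> \<open>Because \<open>u 0\<close> vanishes, \<open>u n\<close> is a telescoping sum and
    its limit is the series of all increments.\<close>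
  define v where "v t k = (\<Sum>m. u (Suc m) t k - u m t k)" for t k
  have v: "(\<lambda>n. u n t k) \<longlonglongrightarrow> v t k" for t k
  proof -
    have "summable (\<lambda>m. u (Suc m) t k - u m t k)"
      by (rule summable_comparison_test[OF _ C(3)[of k]]) (use C(1) in blast)
    from summable_LIMSEQ[OF this] show ?thesis unfolding v_def tele[symmetric] .
  qed
  \<comment> \<open>With the blocks as outer sum, \<open>F n\<close> is a uniform limit of
    trigonometric polynomials. The sums are exchanged afterwards, when \<open>n\<close> tends to
    infinity.\<close>
  define F where "F n z = (\<Sum>j. \<Sum>m<n. D m j z)" for n z
  have X: "(\<Sum>m<n. D m j z) = (\<Sum>k\<in>A j. complex_of_real (bracket k powr s) * u n (fst z) k * cis
    (real_of_int k * snd z))" for n j z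
    unfolding D_def by (subst sum.swap) (simp add: sum_distrib_left[symmetric]
      sum_distrib_right[symmetric] tele[symmetric])
  have sV: "summable (\<lambda>j. \<Sum>m<n. U m j)" for n by (intro summable_sum U)
  have Xb: "cmod (\<Sum>m<n. D m j z) \<le> (\<Sum>m<n. U m j)" for n j z
    by (rule order_trans[OF norm_sum]) (intro sum_mono D)
  have Fn: "field_rep s (u n) (F n)" for n
  proof (rule field_rep_uniform_limit)
    let ?K = "\<lambda>J. \<Union>j<J. A j"
    show "field_rep s (\<lambda>t k. if k \<in> ?K J then u n t k else 0) (\<lambda>(t, x). \<Sum>k\<in>?K J. complex_of_real
      (bracket k powr s) * u n t k * cis (real_of_int k * x))" for J
      by (rule field_rep_trig[OF _ c ub]) (use fin in auto)
    have e: "(\<lambda>(t, x). \<Sum>k\<in>?K J. complex_of_real (bracket k powr s) * u n t k * cis (real_of_int k *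
      x)) = (\<lambda>z. \<Sum>j<J. \<Sum>m<n. D m j z)" for J
    proof (rule ext, clarify)
      fix t x
      show "(\<Sum>k\<in>?K J. complex_of_real (bracket k powr s) * u n t k * cis (real_of_int k * x))
        = (\<Sum>j<J. \<Sum>m<n. D m j (t, x))"
        unfolding X using disj fin by (subst sum.UNION_disjoint) (auto simp: disjoint_family_on_def)
    qed
    show "uniform_limit UNIV (\<lambda>J. \<lambda>(t, x). \<Sum>k\<in>?K J. complex_of_real (bracket k powr s) * u n t k *
      cis (real_of_int k * x)) (F n) sequentially"
      unfolding e F_def by (rule Weierstrass_m_test[OF _ sV]) (rule Xb)
    fix t k
    obtain j where j: "k \<in> A j" using cover by blast
    have "\<forall>\<^sub>F J in sequentially. (if k \<in> ?K J then u n t k else 0) = u n t k"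
      using eventually_gt_at_top[of j] by eventually_elim (use j in auto)
    then show "(\<lambda>J. if k \<in> ?K J then u n t k else 0) \<longlonglongrightarrow> u n t k" by (rule tendsto_eventually)
  qed
  have sD: "summable (\<lambda>j. D m j z)" for m z
    by (rule summable_comparison_test[OF _ U(1)[of m]]) (use D in blast)
  have F2: "F n z = (\<Sum>m<n. \<Sum>j. D m j z)" for n z
    unfolding F_def by (rule suminf_sum) (rule sD)
  define G where "G z = (\<Sum>m. \<Sum>j. D m j z)" for z
  have lim: "uniform_limit UNIV F G sequentially"
    unfolding F2[abs_def] G_def[abs_def]
  proof (rule Weierstrass_m_test[OF _ U(2)])
    fix m and z :: "real \<times> real"
    have "summable (\<lambda>j. norm (D m j z))"
      by (rule summable_comparison_test[OF _ U(1)[of m]]) (use D in auto)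
    then have "norm (\<Sum>j. D m j z) \<le> (\<Sum>j. norm (D m j z))" by (rule summable_norm)
    also have "\<dots> \<le> (\<Sum>j. U m j)" by (rule suminf_le) (use D U \<open>summable (\<lambda>j. norm (D m j z))\<close> in
      auto)
    finally show "norm (\<Sum>j. D m j z) \<le> (\<Sum>j. U m j)" .
  qed
  have G: "field_rep s v G" by (rule field_rep_uniform_limit[OF Fn lim v])
  show ?thesis using field_rep_tendsto[OF _ Fn lim G] by blast
qed

section \<open>Stochastic integrals\<close>

text \<open>The sheet is only known to agree almost surely, point by point, with measurable
  variables; on a complete space this already gives measurability.\<close>

lemma (in complete_measure) borel_measurable_AE_eq:
  assumes f: "f \<in> borel_measurable M" and ae: "AE x in M. f x = g x"
  shows "g \<in> borel_measurable M"
proof (rule measurableI)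
  fix A :: "'b set" assume A: "A \<in> sets borel"
  show "g -` A \<inter> space M \<in> sets M"
    by (rule in_sets_AE[of "f -` A \<inter> space M"]) (use ae f A in \<open>auto elim!: eventually_mono\<close>)
qed simp

lemma integral_Icc_eq_HK:
  fixes f :: "real \<Rightarrow> complex"
  assumes "continuous_on {a..b} f"
  shows "(LBINT r:{a..b}. f r) = integral {a..b} f" "set_integrable lborel {a..b} f"
  using borel_integrable_atLeastAtMost'[OF assms]
    by (auto intro!: set_borel_integral_eq_integral(2))

lemma integral_eq_sum_intervals:
  fixes f :: "real \<Rightarrow> 'b::banach"
  assumes f: "f integrable_on {a..a + real m * h}" and h: "0 \<le> h"
  shows "n \<le> m \<Longrightarrow> integral {a..a + real n * h} f = (\<Sum>i<n. integral {a + real i * h..a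
    + real (Suc i) * h} f)"
proof (induction n)
  case (Suc n)
  have "f integrable_on {a..a + real (Suc n) * h}"
    using f by (rule integrable_subinterval_real) (use Suc.prems h in \<open>auto intro: mult_right_mono\<close>)
  note io = this
  have "integral {a..a + real (Suc n) * h} f = integral {a..a + real n * h} f + integral {a
    + real n * h..a + real (Suc n) * h} f"
    by (rule Henstock_Kurzweil_Integration.integral_combine[symmetric])
      (use h io in \<open>auto intro!: mult_right_mono\<close>)
  then show ?case using Suc by simp
qed simp

text \<open>The white noise respects finite linear combinations, so integrals of paths and integrals
  of kernels are approached by the same left-endpoint sums.\<close>

lemma riemann_sum_tendsto:
  fixes f :: "real \<Rightarrow> complex"
  assumes ab: "a \<le> b" and c: "continuous_on {a..b} f"
  shows "(\<lambda>m. \<Sum>i<Suc m. complex_of_real ((b - a) / Suc m) * f (a + real i * ((b - a) / Suc m)))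
    \<longlonglongrightarrow> (LBINT r:{a..b}. f r)"
proof (rule LIMSEQ_I)
  fix e :: real assume e: "e > 0"
  have uc: "uniformly_continuous_on {a..b} f" by (rule compact_uniformly_continuous[OF c]) simp
  \<comment> \<open>Half of \<open>e\<close> is spread over the length of the interval; the added 1
    covers the case a = b.\<close>
  define e' where "e' = e / (2 * (b - a + 1))"
  have e': "e' > 0" using e ab by (simp add: e'_def)
  obtain d where d: "d > 0" "\<And>x y. x \<in> {a..b} \<Longrightarrow> y \<in> {a..b} \<Longrightarrow> dist y x < d \<Longrightarrow> dist (f y) (f x) < e'"
    using uc e' unfolding uniformly_continuous_on_def by metis
  obtain N :: nat where N: "(b - a) / d < real N" using reals_Archimedean2 by blast
  have "cmod ((\<Sum>i<Suc m. complex_of_real ((b - a) / Suc m) * f (a + real i * ((b - a) / Suc m))) -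
    (LBINT r:{a..b}. f r)) < e" if m: "m \<ge> N" for m
  proof -
    define h where "h = (b - a) / real (Suc m)"
    have h0: "0 \<le> h" using ab by (simp add: h_def)
    have hd: "h < d"
    proof -
      have "(b - a) / d < real (Suc m)" using N m by linarith
      then show ?thesis using d(1) by (simp add: h_def field_simps)
    qed
    have bh: "b = a + real (Suc m) * h" by (simp add: h_def)
    have io: "f integrable_on {a..b}" using c by (rule integrable_continuous_real)
    have "(LBINT r:{a..b}. f r) = integral {a..a + real (Suc m) * h} f"
      using integral_Icc_eq_HK(1)[OF c] bh by simp
    also have "\<dots> = (\<Sum>i<Suc m. integral {a + real i * h..a + real (Suc i) * h} f)"
      by (rule integral_eq_sum_intervals) (use io bh h0 in auto)
    finally have I: "(LBINT r:{a..b}. f r) = (\<Sum>i<Suc m. integral {a + real i * h..a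
      + real (Suc i) * h} f)" .
    have piece: "cmod (complex_of_real h * f (a + real i * h) - integral {a + real i * h..a
      + real (Suc i) * h} f) \<le> e' * h" if i: "i < Suc m" for i
    proof -
      have le: "a + real (Suc i) * h \<le> b" unfolding bh using i h0 by (auto intro!: mult_right_mono)
      have ge: "a \<le> a + real i * h" using h0 by simp
      have sub: "{a + real i * h..a + real (Suc i) * h} \<subseteq> {a..b}" using le ge by auto
      have fi: "f integrable_on {a + real i * h..a + real (Suc i) * h}"
        by (rule integrable_subinterval_real[OF io sub])
      have len: "a + real (Suc i) * h - (a + real i * h) = h" by (simp add: algebra_simps)
      have hle: "a + real i * h \<le> a + real (Suc i) * h" using len h0 by linarith
      have "integral {a + real i * h..a + real (Suc i) * h} (\<lambda>x. f (a + real i * h))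
        = complex_of_real h * f (a + real i * h)"
        using len hle by (simp add: scaleR_conv_of_real del: of_nat_Suc)
      then have "complex_of_real h * f (a + real i * h) - integral {a + real i * h..a
        + real (Suc i) * h} f
         = integral {a + real i * h..a + real (Suc i) * h} (\<lambda>x. f (a + real i * h) - f x)"
        using fi by (subst Henstock_Kurzweil_Integration.integral_diff) auto
      also have "cmod \<dots> \<le> e' * (a + real (Suc i) * h - (a + real i * h))"
      proof (rule integral_bound[OF hle])
        show "continuous_on {a + real i * h..a + real (Suc i) * h} (\<lambda>x. f (a + real i * h) - f x)"
          using continuous_on_subset[OF c sub] by (intro continuous_intros)
        fix x assume x: "x \<in> {a + real i * h..a + real (Suc i) * h}"
        then have "dist x (a + real i * h) < d" using hd len by (auto simp: dist_real_def)
        then have "dist (f x) (f (a + real i * h)) < e'" using d(2)[of "a + real i * h" x] x sub ge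
          le hle by auto
        then show "cmod (f (a + real i * h) - f x) \<le> e'" by (simp add: dist_norm norm_minus_commute)
      qed
      finally show ?thesis using len by simp
    qed
    have "cmod ((\<Sum>i<Suc m. complex_of_real h * f (a + real i * h)) - (LBINT r:{a..b}. f r))
      \<le> (\<Sum>i<Suc m. e' * h)"
      unfolding I sum_subtractf[symmetric] by (rule order_trans[OF norm_sum]) (intro sum_mono piece,
        simp)
    also have "\<dots> = e' * (b - a)" using bh by simp
    also have "\<dots> < e"
    proof -
      have "e' * (b - a) \<le> e' * (b - a + 1)" using e' by simp
      also have "\<dots> = e / 2" using ab by (simp add: e'_def field_simps)
      finally show ?thesis using e by simp
    qed
    finally show ?thesis unfolding h_def .
  qed
  then show "\<exists>N. \<forall>m\<ge>N. cmod ((\<Sum>i<Suc m. complex_of_real ((b - a) / Suc m) * f (a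
    + real i * ((b - a) / Suc m))) - (LBINT r:{a..b}. f r)) < e"
    by blast
qed

text \<open>Rounding time down to multiples of 1/(n+1) leaves countably many values, so the rounded
  process is jointly measurable, and path continuity gives the limit. Paths in an exceptional null
  set are set to zero. The version allows expectation and time integral to be exchanged.\<close>

lemma (in prob_space) caratheodory_version:
  fixes Z :: "'a \<Rightarrow> real \<Rightarrow> complex"
  assumes m: "\<And>r. (\<lambda>\<omega>. Z \<omega> r) \<in> borel_measurable M" and c: "AE \<omega> in M. continuous_on UNIV (Z \<omega>)"
  obtains Z' where "(\<lambda>(\<omega>, r). Z' \<omega> r) \<in> borel_measurable (M \<Otimes>\<^sub>M lborel)" "AE \<omega> in M. Z' \<omega> = Z \<omega>"
proof -
  obtain N where N: "{\<omega> \<in> space M. \<not> continuous_on UNIV (Z \<omega>)} \<subseteq> N" "emeasure M N = 0" "N \<in> sets M"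
    using AE_E[OF c] by metis
  define Zm where "Zm n = (\<lambda>(\<omega>, r). if \<omega> \<in> N then 0 else Z \<omega> (real_of_int \<lfloor>r * real (Suc n)\<rfloor> / real
    (Suc n)))" for n
  define Z' where "Z' \<omega> r = (if \<omega> \<in> N then 0 else Z \<omega> r)" for \<omega> r
  have "(\<lambda>(\<omega>, r). Z' \<omega> r) \<in> borel_measurable (M \<Otimes>\<^sub>M lborel)"
  proof (rule borel_measurable_LIMSEQ_metric)
    fix n
    have "(\<lambda>z. Z (fst z) (real_of_int \<lfloor>snd z * real (Suc n)\<rfloor> / real (Suc n))) \<in> borel_measurable
      (M \<Otimes>\<^sub>M lborel)"
    proof (rule measurable_compose_countable[where f="\<lambda>i z. Z (fst z) (real_of_int i / real
      (Suc n))" and g="\<lambda>z. \<lfloor>snd z * real (Suc n)\<rfloor>"])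
      show "(\<lambda>z. Z (fst z) (real_of_int i / real (Suc n))) \<in> borel_measurable (M \<Otimes>\<^sub>M lborel)" for i
        using measurable_compose[OF measurable_fst m] by blast
      show "(\<lambda>z. \<lfloor>snd z * real (Suc n)\<rfloor>) \<in> M \<Otimes>\<^sub>M lborel \<rightarrow>\<^sub>M count_space UNIV" by measurable
    qed
    moreover have "{z \<in> space (M \<Otimes>\<^sub>M lborel). fst z \<in> N} \<in> sets (M \<Otimes>\<^sub>M lborel)" using N(3)
      by measurable
    ultimately show "Zm n \<in> borel_measurable (M \<Otimes>\<^sub>M lborel)"
      unfolding Zm_def split_beta by (intro measurable_If) auto
  next
    fix z :: "'a \<times> real" assume "z \<in> space (M \<Otimes>\<^sub>M lborel)"
    then obtain \<omega> r where z: "z = (\<omega>, r)" "\<omega> \<in> space M" by (auto simp: space_pair_measure)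
    show "(\<lambda>n. Zm n z) \<longlonglongrightarrow> (case z of (\<omega>, r) \<Rightarrow> Z' \<omega> r)"
    proof (cases "\<omega> \<in> N")
      case True then show ?thesis by (simp add: Zm_def Z'_def z)
    next
      case False
      then have "continuous_on UNIV (Z \<omega>)" using N z by blast
      then have ic: "isCont (Z \<omega>) r" by (simp add: continuous_on_eq_continuous_at)
      have "(\<lambda>n. real_of_int \<lfloor>r * real (Suc n)\<rfloor> / real (Suc n)) \<longlonglongrightarrow> r"
      proof (rule real_tendsto_sandwich)
        show "\<forall>\<^sub>F n in sequentially. r - 1 / real (Suc n) \<le> real_of_int \<lfloor>r * real (Suc n)\<rfloor> / real
          (Suc n)"
        proof (rule always_eventually, rule allI)
          fix n
          have "(r * real (Suc n) - 1) / real (Suc n) \<le> real_of_int \<lfloor>r * real (Suc n)\<rfloor> / real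
            (Suc n)"
            by (intro divide_right_mono) linarith+
          then show "r - 1 / real (Suc n) \<le> real_of_int \<lfloor>r * real (Suc n)\<rfloor> / real (Suc n)"
            by (simp add: diff_divide_distrib del: of_nat_Suc)
        qed
        show "\<forall>\<^sub>F n in sequentially. real_of_int \<lfloor>r * real (Suc n)\<rfloor> / real (Suc n) \<le> r"
          by (rule always_eventually) (auto simp: divide_le_eq simp del: of_nat_Suc)
        show "(\<lambda>n. r - 1 / real (Suc n)) \<longlonglongrightarrow> r"
          using tendsto_diff[OF tendsto_const LIMSEQ_inverse_real_of_nat, of r]
            by (simp add: inverse_eq_divide)
      qed simp
      from isCont_tendsto_compose[OF ic this] show ?thesis using False
        by (simp add: Zm_def Z'_def z del: of_nat_Suc)
    qed
  qed
  moreover have "AE \<omega> in M. \<omega> \<notin> N" using N by (intro AE_not_in) auto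
  then have "AE \<omega> in M. Z' \<omega> = Z \<omega>" by eventually_elim (auto simp: Z'_def)
  ultimately show ?thesis using that by blast
qed

section \<open>Square integrable kernels and Gaussian moments\<close>

definition sq_norm :: "(real \<times> real \<Rightarrow> complex) \<Rightarrow> real" where
  "sq_norm f = (LINT z|lborel. (cmod (f z))\<^sup>2)"

lemma sq_norm_nonneg: "0 \<le> sq_norm f"
  unfolding sq_norm_def by (rule Bochner_Integration.integral_nonneg) simp

lemma square_integrable_measurable [measurable_dest]:
  "f \<in> square_integrable \<Longrightarrow> f \<in> borel_measurable borel"
  by (simp add: square_integrable_def)

lemma square_integrable_dominated:
  assumes f: "f \<in> borel_measurable borel" and G: "integrable lborel (\<lambda>z. (G z)\<^sup>2)" and le:
    "\<And>z. cmod (f z) \<le> G z"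
  shows "f \<in> square_integrable"
proof -
  have "integrable lborel (\<lambda>z. (cmod (f z))\<^sup>2)"
    by (rule Bochner_Integration.integrable_bound[OF G]) (use f le in \<open>auto intro!: power_mono\<close>)
  then show ?thesis using f by (simp add: square_integrable_def)
qed

lemma cmod_add_sq_le: "(cmod (a + b))\<^sup>2 \<le> 2 * (cmod a)\<^sup>2 + 2 * (cmod b)\<^sup>2"
proof -
  have "(cmod (a + b))\<^sup>2 \<le> (cmod a + cmod b)\<^sup>2" by (intro power_mono norm_triangle_ineq) simp
  also have "\<dots> \<le> 2 * (cmod a)\<^sup>2 + 2 * (cmod b)\<^sup>2"
    using sum_squares_ge_zero[of "cmod a - cmod b" 0] by (simp add: power2_eq_square algebra_simps)
  finally show ?thesis .
qed

lemma square_integrable_lin: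
  assumes f: "f \<in> square_integrable" and g: "g \<in> square_integrable"
  shows "(\<lambda>z. a * f z + b * g z) \<in> square_integrable"
proof -
  note [measurable] = f[THEN square_integrable_measurable] g[THEN square_integrable_measurable]
  have i: "integrable lborel (\<lambda>z. 2 * ((cmod a)\<^sup>2 * (cmod (f z))\<^sup>2)
    + 2 * ((cmod b)\<^sup>2 * (cmod (g z))\<^sup>2))"
    using f g by (auto simp: square_integrable_def)
  have "integrable lborel (\<lambda>z. (cmod (a * f z + b * g z))\<^sup>2)"
    by (rule Bochner_Integration.integrable_bound[OF i])
       (use f g cmod_add_sq_le[of "a * f z" "b * g z" for z] in \<open>auto simp: norm_mult
         power_mult_distrib\<close>)
  then show ?thesis by (simp add: square_integrable_def)
qed

lemma square_integrable_zero: "(\<lambda>z. 0) \<in> square_integrable"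
  by (simp add: square_integrable_def)

lemma square_integrable_cmult: "f \<in> square_integrable \<Longrightarrow> (\<lambda>z. a * f z) \<in> square_integrable"
  using square_integrable_lin[of f f a 0] by simp

lemma square_integrable_sum:
  assumes "finite I" "\<And>i. i \<in> I \<Longrightarrow> f i \<in> square_integrable"
  shows "(\<lambda>z. \<Sum>i\<in>I. a i * f i z) \<in> square_integrable"
  using assms
proof (induction rule: finite_induct)
  case (insert i I)
  then have "(\<lambda>z. a i * f i z + 1 * (\<Sum>i\<in>I. a i * f i z)) \<in> square_integrable"
    by (intro square_integrable_lin) auto
  then show ?case using insert by simp
qed (simp add: square_integrable_zero)

text \<open>In the degenerate case both sides vanish because \<open>p \<ge> 1\<close>. Otherwise
  this is the even moment of a normal density, with \<sigma>^2 rewritten as the second moment of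
  \<open>X\<close>.\<close>

lemma centered_gaussian_moment:
  assumes g: "centered_gaussian M X" and p: "p \<ge> 1"
  shows "integrable M (\<lambda>\<omega>. X \<omega> ^ (2 * p))"
    "(LINT \<omega>|M. X \<omega> ^ (2 * p)) = fact (2 * p) / (2 ^ p * fact p) * (LINT \<omega>|M. (X \<omega>)\<^sup>2) ^ p"
proof -
  have m: "X \<in> borel_measurable M" using g by (simp add: centered_gaussian_def)
  have "integrable M (\<lambda>\<omega>. X \<omega> ^ (2 * p)) \<and> (LINT \<omega>|M. X \<omega> ^ (2 * p))
    = fact (2 * p) / (2 ^ p * fact p) * (LINT \<omega>|M. (X \<omega>)\<^sup>2) ^ p"
    using g unfolding centered_gaussian_def
  proof (elim conjE disjE exE)
    assume ae: "AE \<omega> in M. X \<omega> = 0"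
    have a: "AE \<omega> in M. X \<omega> ^ (2 * p) = 0" "AE \<omega> in M. (X \<omega>)\<^sup>2 = 0"
      using ae by (eventually_elim, use p in simp)+
    have "integrable M (\<lambda>\<omega>. X \<omega> ^ (2 * p)) \<longleftrightarrow> integrable M (\<lambda>\<omega>. 0::real)"
      by (rule integrable_cong_AE) (use m a in auto)
    moreover have "(LINT \<omega>|M. X \<omega> ^ (2 * p)) = (LINT \<omega>|M. 0)"
      by (rule integral_cong_AE) (use m a(1) in auto)
    moreover have "(LINT \<omega>|M. (X \<omega>)\<^sup>2) = (LINT \<omega>|M. 0)"
      by (rule integral_cong_AE[OF _ _ a(2)]) (use m in auto)
    ultimately show ?thesis using p by (simp add: zero_power)
  next
    fix \<sigma> :: real assume s: "\<sigma> > 0" and d: "distributed M lborel X (\<lambda>x. ennreal (normal_density 0 \<sigma>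
      x))"
    have h: "has_bochner_integral lborel (\<lambda>x. normal_density 0 \<sigma> x * x ^ (2 * k)) (fact (2 * k) /
      ((2 / \<sigma>\<^sup>2)^k * fact k))" for k
      using normal_moment_even[OF s, of 0 k] by simp
    have 1: "integrable M (\<lambda>\<omega>. X \<omega> ^ (2 * k))" for k
      using distributed_integrable[OF d, of "\<lambda>x. x ^ (2*k)"] h[of k]
        by (auto simp: has_bochner_integral_iff)
    have 2: "(LINT \<omega>|M. X \<omega> ^ (2 * k)) = fact (2 * k) / ((2 / \<sigma>\<^sup>2)^k * fact k)" for k
      using distributed_integral[OF d, of "\<lambda>x. x ^ (2*k)"] h[of k]
        by (auto simp: has_bochner_integral_iff)
    have 3: "(LINT \<omega>|M. (X \<omega>)\<^sup>2) = \<sigma>\<^sup>2" using 2[of 1] by simp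
    show ?thesis unfolding 3 2[of p] using 1 s by (simp add: power_divide field_simps)
  qed
  then show "integrable M (\<lambda>\<omega>. X \<omega> ^ (2 * p))"
    "(LINT \<omega>|M. X \<omega> ^ (2 * p)) = fact (2 * p) / (2 ^ p * fact p) * (LINT \<omega>|M. (X \<omega>)\<^sup>2) ^ p" by auto
qed

section \<open>Calculus of the white noise integral: isometry, moments, limits, integrals and
  derivatives\<close>

locale white_noise = prob_space M + complete_measure M for M :: "'a measure" +
  fixes W :: "(real \<times> real \<Rightarrow> complex) \<Rightarrow> 'a \<Rightarrow> complex"
  assumes noise: "fourier_white_noise M W"
begin

lemma W_measurable [measurable]: "f \<in> square_integrable \<Longrightarrow> W f \<in> borel_measurable M"
  using noise by (simp add: fourier_white_noise_def)

lemma W_lin: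
  assumes "f \<in> square_integrable" "g \<in> square_integrable"
  shows "AE \<omega> in M. W (\<lambda>z. a * f z + b * g z) \<omega> = a * W f \<omega> + b * W g \<omega>"
  using noise assms by (simp add: fourier_white_noise_def)

lemma W_zero: "AE \<omega> in M. W (\<lambda>z. 0) \<omega> = 0"
  using W_lin[OF square_integrable_zero square_integrable_zero, of 0 0] by simp

lemma W_cmult:
  assumes "f \<in> square_integrable" shows "AE \<omega> in M. W (\<lambda>z. a * f z) \<omega> = a * W f \<omega>"
  using W_lin[OF assms assms, of a 0] by simp

lemma W_diff:
  assumes "f \<in> square_integrable" "g \<in> square_integrable"
  shows "AE \<omega> in M. W (\<lambda>z. f z - g z) \<omega> = W f \<omega> - W g \<omega>"
  using W_lin[OF assms, of 1 "-1"] by simp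

lemma W_sum:
  assumes "finite I" "\<And>i. i \<in> I \<Longrightarrow> f i \<in> square_integrable"
  shows "AE \<omega> in M. W (\<lambda>z. \<Sum>i\<in>I. a i * f i z) \<omega> = (\<Sum>i\<in>I. a i * W (f i) \<omega>)"
  using assms
proof (induction rule: finite_induct)
  case (insert i I)
  have "AE \<omega> in M. W (\<lambda>z. a i * f i z + 1 * (\<Sum>i\<in>I. a i * f i z)) \<omega> = a i * W (f i) \<omega>
    + 1 * W (\<lambda>z. \<Sum>i\<in>I. a i * f i z) \<omega>"
    by (rule W_lin) (use insert in \<open>auto intro!: square_integrable_sum\<close>)
  moreover have "AE \<omega> in M. W (\<lambda>z. \<Sum>i\<in>I. a i * f i z) \<omega> = (\<Sum>i\<in>I. a i * W (f i) \<omega>)" using insert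
    by simp
  ultimately show ?case by eventually_elim (use insert in simp)
qed (simp add: W_zero)

lemma W_gaussian:
  assumes f: "f \<in> square_integrable"
  shows "centered_gaussian M (\<lambda>\<omega>. Re (W f \<omega>))"
  using noise f by (simp add: fourier_white_noise_def)

text \<open>Since Im z = Re (-\<i> z), the Gaussian hypothesis on real parts also covers imaginary
  parts.\<close>

lemma W_Im:
  assumes f: "f \<in> square_integrable"
  shows "AE \<omega> in M. Im (W f \<omega>) = Re (W (\<lambda>z. - \<i> * f z) \<omega>)"
  using W_cmult[OF f, of "-\<i>"] by eventually_elim simp

lemma W_sq_integrable:
  assumes f: "f \<in> square_integrable"
  shows "integrable M (\<lambda>\<omega>. (Re (W f \<omega>))\<^sup>2)" "integrable M (\<lambda>\<omega>. (Im (W f \<omega>))\<^sup>2)"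
    "integrable M (\<lambda>\<omega>. (cmod (W f \<omega>))\<^sup>2)"
proof -
  note [measurable] = f
  have fi: "(\<lambda>z. - \<i> * f z) \<in> square_integrable" by (rule square_integrable_cmult[OF f])
  note [measurable] = fi
  show 1: "integrable M (\<lambda>\<omega>. (Re (W f \<omega>))\<^sup>2)" using centered_gaussian_moment(1)[OF W_gaussian[OF f],
    of 1] by simp
  have 2: "integrable M (\<lambda>\<omega>. (Re (W (\<lambda>z. - \<i> * f z) \<omega>))\<^sup>2)" using centered_gaussian_moment(1)[OF
    W_gaussian[OF fi], of 1] by simp
  have "integrable M (\<lambda>\<omega>. (Im (W f \<omega>))\<^sup>2) \<longleftrightarrow> integrable M (\<lambda>\<omega>. (Re (W (\<lambda>z. - \<i> * f z) \<omega>))\<^sup>2)"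
  proof (rule integrable_cong_AE)
    show "AE \<omega> in M. (Im (W f \<omega>))\<^sup>2 = (Re (W (\<lambda>z. - \<i> * f z) \<omega>))\<^sup>2"
      using W_Im[OF f] by eventually_elim (simp only:)
    show "(\<lambda>\<omega>. (Im (W f \<omega>))\<^sup>2) \<in> borel_measurable M" using W_measurable[OF f] by measurable
    show "(\<lambda>\<omega>. (Re (W (\<lambda>z. - \<i> * f z) \<omega>))\<^sup>2) \<in> borel_measurable M" using W_measurable[OF fi]
      by measurable
  qed
  then show 3: "integrable M (\<lambda>\<omega>. (Im (W f \<omega>))\<^sup>2)" using 2 by simp
  show "integrable M (\<lambda>\<omega>. (cmod (W f \<omega>))\<^sup>2)" unfolding cmod_power2 using 1 3 by simp
qed

lemma W_isometry:
  assumes f: "f \<in> square_integrable"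
  shows "(LINT \<omega>|M. (cmod (W f \<omega>))\<^sup>2) = sq_norm f"
proof -
  have "(LINT \<omega>|M. W f \<omega> * cnj (W f \<omega>)) = (LINT z|lborel. f z * cnj (f z))"
    using noise f by (simp add: fourier_white_noise_def)
  then have "complex_of_real (LINT \<omega>|M. (cmod (W f \<omega>))\<^sup>2) = complex_of_real (LINT z|lborel.
    (cmod (f z))\<^sup>2)"
    unfolding complex_norm_square[symmetric] of_real_power[symmetric]
      by (simp only: integral_complex_of_real)
  then show ?thesis unfolding sq_norm_def of_real_eq_iff .
qed

lemma W_nn_isometry:
  assumes f: "f \<in> square_integrable"
  shows "(\<integral>\<^sup>+\<omega>. ennreal ((cmod (W f \<omega>))\<^sup>2) \<partial>M) = ennreal (sq_norm f)"
  using W_isometry[OF f] W_sq_integrable(3)[OF f] by (simp add: nn_integral_eq_integral)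

text \<open>A factor 2 for the real and imaginary parts, \<open>2 ^ p\<close> from (a + b)^p \<le>
  2^p (a^p + b^p), and the normal moment (2p)! / (2^p p!).\<close>

definition moment_const :: "nat \<Rightarrow> real" where
  "moment_const p = 2 * 2 ^ p * (fact (2 * p) / (2 ^ p * fact p))"

text \<open>Real and imaginary parts are centered Gaussian with variance at most
  \<open>sq_norm f\<close>, so all even moments are governed by the p-th power of the
  variance.\<close>

lemma W_moment:
  assumes f: "f \<in> square_integrable" and p: "p \<ge> 1"
  shows "(\<integral>\<^sup>+\<omega>. ennreal (cmod (W f \<omega>) ^ (2 * p)) \<partial>M) \<le> ennreal (moment_const p * sq_norm f ^ p)"
proof -
  have fi: "(\<lambda>z. - \<i> * f z) \<in> square_integrable" by (rule square_integrable_cmult[OF f])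
  let ?R = "\<lambda>\<omega>. Re (W f \<omega>)" and ?I = "\<lambda>\<omega>. Re (W (\<lambda>z. - \<i> * f z) \<omega>)" and ?k =
    "fact (2 * p) / (2 ^ p * fact p) :: real"
  note R = centered_gaussian_moment[OF W_gaussian[OF f] p]
  note I = centered_gaussian_moment[OF W_gaussian[OF fi] p]
  have le: "(\<integral>x. (Re (W g x))\<^sup>2 \<partial>M) \<le> sq_norm g" if g: "g \<in> square_integrable" for g
    unfolding W_isometry[OF g, symmetric]
    by (rule integral_mono) (use W_sq_integrable[OF g] in \<open>auto simp: cmod_power2\<close>)
  have n: "sq_norm (\<lambda>z. - \<i> * f z) = sq_norm f" by (simp add: sq_norm_def norm_mult)
  have EX: "(LINT \<omega>|M. Re (W g \<omega>) ^ (2 * p)) \<le> ?k * sq_norm f ^ p"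
    if g: "g \<in> square_integrable" and ng: "sq_norm g = sq_norm f" for g
    unfolding centered_gaussian_moment(2)[OF W_gaussian[OF g] p] ng[symmetric]
    by (intro mult_left_mono power_mono le g Bochner_Integration.integral_nonneg) auto
  have "AE \<omega> in M. cmod (W f \<omega>) ^ (2 * p) \<le> 2 ^ p * (?R \<omega> ^ (2 * p) + ?I \<omega> ^ (2 * p))"
    using W_Im[OF f]
  proof eventually_elim
    case (elim \<omega>)
    have gen: "(a + b) ^ p \<le> 2 ^ p * (a ^ p + b ^ p)" if "0 \<le> a" "0 \<le> b" for a b :: real
    proof -
      have "(a + b) ^ p \<le> (2 * max a b) ^ p" using that by (intro power_mono) auto
      also have "\<dots> = 2 ^ p * max a b ^ p" by (simp add: power_mult_distrib)
      also have "\<dots> \<le> 2 ^ p * (a ^ p + b ^ p)" using that by (intro mult_left_mono)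
        (auto simp: max_def)
      finally show ?thesis .
    qed
    have "cmod (W f \<omega>) ^ (2 * p) = ((?R \<omega>)\<^sup>2 + (?I \<omega>)\<^sup>2) ^ p"
      unfolding power_mult cmod_power2 elim ..
    also have "\<dots> \<le> 2 ^ p * (?R \<omega> ^ (2 * p) + ?I \<omega> ^ (2 * p))"
      unfolding power_mult by (rule gen) auto
    finally show ?case .
  qed
  then have "(\<integral>\<^sup>+\<omega>. ennreal (cmod (W f \<omega>) ^ (2 * p)) \<partial>M) \<le> (\<integral>\<^sup>+\<omega>. ennreal (2 ^ p * (?R \<omega> ^ (2 * p)
    + ?I \<omega> ^ (2 * p))) \<partial>M)"
    by (intro nn_integral_mono_AE) (auto elim!: eventually_mono intro!: ennreal_leI)
  also have "\<dots> = ennreal (LINT \<omega>|M. 2 ^ p * (?R \<omega> ^ (2 * p) + ?I \<omega> ^ (2 * p)))"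
    using R(1) I(1) by (intro nn_integral_eq_integral) auto
  also have "\<dots> \<le> ennreal (moment_const p * sq_norm f ^ p)"
  proof (rule ennreal_leI)
    have "(LINT \<omega>|M. 2 ^ p * (?R \<omega> ^ (2 * p) + ?I \<omega> ^ (2 * p)))
      = 2 ^ p * ((LINT \<omega>|M. ?R \<omega> ^ (2 * p)) + (LINT \<omega>|M. ?I \<omega> ^ (2 * p)))"
      using R(1) I(1) by simp
    also have "\<dots> \<le> 2 ^ p * (?k * sq_norm f ^ p + ?k * sq_norm f ^ p)"
      by (intro mult_left_mono add_mono EX f fi n) auto
    also have "\<dots> = moment_const p * sq_norm f ^ p" by (simp add: moment_const_def)
    finally show "(LINT \<omega>|M. 2 ^ p * (?R \<omega> ^ (2 * p) + ?I \<omega> ^ (2 * p))) \<le> moment_const p * sq_norm f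
      ^ p" .
  qed
  finally show ?thesis .
qed

text \<open>The isometry turns dominated pointwise convergence of kernels into mean square
  convergence, while the variables \<open>X m\<close> converge almost surely; Fatou's lemma shows
  that both limits agree. Every passage from a derivative or integral of a path to a stochastic
  integral rests on this.\<close>

lemma W_limit:
  assumes f: "\<And>m. f m \<in> borel_measurable borel" and G: "integrable lborel (\<lambda>z. (G z)\<^sup>2)"
    and le: "\<And>m z. cmod (f m z) \<le> G z" and lim: "\<And>z. (\<lambda>m. f m z) \<longlonglongrightarrow> g z"
    and X: "\<And>m. AE \<omega> in M. X m \<omega> = W (f m) \<omega>" and Xlim: "AE \<omega> in M. (\<lambda>m. X m \<omega>) \<longlonglongrightarrow> Y \<omega>"
  shows "g \<in> square_integrable" "AE \<omega> in M. Y \<omega> = W g \<omega>"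
proof -
  have fm: "f m \<in> square_integrable" for m by (rule square_integrable_dominated[OF f G le])
  have gm: "g \<in> borel_measurable borel" by (rule borel_measurable_LIMSEQ_metric[OF f lim])
  have gle: "cmod (g z) \<le> G z" for z
    by (rule tendsto_upperbound[OF tendsto_norm[OF lim]]) (auto intro: always_eventually le)
  show g: "g \<in> square_integrable" by (rule square_integrable_dominated[OF gm G gle])
  have d: "(\<lambda>z. f m z - g z) \<in> square_integrable" for m
    using square_integrable_lin[OF fm[of m] g, of 1 "-1"] by simp
  have "(\<lambda>m. sq_norm (\<lambda>z. f m z - g z)) \<longlonglongrightarrow> (LINT z|(lborel :: (real \<times> real) measure). (0::real))"
    unfolding sq_norm_def
  proof (rule integral_dominated_convergence[where w="\<lambda>z. 4 * (G z)\<^sup>2"])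
    show "AE z in lborel. (\<lambda>m. (cmod (f m z - g z))\<^sup>2) \<longlonglongrightarrow> 0"
    proof (rule AE_I2)
      fix z
      have "(\<lambda>m. (cmod (f m z - g z))\<^sup>2) \<longlonglongrightarrow> (cmod (g z - g z))\<^sup>2" by (intro tendsto_intros lim)
      then show "(\<lambda>m. (cmod (f m z - g z))\<^sup>2) \<longlonglongrightarrow> 0" by simp
    qed
    show "AE z in lborel. norm ((cmod (f m z - g z))\<^sup>2) \<le> 4 * (G z)\<^sup>2" for m
    proof (rule AE_I2)
      fix z
      have "cmod (f m z - g z) \<le> 2 * G z" using norm_triangle_ineq4[of "f m z" "g z"] le[of m z]
        gle[of z] by linarith
      then have "(cmod (f m z - g z))\<^sup>2 \<le> (2 * G z)\<^sup>2" by (intro power_mono) auto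
      then show "norm ((cmod (f m z - g z))\<^sup>2) \<le> 4 * (G z)\<^sup>2" by (simp add: power_mult_distrib)
    qed
  qed (use f gm G in auto)
  then have lim0: "(\<lambda>m. ennreal (sq_norm (\<lambda>z. f m z - g z))) \<longlonglongrightarrow> 0"
    by (simp add: tendsto_ennreal_iff[symmetric] del: tendsto_ennreal_iff) (metis ennreal_0
    tendsto_ennrealI)
  have E: "(\<integral>\<^sup>+\<omega>. ennreal ((cmod (W (f m) \<omega> - W g \<omega>))\<^sup>2) \<partial>M) = ennreal (sq_norm (\<lambda>z. f m z - g z))"
    for m
  proof -
    have "(\<integral>\<^sup>+\<omega>. ennreal ((cmod (W (f m) \<omega> - W g \<omega>))\<^sup>2) \<partial>M)
      = (\<integral>\<^sup>+\<omega>. ennreal ((cmod (W (\<lambda>z. f m z - g z) \<omega>))\<^sup>2) \<partial>M)"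
      by (rule nn_integral_cong_AE) (use W_diff[OF fm[of m] g] in \<open>auto elim!: eventually_mono\<close>)
    then show ?thesis using W_nn_isometry[OF d] by simp
  qed
  \<comment> \<open>The lower limit integrates to zero and thus vanishes almost surely. As the whole
    sequence converges to the squared distance between \<open>Y\<close> and \<open>W g\<close>, that
    distance is zero, without any choice of subsequence.\<close>
  have "(\<integral>\<^sup>+\<omega>. liminf (\<lambda>m. ennreal ((cmod (W (f m) \<omega> - W g \<omega>))\<^sup>2)) \<partial>M)
    \<le> liminf (\<lambda>m. \<integral>\<^sup>+\<omega>. ennreal ((cmod (W (f m) \<omega> - W g \<omega>))\<^sup>2) \<partial>M)"
    using fm g by (intro nn_integral_liminf) measurable
  also have "\<dots> = 0" unfolding E using lim_imp_Liminf[OF _ lim0] by simp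
  finally have "(\<integral>\<^sup>+\<omega>. liminf (\<lambda>m. ennreal ((cmod (W (f m) \<omega> - W g \<omega>))\<^sup>2)) \<partial>M) = 0" by simp
  then have "AE \<omega> in M. liminf (\<lambda>m. ennreal ((cmod (W (f m) \<omega> - W g \<omega>))\<^sup>2)) = 0"
    using fm g by (subst (asm) nn_integral_0_iff_AE) measurable
  moreover have "AE \<omega> in M. \<forall>m. X m \<omega> = W (f m) \<omega>" using X by (simp add: AE_all_countable)
  ultimately show "AE \<omega> in M. Y \<omega> = W g \<omega>" using Xlim
  proof eventually_elim
    case (elim \<omega>)
    have "(\<lambda>m. ennreal ((cmod (W (f m) \<omega> - W g \<omega>))\<^sup>2)) \<longlonglongrightarrow> ennreal ((cmod (Y \<omega> - W g \<omega>))\<^sup>2)"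
      using elim by (intro tendsto_intros) simp
    from lim_imp_Liminf[OF _ this] elim have "ennreal ((cmod (Y \<omega> - W g \<omega>))\<^sup>2) = 0" by simp
    then show ?case by simp
  qed
qed

text \<open>A stochastic Fubini theorem for continuous paths: the Riemann sums of the kernels are
  all dominated by (b - a) G.\<close>

lemma W_Icc_integral:
  fixes a b :: real
  assumes ab: "a \<le> b" and Z: "AE \<omega> in M. continuous_on {a..b} (Z \<omega>)"
    and ZW: "\<And>r. r \<in> {a..b} \<Longrightarrow> AE \<omega> in M. Z \<omega> r = W (g r) \<omega>"
    and g: "\<And>r. r \<in> {a..b} \<Longrightarrow> g r \<in> borel_measurable borel" and gc: "\<And>z. continuous_on {a..b}
      (\<lambda>r. g r z)"
    and G: "integrable lborel (\<lambda>z. (G z)\<^sup>2)" and le: "\<And>r z. r \<in> {a..b} \<Longrightarrow> cmod (g r z) \<le> G z"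
  shows "(\<lambda>z. LBINT r:{a..b}. g r z) \<in> square_integrable" "AE \<omega> in M. (LBINT r:{a..b}. Z \<omega> r)
    = W (\<lambda>z. LBINT r:{a..b}. g r z) \<omega>"
proof -
  let ?h = "\<lambda>m::nat. (b - a) / Suc m"
  let ?p = "\<lambda>m i. a + real i * ?h m"
  have p: "?p m i \<in> {a..b}" if "i < Suc m" for m i
  proof -
    have "real i / real (Suc m) \<le> 1" using that by simp
    then have "(real i / real (Suc m)) * (b - a) \<le> 1 * (b - a)" using ab by (intro mult_right_mono)
      auto
    then have "real i * ?h m \<le> b - a" by simp
    then show ?thesis using ab by simp
  qed
  have gm: "g (?p m i) \<in> square_integrable" if "i < Suc m" for m i
    by (rule square_integrable_dominated[OF g G le]) (use p[OF that] in auto)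
  have G': "integrable lborel (\<lambda>z. ((b - a) * G z)\<^sup>2)" using G by (simp add: power_mult_distrib)
  have m: "(\<lambda>z. \<Sum>i<Suc m. complex_of_real (?h m) * g (?p m i) z) \<in> borel_measurable borel" for m
    using square_integrable_sum[of "{..<Suc m}" "\<lambda>i. g (?p m i)" "\<lambda>_. complex_of_real (?h m)"]
      gm[of _ m]
    by (intro square_integrable_measurable) auto
  have bd: "cmod (\<Sum>i<Suc m. complex_of_real (?h m) * g (?p m i) z) \<le> (b - a) * G z" for m z
  proof -
    have "cmod (\<Sum>i<Suc m. complex_of_real (?h m) * g (?p m i) z) \<le> (\<Sum>i<Suc m. ?h m * G z)"
    proof (rule order_trans[OF norm_sum], rule sum_mono)
      fix i assume "i \<in> {..<Suc m}"
      then have "cmod (g (?p m i) z) \<le> G z" by (intro le p) simp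
      then show "cmod (complex_of_real (?h m) * g (?p m i) z) \<le> ?h m * G z"
        unfolding norm_mult norm_of_real using ab by (simp add: divide_right_mono mult_left_mono
          del: of_nat_Suc)
    qed
    also have "\<dots> = (b - a) * G z" by simp
    finally show ?thesis .
  qed
  have gl: "(\<lambda>m. \<Sum>i<Suc m. complex_of_real (?h m) * g (?p m i) z) \<longlonglongrightarrow> (LBINT r:{a..b}. g r z)" for z
    by (rule riemann_sum_tendsto[OF ab gc])
  have X: "AE \<omega> in M. (\<Sum>i<Suc m. complex_of_real (?h m) * Z \<omega> (?p m i))
    = W (\<lambda>z. \<Sum>i<Suc m. complex_of_real (?h m) * g (?p m i) z) \<omega>" for m
  proof -
    have "AE \<omega> in M. \<forall>i\<in>{..<Suc m}. Z \<omega> (?p m i) = W (g (?p m i)) \<omega>"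
    proof (rule AE_finite_allI)
      fix i assume "i \<in> {..<Suc m}"
      then show "AE \<omega> in M. Z \<omega> (?p m i) = W (g (?p m i)) \<omega>" by (intro ZW p) simp
    qed simp
    moreover have "AE \<omega> in M. W (\<lambda>z. \<Sum>i<Suc m. complex_of_real (?h m) * g (?p m i) z) \<omega>
      = (\<Sum>i<Suc m. complex_of_real (?h m) * W (g (?p m i)) \<omega>)"
      by (rule W_sum) (use gm in auto)
    ultimately show ?thesis by eventually_elim (simp del: of_nat_Suc)
  qed
  have Xl: "AE \<omega> in M. (\<lambda>m. \<Sum>i<Suc m. complex_of_real (?h m) * Z \<omega> (?p m i))
    \<longlonglongrightarrow> (LBINT r:{a..b}. Z \<omega> r)"
    using Z by eventually_elim (rule riemann_sum_tendsto[OF ab])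
  show "(\<lambda>z. LBINT r:{a..b}. g r z) \<in> square_integrable" "AE \<omega> in M. (LBINT r:{a..b}. Z \<omega> r)
    = W (\<lambda>z. LBINT r:{a..b}. g r z) \<omega>"
    using W_limit[OF m G' bd gl X Xl] by auto
qed

lemma W_interval_integral:
  fixes a b :: real
  assumes Z: "AE \<omega> in M. continuous_on UNIV (Z \<omega>)"
    and ZW: "\<And>r. AE \<omega> in M. Z \<omega> r = W (g r) \<omega>"
    and g: "\<And>r. g r \<in> borel_measurable borel" and gc: "\<And>z. continuous_on UNIV (\<lambda>r. g r z)"
    and G: "integrable lborel (\<lambda>z. (G z)\<^sup>2)" and le: "\<And>r z. cmod (g r z) \<le> G z"
  shows "(\<lambda>z. LBINT r=ereal a..ereal b. g r z) \<in> square_integrable"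
    "AE \<omega> in M. (LBINT r=ereal a..ereal b. Z \<omega> r) = W (\<lambda>z. LBINT r=ereal a..ereal b. g r z) \<omega>"
proof -
  have *: "(\<lambda>z. LBINT r=ereal a..ereal b. g r z) \<in> square_integrable \<and>
    (AE \<omega> in M. (LBINT r=ereal a..ereal b. Z \<omega> r) = W (\<lambda>z. LBINT r=ereal a..ereal b. g r z) \<omega>)" if
      "a \<le> b" for a b
  proof -
    have Z': "AE \<omega> in M. continuous_on {a..b} (Z \<omega>)" using Z by eventually_elim
      (rule continuous_on_subset, auto)
    have gc': "continuous_on {a..b} (\<lambda>r. g r z)" for z using gc continuous_on_subset by blast
    show ?thesis unfolding interval_integral_Icc[OF that]
      using W_Icc_integral[OF that Z' ZW g gc' G le] by auto
  qed
  have "(\<lambda>z. LBINT r=ereal a..ereal b. g r z) \<in> square_integrable \<and>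
    (AE \<omega> in M. (LBINT r=ereal a..ereal b. Z \<omega> r) = W (\<lambda>z. LBINT r=ereal a..ereal b. g r z) \<omega>)"
  proof (cases "a \<le> b")
    \<comment> \<open>Negative times occur as upper limits; both sides change sign when the
      endpoints are exchanged.\<close>
    case False
    then have ba: "b \<le> a" by simp
    from *[OF ba] have s: "(\<lambda>z. LBINT r=ereal b..ereal a. g r z) \<in> square_integrable"
      and ae: "AE \<omega> in M. (LBINT r=ereal b..ereal a. Z \<omega> r) = W (\<lambda>z. LBINT r=ereal b..ereal a. g r
        z) \<omega>" by auto
    show ?thesis
      unfolding interval_integral_endpoints_reverse[of "ereal a" "ereal b"]
      using square_integrable_cmult[OF s, of "-1"] W_cmult[OF s, of "-1"] ae by (auto elim: AE_mp)
  qed (rule *)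
  then show "(\<lambda>z. LBINT r=ereal a..ereal b. g r z) \<in> square_integrable"
    "AE \<omega> in M. (LBINT r=ereal a..ereal b. Z \<omega> r) = W (\<lambda>z. LBINT r=ereal a..ereal b. g r z) \<omega>"
      by auto
qed

text \<open>Difference quotients along t + 1/(m+1) are finite combinations of the variables. The
  Lipschitz bound lets \<open>G\<close> dominate all of their kernels, and differentiability of the
  paths supplies the almost sure limit.\<close>

lemma W_derivative:
  fixes X :: "'a \<Rightarrow> real \<Rightarrow> complex"
  assumes X: "\<And>s. AE \<omega> in M. X \<omega> s = W (k s) \<omega>" and d: "AE \<omega> in M. X \<omega> differentiable (at t)"
    and k: "\<And>s. k s \<in> square_integrable"
    and kd: "\<And>z. ((\<lambda>s. k s z) has_vector_derivative k' z) (at t)"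
    and G: "integrable lborel (\<lambda>z. (G z)\<^sup>2)" and le: "\<And>s z. cmod (k s z - k t z) \<le> \<bar>s - t\<bar> * G z"
  shows "k' \<in> square_integrable" "AE \<omega> in M. vector_derivative (X \<omega>) (at t) = W k' \<omega>"
proof -
  let ?s = "\<lambda>m::nat. t + 1 / real (Suc m)"
  have s: "?s \<longlonglongrightarrow> t" using tendsto_add[OF tendsto_const LIMSEQ_inverse_real_of_nat, of t]
    by (simp add: inverse_eq_divide)
  have q: "(\<lambda>m. of_nat (Suc m) * (f (?s m) - f t)) \<longlonglongrightarrow> D" if "(f has_vector_derivative D) (at t)" for
    f :: "real \<Rightarrow> complex" and D
  proof -
    have "((\<lambda>x. (f x - f t) /\<^sub>R (x - t)) \<longlongrightarrow> D) (at t)"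
    proof -
      have "((\<lambda>x. (f x - (f t + (x - t) *\<^sub>R D)) /\<^sub>R norm (x - t)) \<longlongrightarrow> 0) (at t)"
        using that unfolding has_vector_derivative_def has_derivative_at_within
          by (simp add: algebra_simps)
      then have n0: "((\<lambda>x. norm ((f x - (f t + (x - t) *\<^sub>R D)) /\<^sub>R norm (x - t))) \<longlongrightarrow> 0) (at t)"
        by (rule tendsto_norm_zero)
      have "((\<lambda>x. (f x - f t) /\<^sub>R (x - t) - D) \<longlongrightarrow> 0) (at t)"
      proof (rule tendsto_norm_zero_cancel, rule Lim_transform_eventually[OF n0])
        show "\<forall>\<^sub>F x in at t. norm ((f x - (f t + (x - t) *\<^sub>R D)) /\<^sub>R norm (x - t))
          = norm ((f x - f t) /\<^sub>R (x - t) - D)"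
          unfolding eventually_at_filter
        proof (rule always_eventually, intro allI impI)
          fix x assume x: "x \<noteq> t"
          have "(f x - f t) /\<^sub>R (x - t) - D = (f x - (f t + (x - t) *\<^sub>R D)) /\<^sub>R (x - t)"
          proof -
            have "f x - (f t + (x - t) *\<^sub>R D) = (f x - f t) - (x - t) *\<^sub>R D" by simp
            then show ?thesis using x by (simp only: scaleR_diff_right scaleR_scaleR) simp
          qed
          then show "norm ((f x - (f t + (x - t) *\<^sub>R D)) /\<^sub>R norm (x - t))
            = norm ((f x - f t) /\<^sub>R (x - t) - D)" by simp
        qed
      qed
      then show ?thesis by (simp add: LIM_zero_iff)
    qed
    moreover have "filterlim ?s (at t) sequentially" using s
      by (intro filterlim_atI always_eventually) auto
    ultimately have "(\<lambda>m. (f (?s m) - f t) /\<^sub>R (?s m - t)) \<longlonglongrightarrow> D" by (rule filterlim_compose)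
    then show ?thesis by (simp add: scaleR_conv_of_real mult.commute)
  qed
  have f: "(\<lambda>z. of_nat (Suc m) * (k (?s m) z - k t z)) \<in> square_integrable" for m
    using square_integrable_lin[OF k[of "?s m"] k[of t], of "of_nat (Suc m)" "- of_nat (Suc m)"]
      by (simp add: algebra_simps)
  have bd: "cmod (of_nat (Suc m) * (k (?s m) z - k t z)) \<le> G z" for m z
  proof -
    have "cmod (of_nat (Suc m) * (k (?s m) z - k t z)) = real (Suc m) * cmod (k (?s m) z - k t z)"
      by (simp only: norm_mult norm_of_nat)
    also have "\<dots> \<le> real (Suc m) * (\<bar>?s m - t\<bar> * G z)" by (intro mult_left_mono le) simp
    finally show ?thesis by simp
  qed
  have XW: "AE \<omega> in M. of_nat (Suc m) * (X \<omega> (?s m) - X \<omega> t)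
    = W (\<lambda>z. of_nat (Suc m) * (k (?s m) z - k t z)) \<omega>" for m
    using X[of "?s m"] X[of t] W_lin[OF k[of "?s m"] k[of t], of "of_nat (Suc m)"
      "- of_nat (Suc m)"]
    by eventually_elim (simp add: algebra_simps)
  have Xl: "AE \<omega> in M. (\<lambda>m. of_nat (Suc m) * (X \<omega> (?s m) - X \<omega> t)) \<longlonglongrightarrow> vector_derivative (X \<omega>) (at t)"
    using d by eventually_elim (rule q, simp add: vector_derivative_works)
  show "k' \<in> square_integrable" "AE \<omega> in M. vector_derivative (X \<omega>) (at t) = W k' \<omega>"
    using W_limit[OF square_integrable_measurable[OF f] G bd q[OF kd] XW Xl] by auto
qed

end

section \<open>The kernel of the process\<close>

text \<open>The chord has length 2 |sin (u/2)|, which is at most the arc |u|.\<close>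

lemma cmod_cis_diff_le: "cmod (cis a - cis b) \<le> \<bar>a - b\<bar>"
proof -
  have "cis a - cis b = cis b * (cis (a - b) - 1)" by (simp add: cis_mult algebra_simps)
  then have "cmod (cis a - cis b) = cmod (cis (a - b) - 1)" by (simp add: norm_mult)
  moreover have "(cmod (cis u - 1))\<^sup>2 \<le> u\<^sup>2" for u
  proof -
    have "(cmod (cis u - 1))\<^sup>2 = (cos u - 1)\<^sup>2 + (sin u)\<^sup>2" by (simp add: cmod_power2)
    also have "\<dots> = 2 - 2 * cos u"
      using sin_cos_squared_add[of u] by (simp add: power2_eq_square algebra_simps)
    also have "\<dots> = 4 * (sin (u/2))\<^sup>2" using cos_double_sin[of "u/2"] by simp
    also have "\<dots> \<le> 4 * (u/2)\<^sup>2"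
      using abs_sin_x_le_abs_x[of "u/2"] by (simp only: abs_le_square_iff)
    also have "\<dots> = u\<^sup>2" by (simp add: power2_eq_square)
    finally show ?thesis .
  qed
  then have "cmod (cis u - 1) \<le> \<bar>u\<bar>" for u by (metis abs_le_square_iff abs_norm_cancel)
  ultimately show ?thesis by simp
qed

lemma cis_has_vector_derivative [derivative_intros]:
  "((\<lambda>x. cis (x * a)) has_vector_derivative (\<i> * of_real a * cis (x * a))) (at x within S)"
  unfolding has_vector_derivative_def
  by (auto intro!: derivative_eq_intros simp: scaleR_conv_of_real algebra_simps)

text \<open>Differentiating (e^(i t \<xi>) - 1) / |\<xi>|^(H + 1/2) in t gives this amplitude times
  e^(i t \<xi>). At \<xi> = 0 the totalised division returns 0.\<close>

definition amp :: "real \<Rightarrow> real \<Rightarrow> complex" where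
  "amp H \<xi> = \<i> * of_real \<xi> / of_real (\<bar>\<xi>\<bar> powr (H + 1/2))"

text \<open>A plane wave of non-integer frequency \<eta> is not periodic; this is its leakage into
  the integer frequency \<open>k\<close>.\<close>

definition window :: "int \<Rightarrow> real \<Rightarrow> complex" where
  "window k \<eta> = fourier_coeff (\<lambda>x. cis (x * \<eta>)) k"

text \<open>The variable \<zeta> stands for \<xi> - k^2, the distance from resonance that remains
  after the phase of the Schroedinger flow is absorbed.\<close>

definition osc :: "(real \<Rightarrow> real) \<Rightarrow> real \<Rightarrow> real \<Rightarrow> complex" where
  "osc chi t \<zeta> = (LBINT r=0..t. of_real (chi r) * cis (r * \<zeta>))"

text \<open>Setting the level \<open>0\<close> to zero turns \<open>\<Psi>\<^sup>(\<^sup>1\<^sup>)\<close> into the first increment.\<close>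

definition band :: "nat \<Rightarrow> (real \<times> real) set" where
  "band n = (if n = 0 then {} else {(\<xi>, \<eta>). \<bar>\<xi>\<bar> \<le> 2 ^ (2 * n) \<and> \<bar>\<eta>\<bar> \<le> 2 ^ n})"

lemma band_measurable [measurable]: "band n \<in> sets borel"
proof -
  have "closed {(\<xi>, \<eta>). \<bar>\<xi>::real\<bar> \<le> 2 ^ (2 * n) \<and> \<bar>\<eta>::real\<bar> \<le> 2 ^ n}"
    unfolding split_beta by (intro closed_Collect_conj closed_Collect_le continuous_intros)
  then show ?thesis by (simp add: band_def)
qed

text \<open>Modulus of the two amplitudes on the band. Multiples of it are the square integrable
  envelopes under which derivatives and integrals are exchanged with the white noise at level
  \<open>n\<close>.\<close>

definition amp_weight :: "real \<Rightarrow> real \<Rightarrow> nat \<Rightarrow> real \<times> real \<Rightarrow> real" where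
  "amp_weight H0 H1 n = (\<lambda>(\<xi>, \<eta>). indicator (band n) (\<xi>, \<eta>) * (\<bar>\<xi>\<bar> powr (1/2 - H0) * \<bar>\<eta>\<bar> powr
    (1/2 - H1)))"

definition noise_kernel :: "real \<Rightarrow> real \<Rightarrow> real \<Rightarrow> nat \<Rightarrow> int \<Rightarrow> real \<Rightarrow> real \<times> real \<Rightarrow> complex" where
  "noise_kernel c H0 H1 n k r = (\<lambda>(\<xi>, \<eta>). of_real (c * indicator (band n) (\<xi>, \<eta>)) * (amp H0 \<xi> * amp
    H1 \<eta>) * cis (r * \<xi>) * window k \<eta>)"

definition psi_kernel :: "real \<Rightarrow> real \<Rightarrow> real \<Rightarrow> (real \<Rightarrow> real) \<Rightarrow> nat \<Rightarrow> int \<Rightarrow> real \<Rightarrow> real \<times> real \<Rightarrow>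
  complex" where
  "psi_kernel c H0 H1 chi n k t = (\<lambda>(\<xi>, \<eta>). of_real (c * indicator (band n) (\<xi>, \<eta>)) *
    (amp H0 \<xi> * amp H1 \<eta>) *
     (window k \<eta> * (- \<i> * of_real (chi t) * osc chi t (\<xi> - (of_int k)\<^sup>2))))"

lemma norm_amp: "cmod (amp H \<xi>) = \<bar>\<xi>\<bar> powr (1/2 - H)"
proof (cases "\<xi> = 0")
  case False
  then have "\<bar>\<xi>\<bar> / \<bar>\<xi>\<bar> powr (H + 1/2) = \<bar>\<xi>\<bar> powr 1 / \<bar>\<xi>\<bar> powr (H + 1/2)" by simp
  also have "\<dots> = \<bar>\<xi>\<bar> powr (1 - (H + 1/2))" by (rule powr_diff[symmetric])
  finally show ?thesis by (simp add: amp_def norm_divide norm_mult)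
qed (simp add: amp_def)

lemma powr_square: "(x powr a)\<^sup>2 = x powr (2 * a)" for x a :: real
  by (simp add: power2_eq_square powr_add[symmetric])

lemma nn_integral_even_le:
  fixes f :: "real \<Rightarrow> ennreal"
  assumes [measurable]: "f \<in> borel_measurable borel" and even: "\<And>x. f (- x) = f x"
  shows "(\<integral>\<^sup>+x. f x \<partial>lborel) \<le> 2 * (\<integral>\<^sup>+x. f x * indicator {0..} x \<partial>lborel)"
proof -
  have "(\<integral>\<^sup>+x. f x \<partial>lborel) \<le> (\<integral>\<^sup>+x. f x * indicator {0..} x + f x * indicator {..0} x \<partial>lborel)"
    by (intro nn_integral_mono) (auto simp: indicator_def)
  also have "\<dots> = (\<integral>\<^sup>+x. f x * indicator {0..} x \<partial>lborel) + (\<integral>\<^sup>+x. f x * indicator {..0} x \<partial>lborel)"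
    by (rule nn_integral_add) auto
  also have "(\<integral>\<^sup>+x. f x * indicator {..0} x \<partial>lborel) = (\<integral>\<^sup>+x. f (0 + (-1) * x) * indicator {..0} (0
    + (-1) * x) \<partial>lborel)"
    using nn_integral_real_affine[of "\<lambda>x. f x * indicator {..0} x" "-1" 0] by simp
  also have "\<dots> = (\<integral>\<^sup>+x. f x * indicator {0..} x \<partial>lborel)"
    by (intro nn_integral_cong) (auto simp: even indicator_def)
  finally show ?thesis by (simp add: mult_2)
qed

lemma nn_integral_powr_near_0:
  assumes a: "-1 < a" and R: "0 \<le> R"
  shows "(\<integral>\<^sup>+x. ennreal (\<bar>x\<bar> powr a) * indicator {-R..R} x \<partial>lborel) \<le> ennreal (2 * R powr (a + 1) /
    (a + 1))"
proof -
  have "(\<integral>\<^sup>+x. ennreal (\<bar>x\<bar> powr a) * indicator {-R..R} x \<partial>lborel)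
    \<le> 2 * (\<integral>\<^sup>+x. ennreal (\<bar>x\<bar> powr a) * indicator {-R..R} x * indicator {0..} x \<partial>lborel)"
    by (rule nn_integral_even_le) (auto simp: indicator_def)
  also have "(\<integral>\<^sup>+x. ennreal (\<bar>x\<bar> powr a) * indicator {-R..R} x * indicator {0..} x \<partial>lborel)
    = (\<integral>\<^sup>+x. ennreal (x powr a) * indicator {0..R} x \<partial>lborel)"
    by (intro nn_integral_cong) (auto simp: indicator_def)
  also have "\<dots> = ennreal (R powr (a + 1) / (a + 1))"
    by (rule nn_integral_has_integral_lebesgue'[OF _ has_integral_powr_from_0[OF a R]]) simp
  also have "2 * \<dots> = ennreal (2 * (R powr (a + 1) / (a + 1)))"
    using a by (subst ennreal_mult') auto
  finally show ?thesis by simp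
qed

lemma nn_integral_lborel_prod_mult:
  fixes f g :: "real \<Rightarrow> ennreal"
  assumes [measurable]: "f \<in> borel_measurable borel" "g \<in> borel_measurable borel"
  shows "(\<integral>\<^sup>+z. f (fst z) * g (snd z) \<partial>lborel) = (\<integral>\<^sup>+x. f x \<partial>lborel) * (\<integral>\<^sup>+x. g x \<partial>lborel)"
proof -
  have "(\<integral>\<^sup>+z. f (fst z) * g (snd z) \<partial>lborel) = (\<integral>\<^sup>+z. f (fst z) * g (snd z) \<partial>(lborel \<Otimes>\<^sub>M lborel))"
    by (simp add: lborel_prod)
  also have "\<dots> = (\<integral>\<^sup>+x. (\<integral>\<^sup>+y. f x * g y \<partial>lborel) \<partial>lborel)"
    by (subst lborel.nn_integral_fst[symmetric]) auto
  also have "\<dots> = (\<integral>\<^sup>+x. f x \<partial>lborel) * (\<integral>\<^sup>+x. g x \<partial>lborel)"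
    by (simp add: nn_integral_cmult nn_integral_multc)
  finally show ?thesis .
qed

lemma borel_pair [measurable_cong]: "sets (borel :: (real \<times> real) measure) = sets (borel \<Otimes>\<^sub>M borel)"
  by (rule arg_cong[where f=sets, OF borel_prod[symmetric]])

lemma amp_weight_measurable [measurable]: "amp_weight H0 H1 n \<in> borel_measurable borel"
  unfolding amp_weight_def split_beta by measurable

text \<open>The squared weight is bounded by a product over a rectangle, and both exponents 1 - 2 H
  exceed -1, so the singularities on the axes are integrable.\<close>

lemma amp_weight_nn_integral:
  assumes H: "H0 < 1" "H1 < 1"
  shows "(\<integral>\<^sup>+z. ennreal ((amp_weight H0 H1 n z)\<^sup>2) \<partial>lborel)
    \<le> ennreal (2 * (2 ^ (2 * n)) powr (2 - 2 * H0) / (2 - 2 * H0)) * ennreal (2 * (2 ^ n) powr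
      (2 - 2 * H1) / (2 - 2 * H1))"
proof -
  have "(\<integral>\<^sup>+z. ennreal ((amp_weight H0 H1 n z)\<^sup>2) \<partial>lborel)
     \<le> (\<integral>\<^sup>+z. (ennreal (\<bar>fst z\<bar> powr (1 - 2 * H0)) * indicator {-(2 ^ (2 * n))..2 ^ (2 * n)}
       (fst z)) *
         (ennreal (\<bar>snd z\<bar> powr (1 - 2 * H1)) * indicator {-(2 ^ n)..2 ^ n} (snd z)) \<partial>lborel)"
    by (intro nn_integral_mono)
       (auto simp: amp_weight_def band_def indicator_def power_mult_distrib powr_square
         right_diff_distrib ennreal_mult' split: if_splits)
  also have "\<dots> = (\<integral>\<^sup>+x. ennreal (\<bar>x\<bar> powr (1 - 2 * H0)) * indicator {-(2 ^ (2 * n))..2 ^ (2 * n)} x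
    \<partial>lborel) *
        (\<integral>\<^sup>+x. ennreal (\<bar>x\<bar> powr (1 - 2 * H1)) * indicator {-(2 ^ n)..2 ^ n} x \<partial>lborel)"
    by (rule nn_integral_lborel_prod_mult) auto
  also have "\<dots> \<le> ennreal (2 * (2 ^ (2 * n)) powr (2 - 2 * H0) / (2 - 2 * H0)) * ennreal
    (2 * (2 ^ n) powr (2 - 2 * H1) / (2 - 2 * H1))"
    using nn_integral_powr_near_0[of "1 - 2 * H0" "2 ^ (2*n)"] nn_integral_powr_near_0[of
      "1 - 2 * H1" "2 ^ n"] H
    by (intro mult_mono) (auto simp: algebra_simps)
  finally show ?thesis .
qed

lemma amp_weight_square_integrable:
  assumes H: "H0 < 1" "H1 < 1"
  shows "integrable lborel (\<lambda>z. (amp_weight H0 H1 n z)\<^sup>2)"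
proof (rule integrableI_bounded)
  show "(\<integral>\<^sup>+z. ennreal (norm ((amp_weight H0 H1 n z)\<^sup>2)) \<partial>lborel) < \<infinity>"
    using le_less_trans[OF amp_weight_nn_integral[OF H, of n]] by (simp add: ennreal_mult_less_top)
qed simp

lemma norm_fourier_coeff_le:
  assumes "f \<in> borel_measurable borel" "\<And>x. cmod (f x) \<le> C"
  shows "cmod (fourier_coeff f k) \<le> C"
  using fourier_coeff_diff_le[OF integrable_torus_bounded[OF assms], of "\<lambda>_. 0" C k] assms by simp

lemma norm_window_le_1: "cmod (window k \<eta>) \<le> 1"
  unfolding window_def by (rule norm_fourier_coeff_le) auto

section \<open>Stochastic integral representation of the noise and of the process\<close>

locale sheet = white_noise M W for M :: "'a measure" and W +
  fixes c H0 H1 :: real and chi :: "real \<Rightarrow> real" and B :: "nat \<Rightarrow> 'a \<Rightarrow> real \<Rightarrow> real \<Rightarrow> complex"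
  assumes c_pos: "0 < c" and H: "0 < H0" "H0 < 1" "0 < H1" "H1 < 1"
    and chi: "cutoff chi" and B: "\<And>n. n \<ge> 1 \<Longrightarrow> sheet_approx M W c H0 H1 n (B n)"
begin

lemma chi_continuous: "continuous_on S chi"
proof -
  have "\<forall>t. (deriv ^^ 0) chi differentiable (at t)" using chi unfolding cutoff_def by blast
  then have "\<forall>t. chi differentiable (at t)" by simp
  then show ?thesis
    by (meson continuous_at_imp_continuous_on differentiable_imp_continuous_within)
qed

lemma chi_bounds: "0 \<le> chi t" "chi t \<le> 1" "2 \<le> \<bar>t\<bar> \<Longrightarrow> chi t = 0" "\<bar>t\<bar> \<le> 1 \<Longrightarrow> chi t = 1"
  using chi unfolding cutoff_def by blast+

lemma sheet_kernel_eq: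
  assumes "n \<ge> 1"
  shows "sheet_kernel H0 H1 n t x = (\<lambda>(\<xi>, \<eta>). of_real (indicator (band n) (\<xi>, \<eta>)) *
    ((cis (t * \<xi>) - 1) / of_real (\<bar>\<xi>\<bar> powr (H0 + 1/2)) * ((cis (x * \<eta>) - 1) / of_real (\<bar>\<eta>\<bar> powr (H1
      + 1/2)))))"
  using assms by (auto simp: sheet_kernel_def band_def indicator_def fun_eq_iff)

text \<open>The increment of the phase gains one power of |\<xi>|; this is the domination required
  to differentiate kernels in time or space.\<close>

lemma cis_over_powr_le: "cmod ((cis (t * \<xi>) - cis (s * \<xi>)) / of_real (\<bar>\<xi>\<bar> powr (H + 1/2)))
  \<le> \<bar>t - s\<bar> * \<bar>\<xi>\<bar> powr (1/2 - H)"
proof -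
  have "cmod ((cis (t * \<xi>) - cis (s * \<xi>)) / of_real (\<bar>\<xi>\<bar> powr (H + 1/2))) \<le> \<bar>t * \<xi> - s * \<xi>\<bar> / \<bar>\<xi>\<bar>
    powr (H + 1/2)"
    unfolding norm_divide by (simp add: divide_right_mono cmod_cis_diff_le)
  also have "\<dots> = \<bar>t - s\<bar> * cmod (amp H \<xi>)" by (simp add: amp_def norm_divide norm_mult
    left_diff_distrib[symmetric] abs_mult)
  finally show ?thesis by (simp add: norm_amp)
qed

text \<open>Differentiation follows the order in \<open>mixed_deriv\<close>, in \<open>x\<close> and
  then in \<open>t\<close>. Both times the difference quotients of the kernel are dominated by a
  multiple of \<open>amp_weight\<close>, and the paths are differentiable by
  \<open>sheet_approx\<close>.\<close>

lemma mixed_deriv_W: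
  assumes n: "n \<ge> 1"
  shows "(\<lambda>(\<xi>, \<eta>). of_real (c * indicator (band n) (\<xi>, \<eta>)) * (amp H0 \<xi> * cis (t * \<xi>) *
    (amp H1 \<eta> * cis (x * \<eta>)))) \<in> square_integrable" (is "?K \<in> _")
    "AE \<omega> in M. mixed_deriv (B n \<omega>) t x = W (\<lambda>(\<xi>, \<eta>). of_real (c * indicator (band n) (\<xi>, \<eta>)) *
      (amp H0 \<xi> * cis (t * \<xi>) * (amp H1 \<eta> * cis (x * \<eta>)))) \<omega>"
proof -
  let ?g = "amp_weight H0 H1 n"
  note iG = amp_weight_square_integrable[OF H(2) H(4), of n]
  have iG': "integrable lborel (\<lambda>z. (C * ?g z)\<^sup>2)" for C using iG by (simp add: power_mult_distrib)
  let ?k0 = "\<lambda>t x z. of_real c * sheet_kernel H0 H1 n t x z"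
  have m0: "sheet_kernel H0 H1 n t x \<in> borel_measurable borel" for t x
    unfolding sheet_kernel_eq[OF n] split_beta by measurable
  have b0: "cmod (sheet_kernel H0 H1 n t x z) \<le> \<bar>t\<bar> * \<bar>x\<bar> * ?g z" for t x z
  proof (cases z)
    case (Pair \<xi> \<eta>)
    have "cmod ((cis (t * \<xi>) - 1) / of_real (\<bar>\<xi>\<bar> powr (H0 + 1/2))) \<le> \<bar>t\<bar> * \<bar>\<xi>\<bar> powr (1/2 - H0)"
      using cis_over_powr_le[of t \<xi> 0 H0] by simp
    moreover have "cmod ((cis (x * \<eta>) - 1) / of_real (\<bar>\<eta>\<bar> powr (H1 + 1/2)))
      \<le> \<bar>x\<bar> * \<bar>\<eta>\<bar> powr (1/2 - H1)"
      using cis_over_powr_le[of x \<eta> 0 H1] by simp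
    ultimately have "cmod ((cis (t * \<xi>) - 1) / of_real (\<bar>\<xi>\<bar> powr (H0 + 1/2))) * cmod
      ((cis (x * \<eta>) - 1) / of_real (\<bar>\<eta>\<bar> powr (H1 + 1/2)))
       \<le> (\<bar>t\<bar> * \<bar>\<xi>\<bar> powr (1/2 - H0)) * (\<bar>x\<bar> * \<bar>\<eta>\<bar> powr (1/2 - H1))" by (intro mult_mono) auto
    then have "indicator (band n) (\<xi>, \<eta>) * (cmod ((cis (t * \<xi>) - 1) / of_real (\<bar>\<xi>\<bar> powr (H0 + 1/2)))
      * cmod ((cis (x * \<eta>) - 1) / of_real (\<bar>\<eta>\<bar> powr (H1 + 1/2))))
       \<le> indicator (band n) (\<xi>, \<eta>) * ((\<bar>t\<bar> * \<bar>\<xi>\<bar> powr (1/2 - H0)) * (\<bar>x\<bar> * \<bar>\<eta>\<bar> powr (1/2 - H1)))"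
      by (rule mult_left_mono) simp
    then show ?thesis unfolding sheet_kernel_eq[OF n] Pair amp_weight_def prod.case norm_mult
      norm_of_real
      by (simp add: mult_ac)
  qed
  have s0: "sheet_kernel H0 H1 n t x \<in> square_integrable" for t x
    by (rule square_integrable_dominated[OF m0 iG' b0])
  have X0: "AE \<omega> in M. B n \<omega> t x = W (?k0 t x) \<omega>" for t x
  proof -
    have "AE \<omega> in M. B n \<omega> t x = of_real c * W (sheet_kernel H0 H1 n t x) \<omega>"
      using B[OF n] by (simp add: sheet_approx_def)
    then show ?thesis using W_cmult[OF s0[of t x], of "of_real c"] by eventually_elim simp
  qed
  have reg: "AE \<omega> in M. has_continuous_mixed_deriv (B n \<omega>)" using B[OF n]
    by (simp add: sheet_approx_def)
  \<comment> \<open>The kernel after the space derivative: the factor in \<eta> is already an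
    amplitude times a phase, the factor in \<xi> is still an increment from time 0.\<close>
  define k1 where "k1 t = (\<lambda>(\<xi>, \<eta>). of_real (c * indicator (band n) (\<xi>, \<eta>)) *
    ((cis (t * \<xi>) - 1) / of_real (\<bar>\<xi>\<bar> powr (H0 + 1/2)) * (amp H1 \<eta> * cis (x * \<eta>))))" for t
  have 1: "k1 t \<in> square_integrable \<and> (AE \<omega> in M. vector_derivative (B n \<omega> t) (at x) = W (k1 t) \<omega>)"
    for t
  proof -
    have d: "AE \<omega> in M. B n \<omega> t differentiable (at x)"
      using reg by eventually_elim (simp add: has_continuous_mixed_deriv_def)
    have kd: "((\<lambda>s. ?k0 t s z) has_vector_derivative k1 t z) (at x)" for z
    proof (cases z)
      case (Pair \<xi> \<eta>)
      have "((\<lambda>s. of_real (c * indicator (band n) (\<xi>, \<eta>)) * ((cis (t * \<xi>) - 1) / of_real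
        (\<bar>\<xi>\<bar> powr (H0 + 1/2)) * ((cis (s * \<eta>) - 1) / of_real (\<bar>\<eta>\<bar> powr (H1 + 1/2)))))
         has_vector_derivative of_real (c * indicator (band n) (\<xi>, \<eta>)) * ((cis (t * \<xi>) - 1) /
           of_real (\<bar>\<xi>\<bar> powr (H0 + 1/2)) * ((\<i> * of_real \<eta> * cis (x * \<eta>) - 0) / of_real
           (\<bar>\<eta>\<bar> powr (H1 + 1/2))))) (at x)"
        by (intro has_vector_derivative_mult_right has_vector_derivative_divide
          has_vector_derivative_diff cis_has_vector_derivative has_vector_derivative_const)
      then show ?thesis unfolding sheet_kernel_eq[OF n] Pair k1_def
        by (simp add: amp_def mult.assoc)
    qed
    have le: "cmod (?k0 t s z - ?k0 t x z) \<le> \<bar>s - x\<bar> * (c * \<bar>t\<bar> * ?g z)" for s z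
    proof (cases z)
      case (Pair \<xi> \<eta>)
      have "?k0 t s z - ?k0 t x z = of_real (c * indicator (band n) (\<xi>, \<eta>)) *
        ((cis (t * \<xi>) - cis (0 * \<xi>)) / of_real (\<bar>\<xi>\<bar> powr (H0 + 1/2)) * ((cis (s * \<eta>) - cis (x * \<eta>))
        / of_real (\<bar>\<eta>\<bar> powr (H1 + 1/2))))"
        unfolding sheet_kernel_eq[OF n] Pair by (simp add: algebra_simps diff_divide_distrib)
      also have "cmod \<dots> = c * indicator (band n) (\<xi>, \<eta>) * (cmod ((cis (t * \<xi>) - cis (0 * \<xi>)) /
        of_real (\<bar>\<xi>\<bar> powr (H0 + 1/2))) * cmod ((cis (s * \<eta>) - cis (x * \<eta>)) / of_real (\<bar>\<eta>\<bar> powr (H1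
        + 1/2))))"
        unfolding norm_mult norm_of_real using c_pos by (auto simp: indicator_def)
      also have "\<dots> \<le> c * indicator (band n) (\<xi>, \<eta>) * ((\<bar>t - 0\<bar> * \<bar>\<xi>\<bar> powr (1/2 - H0)) *
        (\<bar>s - x\<bar> * \<bar>\<eta>\<bar> powr (1/2 - H1)))"
        using c_pos by (intro mult_left_mono mult_mono cis_over_powr_le) auto
      also have "\<dots> = \<bar>s - x\<bar> * (c * \<bar>t\<bar> * ?g z)" unfolding Pair amp_weight_def by simp
      finally show ?thesis .
    qed
    show ?thesis using W_derivative[OF X0 d square_integrable_cmult[OF s0] kd iG' le] by simp
  qed
  have d: "AE \<omega> in M. (\<lambda>s. vector_derivative (B n \<omega> s) (at x)) differentiable (at t)"
    using reg by eventually_elim (simp add: has_continuous_mixed_deriv_def)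
  have kd: "((\<lambda>s. k1 s z) has_vector_derivative ?K z) (at t)" for z
  proof (cases z)
    case (Pair \<xi> \<eta>)
    have "((\<lambda>s. of_real (c * indicator (band n) (\<xi>, \<eta>)) * ((cis (s * \<xi>) - 1) / of_real (\<bar>\<xi>\<bar> powr (H0
      + 1/2)) * (amp H1 \<eta> * cis (x * \<eta>))))
       has_vector_derivative of_real (c * indicator (band n) (\<xi>, \<eta>)) * ((\<i> * of_real \<xi> * cis (t * \<xi>)
         - 0) / of_real (\<bar>\<xi>\<bar> powr (H0 + 1/2)) * (amp H1 \<eta> * cis (x * \<eta>)))) (at t)"
      by (intro has_vector_derivative_mult_right has_vector_derivative_mult_left
        has_vector_derivative_divide has_vector_derivative_diff cis_has_vector_derivative
        has_vector_derivative_const)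
    then show ?thesis unfolding Pair k1_def by (simp add: amp_def[of H0] mult.assoc)
  qed
  have le: "cmod (k1 s z - k1 t z) \<le> \<bar>s - t\<bar> * (c * ?g z)" for s z
  proof (cases z)
    case (Pair \<xi> \<eta>)
    have "k1 s z - k1 t z = of_real (c * indicator (band n) (\<xi>, \<eta>)) * ((cis (s * \<xi>) - cis (t * \<xi>)) /
      of_real (\<bar>\<xi>\<bar> powr (H0 + 1/2)) * (amp H1 \<eta> * cis (x * \<eta>)))"
      unfolding k1_def Pair by (simp add: algebra_simps diff_divide_distrib)
    also have "cmod \<dots> = c * indicator (band n) (\<xi>, \<eta>) * (cmod ((cis (s * \<xi>) - cis (t * \<xi>)) / of_real
      (\<bar>\<xi>\<bar> powr (H0 + 1/2))) * \<bar>\<eta>\<bar> powr (1/2 - H1))"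
      unfolding norm_mult norm_of_real norm_amp using c_pos by (auto simp: indicator_def)
    also have "\<dots> \<le> c * indicator (band n) (\<xi>, \<eta>) * ((\<bar>s - t\<bar> * \<bar>\<xi>\<bar> powr (1/2 - H0)) * \<bar>\<eta>\<bar> powr
      (1/2 - H1))"
      using c_pos by (intro mult_left_mono mult_right_mono cis_over_powr_le) auto
    also have "\<dots> = \<bar>s - t\<bar> * (c * ?g z)" unfolding Pair amp_weight_def by simp
    finally show ?thesis .
  qed
  have X1: "AE \<omega> in M. vector_derivative (B n \<omega> s) (at x) = W (k1 s) \<omega>" for s using 1 by blast
  have s1: "k1 s \<in> square_integrable" for s using 1 by blast
  show "?K \<in> square_integrable" "AE \<omega> in M. mixed_deriv (B n \<omega>) t x = W ?K \<omega>"
    unfolding mixed_deriv_def using W_derivative[OF X1 d s1 kd iG' le] by auto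
qed

definition noise_coeff :: "nat \<Rightarrow> 'a \<Rightarrow> int \<Rightarrow> real \<Rightarrow> complex" where
  "noise_coeff n \<omega> k r = fourier_coeff (mixed_deriv (B n \<omega>) r) k"

lemma mixed_deriv_continuous:
  assumes n: "n \<ge> 1"
  shows "AE \<omega> in M. continuous_on UNIV (\<lambda>(t, x). mixed_deriv (B n \<omega>) t x)"
  using B[OF n] unfolding sheet_approx_def has_continuous_mixed_deriv_def
    by (auto elim!: eventually_mono)

text \<open>The exceptional event is that of the jointly continuous mixed derivative, hence common
  to all \<open>k\<close>.\<close>

lemma noise_coeff_continuous:
  assumes n: "n \<ge> 1"
  shows "AE \<omega> in M. \<forall>k. continuous_on UNIV (noise_coeff n \<omega> k)"
  using mixed_deriv_continuous[OF n]
proof eventually_elim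
  case (elim \<omega>)
  show ?case
  proof
    fix k
    have md: "continuous_on S (\<lambda>z. mixed_deriv (B n \<omega>) (fst z) (snd z))" for S
      using elim unfolding split_beta by (rule continuous_on_subset) simp
    have c2: "continuous_on (UNIV \<times> cbox 0 (2*pi)) (\<lambda>(r, x). cis (- (real_of_int k * x)) *
      mixed_deriv (B n \<omega>) r x)"
      unfolding split_beta by (intro continuous_intros md)
    have c1: "continuous_on {0..2*pi} (\<lambda>x. cis (- (real_of_int k * x)) * mixed_deriv (B n \<omega>) r x)"
      for r
    proof -
      have "continuous_on {0..2*pi} ((\<lambda>z. mixed_deriv (B n \<omega>) (fst z) (snd z)) \<circ> (\<lambda>x. (r, x)))"
        by (intro continuous_on_compose md continuous_intros)
      then show ?thesis by (intro continuous_intros) (simp add: o_def)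
    qed
    have "noise_coeff n \<omega> k = (\<lambda>r. integral (cbox 0 (2*pi)) (\<lambda>x. cis (- (real_of_int k * x)) *
      mixed_deriv (B n \<omega>) r x) / (2 * pi))"
      unfolding noise_coeff_def fourier_coeff_def zero_ereal_def
      by (subst interval_integral_Icc) (auto simp: integral_Icc_eq_HK(1)[OF c1])
    then show "continuous_on UNIV (noise_coeff n \<omega> k)"
      using integral_continuous_on_param[OF c2] by (auto intro!: continuous_intros)
  qed
qed

text \<open>The integral over one period passes inside the white noise and acts on the single factor
  that depends on \<open>x\<close>, which produces \<open>window\<close>.\<close>

lemma noise_coeff_W:
  assumes n: "n \<ge> 1"
  shows "noise_kernel c H0 H1 n k r \<in> square_integrable" "AE \<omega> in M. noise_coeff n \<omega> k r
    = W (noise_kernel c H0 H1 n k r) \<omega>"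
proof -
  let ?g = "amp_weight H0 H1 n"
  have iG: "integrable lborel (\<lambda>z. (c * ?g z)\<^sup>2)" using amp_weight_square_integrable[OF H(2) H(4),
    of n] by (simp add: power_mult_distrib)
  let ?K = "\<lambda>x (\<xi>, \<eta>). of_real (c * indicator (band n) (\<xi>, \<eta>)) * (amp H0 \<xi> * cis (r * \<xi>) *
    (amp H1 \<eta> * cis (x * \<eta>)))"
  let ?k = "\<lambda>x z. cis (- (real_of_int k * x)) * ?K x z"
  have Z: "AE \<omega> in M. continuous_on UNIV (\<lambda>x. cis (- (real_of_int k * x)) * mixed_deriv (B n \<omega>) r
    x)"
    using mixed_deriv_continuous[OF n]
  proof eventually_elim
    case (elim \<omega>)
    have "continuous_on UNIV ((\<lambda>(t,x). mixed_deriv (B n \<omega>) t x) \<circ> (\<lambda>x. (r, x)))"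
      by (intro continuous_on_compose continuous_intros continuous_on_subset[OF elim]) simp
    then show ?case by (intro continuous_intros) (simp add: o_def)
  qed
  have ZW: "AE \<omega> in M. cis (- (real_of_int k * x)) * mixed_deriv (B n \<omega>) r x = W (?k x) \<omega>" for x
    using mixed_deriv_W(2)[OF n, of r x] W_cmult[OF mixed_deriv_W(1)[OF n, of r x], of
      "cis (- (real_of_int k * x))"]
    by eventually_elim simp
  have gm: "?k x \<in> borel_measurable borel" for x
    using square_integrable_cmult[OF mixed_deriv_W(1)[OF n, of r x]]
      by (rule square_integrable_measurable)
  have gc: "continuous_on UNIV (\<lambda>x. ?k x z)" for z
    by (cases z) (auto intro!: continuous_intros)
  have le: "cmod (?k x z) \<le> c * ?g z" for x z
    using c_pos by (cases z) (auto simp: norm_mult norm_amp amp_weight_def indicator_def)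
  note * = W_interval_integral[OF Z ZW gm gc iG le, of 0 "2*pi"]
  have eq: "noise_kernel c H0 H1 n k r = (\<lambda>z. of_real (1 / (2*pi)) * (LBINT x=ereal 0..ereal (2*pi).
    ?k x z))"
  proof
    fix z :: "real \<times> real"
    obtain \<xi> \<eta> where z: "z = (\<xi>, \<eta>)" by (cases z)
    let ?a = "of_real (c * indicator (band n) (\<xi>, \<eta>)) * (amp H0 \<xi> * cis (r * \<xi>) * amp H1 \<eta>)"
    have "(LBINT x=ereal 0..ereal (2*pi). ?k x z) = (LBINT x=ereal 0..ereal (2*pi). ?a *
      (cis (- (real_of_int k * x)) * cis (x * \<eta>)))"
      unfolding z by (simp add: mult_ac)
    also have "\<dots> = ?a * (LBINT x=ereal 0..ereal (2*pi). cis (- (real_of_int k * x)) * cis (x * \<eta>))"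
      by simp
    finally have e: "(LBINT x=ereal 0..ereal (2*pi). ?k x z) = ?a * (LBINT x=ereal 0..ereal (2*pi).
      cis (- (real_of_int k * x)) * cis (x * \<eta>))" .
    show "noise_kernel c H0 H1 n k r z = of_real (1 / (2*pi)) * (LBINT x=ereal 0..ereal (2*pi). ?k x
      z)"
      unfolding e unfolding z noise_kernel_def window_def fourier_coeff_def zero_ereal_def
        by (simp add: mult_ac)
  qed
  show "noise_kernel c H0 H1 n k r \<in> square_integrable"
    unfolding eq by (rule square_integrable_cmult[OF *(1)])
  show "AE \<omega> in M. noise_coeff n \<omega> k r = W (noise_kernel c H0 H1 n k r) \<omega>"
    unfolding eq using *(2) W_cmult[OF *(1), of "of_real (1 / (2*pi))"]
    by eventually_elim (simp add: noise_coeff_def fourier_coeff_def zero_ereal_def)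
qed

text \<open>Once the time integral is inside the white noise, the phase of the flow and
  \<open>cis (r * \<xi>)\<close> combine to frequency \<xi> - k^2, and the integral over
  \<open>r\<close> is \<open>osc\<close>.\<close>

lemma psi_W:
  assumes n: "n \<ge> 1"
  shows "psi_kernel c H0 H1 chi n k t \<in> square_integrable" "AE \<omega> in M. Psi chi (B n \<omega>) t k
    = W (psi_kernel c H0 H1 chi n k t) \<omega>"
proof -
  let ?g = "amp_weight H0 H1 n"
  have iG: "integrable lborel (\<lambda>z. (c * ?g z)\<^sup>2)" using amp_weight_square_integrable[OF H(2) H(4),
    of n] by (simp add: power_mult_distrib)
  let ?e = "\<lambda>r. complex_of_real (chi r) * cis (- (r * (real_of_int k)\<^sup>2))"
  let ?k = "\<lambda>r z. ?e r * noise_kernel c H0 H1 n k r z"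
  have Z: "AE \<omega> in M. continuous_on UNIV (\<lambda>r. ?e r * noise_coeff n \<omega> k r)"
    using noise_coeff_continuous[OF n]
    by eventually_elim (intro continuous_intros continuous_on_of_real chi_continuous, blast)
  have ZW: "AE \<omega> in M. ?e r * noise_coeff n \<omega> k r = W (?k r) \<omega>" for r
    using noise_coeff_W(2)[OF n, of k r] W_cmult[OF noise_coeff_W(1)[OF n, of k r], of "?e r"]
    by eventually_elim simp
  have gm: "?k r \<in> borel_measurable borel" for r
    using square_integrable_cmult[OF noise_coeff_W(1)[OF n, of k r]]
      by (rule square_integrable_measurable)
  have gc: "continuous_on UNIV (\<lambda>r. ?k r z)" for z
    by (cases z) (auto simp: noise_kernel_def intro!: continuous_intros continuous_on_of_real
      chi_continuous)
  have le: "cmod (?k r z) \<le> c * ?g z" for r z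
  proof (cases z)
    case (Pair \<xi> \<eta>)
    have "cmod (?k r z) = \<bar>chi r\<bar> * ((c * ?g z) * cmod (window k \<eta>))"
      using c_pos unfolding Pair by (auto simp: norm_mult norm_amp amp_weight_def indicator_def
        noise_kernel_def)
    also have "\<dots> \<le> 1 * ((c * ?g z) * 1)"
      using c_pos chi_bounds[of r] norm_window_le_1 by (intro mult_mono) (auto simp: Pair
        amp_weight_def)
    finally show ?thesis by simp
  qed
  note * = W_interval_integral[OF Z ZW gm gc iG le, of 0 t]
  have eq: "psi_kernel c H0 H1 chi n k t = (\<lambda>z. (- \<i> * of_real (chi t)) * (LBINT r=ereal 0..ereal t.
    ?k r z))"
  proof
    fix z :: "real \<times> real"
    obtain \<xi> \<eta> where z: "z = (\<xi>, \<eta>)" by (cases z)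
    let ?a = "of_real (c * indicator (band n) (\<xi>, \<eta>)) * (amp H0 \<xi> * amp H1 \<eta>) * window k \<eta>"
    have "?k r z = ?a * (of_real (chi r) * cis (r * (\<xi> - (of_int k)\<^sup>2)))" for r
    proof -
      have "cis (- (r * (real_of_int k)\<^sup>2)) * cis (r * \<xi>) = cis (r * (\<xi> - (of_int k)\<^sup>2))"
        by (simp add: cis_mult algebra_simps)
      then show ?thesis unfolding z noise_kernel_def by (simp add: mult_ac)
    qed
    then have "(LBINT r=ereal 0..ereal t. ?k r z) = (LBINT r=ereal 0..ereal t. ?a *
      (of_real (chi r) * cis (r * (\<xi> - (of_int k)\<^sup>2))))"
      by (simp only:)
    then have e: "(LBINT r=ereal 0..ereal t. ?k r z) = ?a * (LBINT r=ereal 0..ereal t. of_real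
      (chi r) * cis (r * (\<xi> - (of_int k)\<^sup>2)))"
      by simp
    show "psi_kernel c H0 H1 chi n k t z = (- \<i> * of_real (chi t)) * (LBINT r=ereal 0..ereal t. ?k r
      z)"
      unfolding e unfolding z psi_kernel_def osc_def zero_ereal_def by (simp add: mult_ac)
  qed
  show "psi_kernel c H0 H1 chi n k t \<in> square_integrable"
    unfolding eq by (rule square_integrable_cmult[OF *(1)])
  show "AE \<omega> in M. Psi chi (B n \<omega>) t k = W (psi_kernel c H0 H1 chi n k t) \<omega>"
    unfolding eq using *(2) W_cmult[OF *(1), of "- \<i> * of_real (chi t)"]
    by eventually_elim (simp add: Psi_def noise_coeff_def[symmetric] zero_ereal_def)
qed

end

section \<open>Variance estimates\<close>

lemma interval_integral_norm_le:
  fixes f :: "real \<Rightarrow> complex"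
  assumes c: "continuous_on UNIV f" and le: "\<And>x. x \<in> {min a b..max a b} \<Longrightarrow> cmod (f x) \<le> C"
  shows "cmod (LBINT x=ereal a..ereal b. f x) \<le> C * \<bar>b - a\<bar>"
proof -
  have *: "cmod (LBINT x=ereal a..ereal b. f x) \<le> C * (b - a)" if "a \<le> b" "\<And>x. x \<in> {a..b}
    \<Longrightarrow> cmod (f x) \<le> C" for a b
  proof -
    have c': "continuous_on {a..b} f" using c continuous_on_subset by blast
    show ?thesis
      unfolding interval_integral_Icc[OF that(1)] integral_Icc_eq_HK(1)[OF c']
      by (rule integral_bound[OF that(1) c']) (use that in auto)
  qed
  show ?thesis
  proof (cases "a \<le> b")
    case True then show ?thesis using *[of a b] le by simp
  next
    case False
    then show ?thesis using *[of b a] le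
      unfolding interval_integral_endpoints_reverse[of "ereal a" "ereal b"] by simp
  qed
qed

text \<open>With u = \<eta> - k, integrating the exponential over a period gives |u| |window| \<le>
  1; adding the trivial bound |window| \<le> 1 yields the claim. Multiplying by \<open>u\<close>
  rather than dividing covers u = 0.\<close>

lemma window_le: "cmod (window k \<eta>) \<le> 2 * (1 + \<bar>\<eta> - of_int k\<bar>) powr (-1)"
proof -
  define u where "u = \<eta> - of_int k"
  have w: "window k \<eta> = (LBINT x=ereal 0..ereal (2*pi). cis (x * u)) / (2 * pi)"
    unfolding window_def fourier_coeff_def zero_ereal_def u_def
      by (simp add: cis_mult algebra_simps)
  have "(LBINT x=ereal 0..ereal (2*pi). \<i> * of_real u * cis (x * u)) = cis (2*pi * u) - cis (0 * u)"
    by (rule interval_integral_FTC_finite) (auto intro!: continuous_intros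
      cis_has_vector_derivative)
  then have "\<i> * of_real u * (LBINT x=ereal 0..ereal (2*pi). cis (x * u)) = cis (2*pi * u) - 1"
    by simp
  then have "\<i> * of_real u * (of_real (2 * pi) * window k \<eta>) = cis (2*pi * u) - 1" using w by simp
  then have "\<bar>u\<bar> * (2 * pi) * cmod (window k \<eta>) = cmod (cis (2*pi * u) - 1)"
    by (metis abs_of_nonneg mult.assoc norm_ii norm_mult norm_of_real mult_1 pi_ge_zero
      zero_le_mult_iff zero_le_numeral)
  also have "\<dots> \<le> 2" using norm_triangle_ineq4[of "cis (2*pi*u)" 1] by simp
  finally have "\<bar>u\<bar> * cmod (window k \<eta>) * (2 * pi) \<le> 2" by (simp add: mult_ac)
  moreover have "\<bar>u\<bar> * cmod (window k \<eta>) * 2 \<le> \<bar>u\<bar> * cmod (window k \<eta>) * (2 * pi)"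
    using pi_gt3 by (intro mult_left_mono) auto
  ultimately have "\<bar>u\<bar> * cmod (window k \<eta>) \<le> 1" by linarith
  then have "(1 + \<bar>u\<bar>) * cmod (window k \<eta>) \<le> 2" using norm_window_le_1[of k \<eta>]
    by (simp add: distrib_right)
  then show ?thesis by (simp add: u_def[symmetric] powr_minus field_simps powr_one add_pos_nonneg)
qed

section \<open>Integrals and sums with decaying weights\<close>

lemma nn_integral_shift:
  fixes f :: "real \<Rightarrow> ennreal"
  assumes "f \<in> borel_measurable borel"
  shows "(\<integral>\<^sup>+x. f (x - m) \<partial>lborel) = (\<integral>\<^sup>+x. f x \<partial>lborel)"
  using nn_integral_real_affine[OF assms, of 1 "-m"] by (simp add: algebra_simps)

lemma nn_integral_decay:
  assumes q: "1 < q"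
  shows "(\<integral>\<^sup>+x. ennreal ((1 + \<bar>x - m\<bar>) powr (-q)) \<partial>lborel) \<le> ennreal (2 / (q - 1))"
proof -
  have "(\<integral>\<^sup>+x. ennreal ((1 + \<bar>x - m\<bar>) powr (-q)) \<partial>lborel) = (\<integral>\<^sup>+x. ennreal ((1 + \<bar>x\<bar>) powr (-q))
    \<partial>lborel)"
    by (rule nn_integral_shift[of "\<lambda>x. ennreal ((1 + \<bar>x\<bar>) powr (-q))"]) simp
  also have "\<dots> \<le> 2 * (\<integral>\<^sup>+x. ennreal ((1 + \<bar>x\<bar>) powr (-q)) * indicator {0..} x \<partial>lborel)"
    by (rule nn_integral_even_le) auto
  also have "(\<integral>\<^sup>+x. ennreal ((1 + \<bar>x\<bar>) powr (-q)) * indicator {0..} x \<partial>lborel)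
    = (\<integral>\<^sup>+x. ennreal ((x - (-1)) powr (-q)) * indicator {1..} (x - (-1)) \<partial>lborel)"
    by (intro nn_integral_cong) (auto simp: indicator_def add.commute)
  also have "\<dots> = (\<integral>\<^sup>+x. ennreal (x powr (-q)) * indicator {1..} x \<partial>lborel)"
    by (rule nn_integral_shift[of "\<lambda>x. ennreal (x powr (-q)) * indicator {1..} x"]) simp
  also have "\<dots> = ennreal (- (1 powr (-q + 1)) / (-q + 1))"
    by (rule nn_integral_has_integral_lebesgue'[OF _ has_integral_powr_to_inf]) (use q in auto)
  also have "- (1 powr (-q + 1)) / (-q + 1) = 1 / (q - 1)" using q by (simp add: field_simps)
  also have "2 * ennreal (1 / (q - 1)) = ennreal (2 / (q - 1))"
    using q by (subst ennreal_numeral[symmetric], subst ennreal_mult[symmetric]) auto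
  finally show ?thesis .
qed

text \<open>A bump centred at \<open>m\<close> sees the power weight as it is near \<open>m\<close>.
  For \<beta> \<ge> 0 the inequality |x| \<le> (1 + |m|)(1 + |x - m|) transfers the weight to
  \<open>m\<close> and uses up \<beta> powers of decay, whence q > \<beta> + 1. For \<beta> < 0 the
  singularity at the origin is cut out.\<close>

lemma nn_integral_powr_decay:
  assumes \<beta>: "-1 < \<beta>" and q: "1 < q" "\<beta> + 1 < q"
  shows "\<exists>C\<ge>0. \<forall>m. (\<integral>\<^sup>+x. ennreal (\<bar>x\<bar> powr \<beta> * (1 + \<bar>x - m\<bar>) powr (-q)) \<partial>lborel)
    \<le> ennreal (C * (1 + \<bar>m\<bar>) powr \<beta>)"
proof (cases "0 \<le> \<beta>")
  case True
  have "(\<integral>\<^sup>+x. ennreal (\<bar>x\<bar> powr \<beta> * (1 + \<bar>x - m\<bar>) powr (-q)) \<partial>lborel)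
    \<le> ennreal (2 / (q - \<beta> - 1) * (1 + \<bar>m\<bar>) powr \<beta>)" for m
  proof -
    have "\<bar>x\<bar> powr \<beta> * (1 + \<bar>x - m\<bar>) powr (-q) \<le> (1 + \<bar>m\<bar>) powr \<beta> * (1 + \<bar>x - m\<bar>) powr (-(q - \<beta>))"
      for x
    proof -
      have "\<bar>x\<bar> \<le> (1 + \<bar>m\<bar>) * (1 + \<bar>x - m\<bar>)"
      proof -
        have "\<bar>x\<bar> \<le> \<bar>m\<bar> + \<bar>x - m\<bar>" by linarith
        also have "\<dots> \<le> (1 + \<bar>m\<bar>) * (1 + \<bar>x - m\<bar>)" by (simp add: algebra_simps)
        finally show ?thesis .
      qed
      then have "\<bar>x\<bar> powr \<beta> \<le> ((1 + \<bar>m\<bar>) * (1 + \<bar>x - m\<bar>)) powr \<beta>" using True by (intro powr_mono2)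
        auto
      also have "\<dots> = (1 + \<bar>m\<bar>) powr \<beta> * (1 + \<bar>x - m\<bar>) powr \<beta>" by (simp add: powr_mult)
      finally have "\<bar>x\<bar> powr \<beta> * (1 + \<bar>x - m\<bar>) powr (-q) \<le> ((1 + \<bar>m\<bar>) powr \<beta> * (1 + \<bar>x - m\<bar>) powr \<beta>)
        * (1 + \<bar>x - m\<bar>) powr (-q)"
        by (intro mult_right_mono) auto
      then show ?thesis by (simp add: mult.assoc powr_add[symmetric])
    qed
    then have "(\<integral>\<^sup>+x. ennreal (\<bar>x\<bar> powr \<beta> * (1 + \<bar>x - m\<bar>) powr (-q)) \<partial>lborel)
      \<le> (\<integral>\<^sup>+x. ennreal ((1 + \<bar>m\<bar>) powr \<beta>) * ennreal ((1 + \<bar>x - m\<bar>) powr (-(q - \<beta>))) \<partial>lborel)"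
      by (intro nn_integral_mono) (simp add: ennreal_mult[symmetric])
    also have "\<dots> = ennreal ((1 + \<bar>m\<bar>) powr \<beta>) * (\<integral>\<^sup>+x. ennreal ((1 + \<bar>x - m\<bar>) powr (-(q - \<beta>)))
      \<partial>lborel)"
      by (rule nn_integral_cmult) simp
    also have "\<dots> \<le> ennreal ((1 + \<bar>m\<bar>) powr \<beta>) * ennreal (2 / (q - \<beta> - 1))"
      by (intro mult_left_mono nn_integral_decay) (use q in auto)
    also have "\<dots> = ennreal (2 / (q - \<beta> - 1) * (1 + \<bar>m\<bar>) powr \<beta>)"
      using q by (subst ennreal_mult[symmetric]) (auto simp: mult.commute)
    finally show ?thesis .
  qed
  then show ?thesis using q by (intro exI[of _ "2 / (q - \<beta> - 1)"]) auto
next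
  case False
  define C1 where "C1 = 2 / (\<beta> + 1) * (1/2) powr (\<beta> + 1 - q)"
  define C2 where "C2 = (1/2) powr \<beta> * (2 / (q - 1))"
  have C0: "0 \<le> C1" "0 \<le> C2" using \<beta> q by (auto simp: C1_def C2_def)
  have "(\<integral>\<^sup>+x. ennreal (\<bar>x\<bar> powr \<beta> * (1 + \<bar>x - m\<bar>) powr (-q)) \<partial>lborel)
    \<le> ennreal ((C1 + C2) * (1 + \<bar>m\<bar>) powr \<beta>)" for m
  proof -
    \<comment> \<open>Since 2 R = 1 + |m|, a point with |x| \<le> R satisfies 1 + |x - m| \<ge> R,
      so the bump is at most R^(-q) there; beyond R the negative power of |x| is at most
      R^\<beta>.\<close>
    define R where "R = (1 + \<bar>m\<bar>) / 2"
    have R: "R > 0" "1/2 \<le> R" by (auto simp: R_def)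
    have "ennreal (\<bar>x\<bar> powr \<beta> * (1 + \<bar>x - m\<bar>) powr (-q)) \<le>
        ennreal (R powr (-q)) * (ennreal (\<bar>x\<bar> powr \<beta>) * indicator {-R..R} x) + ennreal (R powr \<beta>) *
          ennreal ((1 + \<bar>x - m\<bar>) powr (-q))" for x
    proof (cases "\<bar>x\<bar> \<le> R")
      case True
      moreover have "2 * R = 1 + \<bar>m\<bar>" by (simp add: R_def)
      ultimately have "R \<le> 1 + \<bar>x - m\<bar>" by linarith
      then have "(1 + \<bar>x - m\<bar>) powr (-q) \<le> R powr (-q)" using R q by (intro powr_mono2') auto
      from mult_left_mono[OF this, of "\<bar>x\<bar> powr \<beta>"]
      have "\<bar>x\<bar> powr \<beta> * (1 + \<bar>x - m\<bar>) powr (-q) \<le> R powr (-q) * \<bar>x\<bar> powr \<beta>"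
        by (simp add: mult.commute)
      then have "ennreal (\<bar>x\<bar> powr \<beta> * (1 + \<bar>x - m\<bar>) powr (-q)) \<le> ennreal (R powr (-q)) *
        (ennreal (\<bar>x\<bar> powr \<beta>) * indicator {-R..R} x)"
        using True by (auto simp: indicator_def abs_le_iff ennreal_mult[symmetric] intro!:
          ennreal_leI)
      then show ?thesis by (rule order_trans) simp
    next
      case False
      then have "\<bar>x\<bar> powr \<beta> \<le> R powr \<beta>" using R \<open>\<not> 0 \<le> \<beta>\<close> by (intro powr_mono2') auto
      then have "\<bar>x\<bar> powr \<beta> * (1 + \<bar>x - m\<bar>) powr (-q) \<le> R powr \<beta> * (1 + \<bar>x - m\<bar>) powr (-q)"
        by (intro mult_right_mono) auto
      then have "ennreal (\<bar>x\<bar> powr \<beta> * (1 + \<bar>x - m\<bar>) powr (-q)) \<le> ennreal (R powr \<beta>) * ennreal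
        ((1 + \<bar>x - m\<bar>) powr (-q))"
        by (subst ennreal_mult[symmetric]) (auto intro!: ennreal_leI)
      then show ?thesis by (rule order_trans) simp
    qed
    then have "(\<integral>\<^sup>+x. ennreal (\<bar>x\<bar> powr \<beta> * (1 + \<bar>x - m\<bar>) powr (-q)) \<partial>lborel) \<le>
       (\<integral>\<^sup>+x. ennreal (R powr (-q)) * (ennreal (\<bar>x\<bar> powr \<beta>) * indicator {-R..R} x)
         + ennreal (R powr \<beta>) * ennreal ((1 + \<bar>x - m\<bar>) powr (-q)) \<partial>lborel)"
      by (intro nn_integral_mono)
    also have "\<dots> = ennreal (R powr (-q)) * (\<integral>\<^sup>+x. ennreal (\<bar>x\<bar> powr \<beta>) * indicator {-R..R} x
      \<partial>lborel) + ennreal (R powr \<beta>) * (\<integral>\<^sup>+x. ennreal ((1 + \<bar>x - m\<bar>) powr (-q)) \<partial>lborel)"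
      by (simp add: nn_integral_add nn_integral_cmult)
    also have "\<dots> \<le> ennreal (R powr (-q)) * ennreal (2 * R powr (\<beta> + 1) / (\<beta> + 1))
      + ennreal (R powr \<beta>) * ennreal (2 / (q - 1))"
      by (intro add_mono mult_left_mono nn_integral_decay nn_integral_powr_near_0)
        (use \<beta> q R in auto)
    also have "\<dots> = ennreal (R powr (-q) * (2 * R powr (\<beta> + 1) / (\<beta> + 1))
      + R powr \<beta> * (2 / (q - 1)))"
      using \<beta> q by (simp add: ennreal_mult[symmetric] ennreal_plus[symmetric] del: ennreal_plus)
    also have "\<dots> \<le> ennreal ((C1 + C2) * (1 + \<bar>m\<bar>) powr \<beta>)"
    proof (rule ennreal_leI)
      have "R powr (-q) * (2 * R powr (\<beta> + 1) / (\<beta> + 1)) = 2 / (\<beta> + 1) * R powr (\<beta> + 1 - q)"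
        by (simp add: powr_add[symmetric] mult_ac)
      also have "R powr (\<beta> + 1 - q) = (1/2) powr (\<beta> + 1 - q) * (1 + \<bar>m\<bar>) powr (\<beta> + 1 - q)"
        unfolding R_def by (simp add: powr_mult[symmetric])
      also have "(1 + \<bar>m\<bar>) powr (\<beta> + 1 - q) \<le> (1 + \<bar>m\<bar>) powr \<beta>" using q by (intro powr_mono) auto
      finally have 1: "R powr (-q) * (2 * R powr (\<beta> + 1) / (\<beta> + 1)) \<le> C1 * (1 + \<bar>m\<bar>) powr \<beta>"
        using \<beta> unfolding C1_def by (simp add: mult_left_mono divide_right_mono mult.assoc)
      have 2: "R powr \<beta> * (2 / (q - 1)) = C2 * (1 + \<bar>m\<bar>) powr \<beta>"
      proof -
        have "R powr \<beta> = (1/2) powr \<beta> * (1 + \<bar>m\<bar>) powr \<beta>" unfolding R_def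
          by (simp add: powr_mult[symmetric])
        then show ?thesis by (simp add: C2_def)
      qed
      show "R powr (-q) * (2 * R powr (\<beta> + 1) / (\<beta> + 1)) + R powr \<beta> * (2 / (q - 1)) \<le> (C1 + C2) * (1
        + \<bar>m\<bar>) powr \<beta>"
        using 1 2 by (simp add: distrib_right)
    qed
    finally show ?thesis .
  qed
  then show ?thesis using C0 by (intro exI[of _ "C1 + C2"]) auto
qed

text \<open>Peetre's inequality 1 + |x| \<le> (1 + |m|)(1 + |x - m|) moves the extra weight to
  \<open>m\<close> at the price of \<kappa> powers of decay.\<close>

lemma nn_integral_weight_decay:
  assumes \<beta>: "-1 < \<beta>" and \<kappa>: "0 \<le> \<kappa>" and q: "1 < q - \<kappa>" "\<beta> + 1 < q - \<kappa>"
  shows "\<exists>C\<ge>0. \<forall>m. (\<integral>\<^sup>+x. ennreal (\<bar>x\<bar> powr \<beta> * (1 + \<bar>x\<bar>) powr \<kappa> * (1 + \<bar>x - m\<bar>) powr (-q)) \<partial>lborel)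
    \<le> ennreal (C * (1 + \<bar>m\<bar>) powr (\<beta> + \<kappa>))"
proof -
  obtain C where C: "C \<ge> 0" "\<And>m. (\<integral>\<^sup>+x. ennreal (\<bar>x\<bar> powr \<beta> * (1 + \<bar>x - m\<bar>) powr (-(q - \<kappa>)))
    \<partial>lborel) \<le> ennreal (C * (1 + \<bar>m\<bar>) powr \<beta>)"
    using nn_integral_powr_decay[OF \<beta> q] by blast
  have "(\<integral>\<^sup>+x. ennreal (\<bar>x\<bar> powr \<beta> * (1 + \<bar>x\<bar>) powr \<kappa> * (1 + \<bar>x - m\<bar>) powr (-q)) \<partial>lborel)
    \<le> ennreal (C * (1 + \<bar>m\<bar>) powr (\<beta> + \<kappa>))" for m
  proof -
    have "\<bar>x\<bar> powr \<beta> * (1 + \<bar>x\<bar>) powr \<kappa> * (1 + \<bar>x - m\<bar>) powr (-q) \<le> (1 + \<bar>m\<bar>) powr \<kappa> * (\<bar>x\<bar> powr \<beta> *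
      (1 + \<bar>x - m\<bar>) powr (-(q - \<kappa>)))" for x
    proof -
      have "1 + \<bar>x\<bar> \<le> (1 + \<bar>m\<bar>) * (1 + \<bar>x - m\<bar>)"
      proof -
        have "1 + \<bar>x\<bar> \<le> 1 + \<bar>m\<bar> + \<bar>x - m\<bar>" by linarith
        also have "\<dots> \<le> (1 + \<bar>m\<bar>) * (1 + \<bar>x - m\<bar>)" by (simp add: algebra_simps)
        finally show ?thesis .
      qed
      then have "(1 + \<bar>x\<bar>) powr \<kappa> \<le> ((1 + \<bar>m\<bar>) * (1 + \<bar>x - m\<bar>)) powr \<kappa>" using \<kappa>
        by (intro powr_mono2) auto
      also have "\<dots> = (1 + \<bar>m\<bar>) powr \<kappa> * (1 + \<bar>x - m\<bar>) powr \<kappa>" by (simp add: powr_mult)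
      finally have "\<bar>x\<bar> powr \<beta> * (1 + \<bar>x\<bar>) powr \<kappa> * (1 + \<bar>x - m\<bar>) powr (-q)
        \<le> \<bar>x\<bar> powr \<beta> * ((1 + \<bar>m\<bar>) powr \<kappa> * (1 + \<bar>x - m\<bar>) powr \<kappa>) * (1 + \<bar>x - m\<bar>) powr (-q)"
        by (intro mult_right_mono mult_left_mono) auto
      also have "\<dots> = (1 + \<bar>m\<bar>) powr \<kappa> * (\<bar>x\<bar> powr \<beta> * ((1 + \<bar>x - m\<bar>) powr \<kappa> * (1 + \<bar>x - m\<bar>) powr
        (-q)))" by (simp add: mult_ac)
      finally show ?thesis by (simp add: powr_add[symmetric])
    qed
    then have "(\<integral>\<^sup>+x. ennreal (\<bar>x\<bar> powr \<beta> * (1 + \<bar>x\<bar>) powr \<kappa> * (1 + \<bar>x - m\<bar>) powr (-q)) \<partial>lborel) \<le>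
      (\<integral>\<^sup>+x. ennreal ((1 + \<bar>m\<bar>) powr \<kappa>) * ennreal (\<bar>x\<bar> powr \<beta> * (1 + \<bar>x - m\<bar>) powr (-(q - \<kappa>)))
        \<partial>lborel)"
      by (intro nn_integral_mono) (simp add: ennreal_mult[symmetric])
    also have "\<dots> = ennreal ((1 + \<bar>m\<bar>) powr \<kappa>) * (\<integral>\<^sup>+x. ennreal (\<bar>x\<bar> powr \<beta> * (1 + \<bar>x - m\<bar>) powr
      (-(q - \<kappa>))) \<partial>lborel)"
      by (rule nn_integral_cmult) simp
    also have "\<dots> \<le> ennreal ((1 + \<bar>m\<bar>) powr \<kappa>) * ennreal (C * (1 + \<bar>m\<bar>) powr \<beta>)"
      by (intro mult_left_mono C) simp
    also have "\<dots> = ennreal (C * (1 + \<bar>m\<bar>) powr (\<beta> + \<kappa>))" using C(1)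
      by (simp add: ennreal_mult[symmetric] powr_add mult_ac)
    finally show ?thesis .
  qed
  then show ?thesis using C(1) by blast
qed

lemma sum_int_decay:
  fixes \<theta> :: real
  assumes \<theta>: "1/2 < \<theta>"
  shows "\<exists>C\<ge>0. \<forall>L::int set. finite L \<longrightarrow> (\<Sum>l\<in>L. (1 + (real_of_int l)\<^sup>2) powr (-\<theta>)) \<le> C"
proof -
  define f :: "nat \<Rightarrow> real" where "f n = (1 + (real n)\<^sup>2) powr (-\<theta>)" for n
  have f0: "0 \<le> f n" for n by (simp add: f_def)
  have "summable (\<lambda>n. real n powr (- 2 * \<theta>))" using \<theta> by (subst summable_real_powr_iff) auto
  then have sf: "summable f"
  proof (rule summable_comparison_test[rotated], intro exI allI impI)
    fix n :: nat assume n: "n \<ge> 1"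
    have "f n \<le> ((real n)\<^sup>2) powr (-\<theta>)" unfolding f_def using n \<theta> by (intro powr_mono2') auto
    also have "\<dots> = real n powr (- 2 * \<theta>)" using n by (simp add: powr_powr powr_realpow[symmetric]
      powr_numeral[symmetric] del: powr_numeral)
    finally show "norm (f n) \<le> real n powr (- 2 * \<theta>)" using f0 by simp
  qed
  have "(\<Sum>l\<in>L. (1 + (real_of_int l)\<^sup>2) powr (-\<theta>)) \<le> 2 * suminf f" if L: "finite L" for L ::
    "int set"
  proof -
    have "(\<Sum>l\<in>L. (1 + (real_of_int l)\<^sup>2) powr (-\<theta>)) = (\<Sum>l\<in>L. f (nat \<bar>l\<bar>))"
      by (intro sum.cong) (auto simp: f_def)
    also have "\<dots> = (\<Sum>l\<in>L \<inter> {0..}. f (nat \<bar>l\<bar>)) + (\<Sum>l\<in>L \<inter> {..<0}. f (nat \<bar>l\<bar>))"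
    proof -
      have "L = (L \<inter> {0..}) \<union> (L \<inter> {..<0})" by auto
      then show ?thesis using L by (metis (no_types, lifting) disjoint_iff IntE atLeast_iff
        finite_Int lessThan_iff linorder_not_less sum.union_disjoint)
    qed
    also have "(\<Sum>l\<in>L \<inter> {0..}. f (nat \<bar>l\<bar>)) = (\<Sum>n\<in>(\<lambda>l. nat \<bar>l\<bar>) ` (L \<inter> {0..}). f n)"
      by (rule sum.reindex[symmetric, unfolded o_def]) (auto simp: inj_on_def)
    also have "\<dots> \<le> suminf f" using L by (intro sum_le_suminf sf f0) auto
    also have "(\<Sum>l\<in>L \<inter> {..<0}. f (nat \<bar>l\<bar>)) = (\<Sum>n\<in>(\<lambda>l. nat \<bar>l\<bar>) ` (L \<inter> {..<0}). f n)"
      by (rule sum.reindex[symmetric, unfolded o_def]) (auto simp: inj_on_def)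
    also have "\<dots> \<le> suminf f" using L by (intro sum_le_suminf sf f0) auto
    finally show ?thesis by simp
  qed
  then show ?thesis using suminf_nonneg[OF sf f0] by (intro exI[of _ "2 * suminf f"]) auto
qed

text \<open>With s the square root of the positive part of \<xi>, one has |\<xi> - k^2| \<ge> (|k| -
  s)^2. The sum is thus compared with that of (1 + l^2)^(-\<theta>), once for each sign of
  \<open>k\<close>, which is finite exactly because \<theta> > 1/2.\<close>

lemma sum_resonance:
  fixes \<theta> :: real
  assumes \<theta>: "1/2 < \<theta>"
  shows "\<exists>C\<ge>0. \<forall>(K::int set) \<xi>. finite K \<longrightarrow> (\<Sum>k\<in>K. (1 + \<bar>\<xi> - (of_int k)\<^sup>2\<bar>) powr (-\<theta>)) \<le> C"
proof -
  obtain C where C: "C \<ge> 0" "\<And>L::int set. finite L \<Longrightarrow> (\<Sum>l\<in>L. (1 + (real_of_int l)\<^sup>2) powr (-\<theta>)) \<le> C"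
    using sum_int_decay[OF \<theta>] by blast
  let ?f = "\<lambda>l::int. (1 + (real_of_int l)\<^sup>2) powr (-\<theta>)"
  have "(\<Sum>k\<in>K. (1 + \<bar>\<xi> - (of_int k)\<^sup>2\<bar>) powr (-\<theta>)) \<le> 3 powr \<theta> * (C + C)" if K: "finite K" for K ::
    "int set" and \<xi> :: real
  proof -
    define s where "s = sqrt (max \<xi> 0)"
    define m where "m = \<lfloor>s\<rfloor>"
    have s0: "0 \<le> s" by (simp add: s_def)
    have main: "(1 + \<bar>\<xi> - (of_int k)\<^sup>2\<bar>) powr (-\<theta>) \<le> 3 powr \<theta> * (?f (k - m) + ?f (- k - m))" for k
    proof -
      have 1: "(\<bar>of_int k\<bar> - s)\<^sup>2 \<le> \<bar>\<xi> - (of_int k)\<^sup>2\<bar>"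
      proof (cases "0 \<le> \<xi>")
        case True
        then have "\<xi> = s\<^sup>2" by (simp add: s_def)
        then have "\<xi> - (of_int k)\<^sup>2 = (s - \<bar>of_int k\<bar>) * (s + \<bar>of_int k\<bar>)"
          by (simp add: power2_eq_square algebra_simps)
        then have e: "\<bar>\<xi> - (of_int k)\<^sup>2\<bar> = \<bar>s - \<bar>of_int k\<bar>\<bar> * (s + \<bar>of_int k\<bar>)" using s0
          by (simp add: abs_mult)
        have "(\<bar>of_int k\<bar> - s)\<^sup>2 = \<bar>s - \<bar>of_int k\<bar>\<bar> * \<bar>s - \<bar>of_int k\<bar>\<bar>"
          by (simp add: power2_eq_square algebra_simps)
        also have "\<dots> \<le> \<bar>s - \<bar>of_int k\<bar>\<bar> * (s + \<bar>of_int k\<bar>)" using s0 by (intro mult_left_mono) auto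
        finally show ?thesis using e by simp
      next
        case False then show ?thesis by (simp add: s_def)
      qed
      have ms: "real_of_int m \<le> s" "s < real_of_int m + 1" unfolding m_def by linarith+
      \<comment> \<open>Replacing s by its integer part m allows reindexing by integers; the error
        of at most 1 in the root is absorbed by the factor 3.\<close>
      have 2: "1 + (\<bar>of_int k\<bar> - real_of_int m)\<^sup>2 \<le> 3 * (1 + \<bar>\<xi> - (of_int k)\<^sup>2\<bar>)"
      proof -
        have "(\<bar>of_int k\<bar> - real_of_int m)\<^sup>2 \<le> (\<bar>\<bar>of_int k\<bar> - s\<bar> + 1)\<^sup>2"
          using ms by (subst abs_le_square_iff[symmetric]) linarith
        also have "\<dots> \<le> 2 * (\<bar>of_int k\<bar> - s)\<^sup>2 + 2"
          using sum_squares_ge_zero[of "\<bar>\<bar>of_int k\<bar> - s\<bar> - 1" 0]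
            by (simp add: power2_eq_square algebra_simps)
        finally have "(\<bar>of_int k\<bar> - real_of_int m)\<^sup>2 \<le> 2 * (\<bar>of_int k\<bar> - s)\<^sup>2 + 2" .
        moreover have "1 + x \<le> 3 * (1 + A)" if "x \<le> 2 * y + 2" "y \<le> A" "0 \<le> A" for x y A :: real
          using that by simp
        ultimately show ?thesis using 1 abs_ge_zero by blast
      qed
      have "(3 * (1 + \<bar>\<xi> - (of_int k)\<^sup>2\<bar>)) powr (-\<theta>) \<le> (1 + (\<bar>of_int k\<bar> - real_of_int m)\<^sup>2) powr
        (-\<theta>)"
        using 2 \<theta> by (intro powr_mono2') (auto intro: add_pos_nonneg)
      then have "3 powr \<theta> * (3 * (1 + \<bar>\<xi> - (of_int k)\<^sup>2\<bar>)) powr (-\<theta>) \<le> 3 powr \<theta> * (1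
        + (\<bar>of_int k\<bar> - real_of_int m)\<^sup>2) powr (-\<theta>)"
        by (intro mult_left_mono) auto
      moreover have "3 powr \<theta> * (3 * (1 + \<bar>\<xi> - (of_int k)\<^sup>2\<bar>)) powr (-\<theta>) = (1 + \<bar>\<xi> - (of_int k)\<^sup>2\<bar>)
        powr (-\<theta>)"
        using powr_mult[of 3 "1 + \<bar>\<xi> - (of_int k)\<^sup>2\<bar>" "-\<theta>"]
        by (simp only: mult.assoc[symmetric] powr_add[symmetric]) simp
      moreover have "(1 + (\<bar>of_int k\<bar> - real_of_int m)\<^sup>2) powr (-\<theta>) \<le> ?f (k - m) + ?f (- k - m)"
        by (cases "0 \<le> k") auto
      then have "3 powr \<theta> * (1 + (\<bar>of_int k\<bar> - real_of_int m)\<^sup>2) powr (-\<theta>) \<le> 3 powr \<theta> * (?f (k - m)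
        + ?f (- k - m))"
        by (rule mult_left_mono) simp
      ultimately show ?thesis by linarith
    qed
    have "(\<Sum>k\<in>K. (1 + \<bar>\<xi> - (of_int k)\<^sup>2\<bar>) powr (-\<theta>)) \<le> (\<Sum>k\<in>K. 3 powr \<theta> * (?f (k - m)
      + ?f (- k - m)))"
      by (intro sum_mono main)
    also have "\<dots> = 3 powr \<theta> * ((\<Sum>k\<in>K. ?f (k - m)) + (\<Sum>k\<in>K. ?f (- k - m)))"
      by (simp only: sum_distrib_left[symmetric] sum.distrib)
    also have "(\<Sum>k\<in>K. ?f (k - m)) = (\<Sum>l\<in>(\<lambda>k. k - m) ` K. ?f l)"
      by (subst sum.reindex) (auto simp: inj_on_def)
    also have "(\<Sum>k\<in>K. ?f (- k - m)) = (\<Sum>l\<in>(\<lambda>k. - k - m) ` K. ?f l)"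
      by (subst sum.reindex) (auto simp: inj_on_def)
    also have "3 powr \<theta> * ((\<Sum>l\<in>(\<lambda>k. k - m) ` K. ?f l) + (\<Sum>l\<in>(\<lambda>k. - k - m) ` K. ?f l))
      \<le> 3 powr \<theta> * (C + C)"
      using K by (intro mult_left_mono add_mono C) auto
    finally show ?thesis .
  qed
  then show ?thesis using C(1) by (intro exI[of _ "3 powr \<theta> * (C + C)"]) auto
qed

section \<open>Variance of the increments between levels\<close>

context sheet
begin

lemma chi_C1:
  obtains D L where "\<And>t. (chi has_vector_derivative D t) (at t)" "continuous_on UNIV D" "0 \<le> L"
    "\<And>t. \<bar>t\<bar> \<le> 2 \<Longrightarrow> \<bar>D t\<bar> \<le> L"
proof -
  have d: "(deriv ^^ j) chi differentiable (at t)" for j t using chi unfolding cutoff_def by blast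
  have "chi differentiable (at t)" for t using d[of 0 t] by simp
  then have 1: "(chi has_vector_derivative deriv chi t) (at t)" for t
    by (metis DERIV_deriv_iff_real_differentiable has_real_derivative_iff_has_vector_derivative)
  have "deriv chi differentiable (at t)" for t using d[of 1 t] by simp
  then have 2: "continuous_on UNIV (deriv chi)"
    by (meson continuous_at_imp_continuous_on differentiable_imp_continuous_within)
  have "compact (deriv chi ` {-2..2})" by (intro compact_continuous_image continuous_on_subset[OF
    2]) auto
  then have "bounded (deriv chi ` {-2..2})" by (rule compact_imp_bounded)
  then obtain L where L: "\<And>t. t \<in> {-2..2} \<Longrightarrow> \<bar>deriv chi t\<bar> \<le> L"
    unfolding bounded_iff by (auto simp del: atLeastAtMost_iff)
  have "0 \<le> L" using L[of 0] by simp
  show ?thesis by (rule that[OF 1 2 \<open>0 \<le> L\<close>]) (rule L, auto)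
qed

lemma chi_lipschitz: "\<exists>L. L-lipschitz_on {-2..2} chi"
proof -
  obtain D L where D: "\<And>t. (chi has_vector_derivative D t) (at t)" "0 \<le> L" "\<And>t. \<bar>t\<bar> \<le> 2 \<Longrightarrow> \<bar>D t\<bar> \<le> L"
    by (rule chi_C1) blast
  have "norm (chi t - chi s) \<le> L * norm (t - s)" if "\<bar>s\<bar> \<le> 2" "\<bar>t\<bar> \<le> 2" for s t
  proof (rule differentiable_bound[of "{-2..2}" chi "\<lambda>t x. x *\<^sub>R D t"])
    show "(chi has_derivative (\<lambda>xa. xa *\<^sub>R D x)) (at x within {- 2..2})" for x
      using D(1)[of x] unfolding has_vector_derivative_def by (rule has_derivative_at_withinI)
    show "onorm (\<lambda>xa. xa *\<^sub>R D x) \<le> L" if "x \<in> {-2..2}" for x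
    proof (rule onorm_le)
      fix y
      have "\<bar>D x\<bar> * \<bar>y\<bar> \<le> L * \<bar>y\<bar>" using D(3)[of x] that by (intro mult_right_mono) auto
      then show "norm (y *\<^sub>R D x) \<le> L * norm y" by (simp add: abs_mult mult.commute)
    qed
  qed (use that in auto)
  then have "L-lipschitz_on {-2..2} chi"
    using D(2) by (intro lipschitz_onI) (auto simp: dist_norm)
  then show ?thesis ..
qed

text \<open>Integration by parts gives |\<zeta>| |osc| \<le> 2 + 2 L, with two boundary terms and
  the integral of the derivative of the cutoff; together with |osc| \<le> 2 this makes 4 + 2 L. The
  outer cutoff confines \<open>t\<close> to [-2, 2], so the bound is uniform in time.\<close>

lemma osc_bound: "\<exists>C\<ge>0. \<forall>t \<zeta>. cmod (of_real (chi t) * osc chi t \<zeta>) \<le> C * (1 + \<bar>\<zeta>\<bar>) powr (-1)"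
proof -
  obtain D L where D: "\<And>t. (chi has_vector_derivative D t) (at t)" "continuous_on UNIV D" "0 \<le> L"
    "\<And>t. \<bar>t\<bar> \<le> 2 \<Longrightarrow> \<bar>D t\<bar> \<le> L"
    by (rule chi_C1) blast
  have "cmod (of_real (chi t) * osc chi t \<zeta>) \<le> (4 + 2 * L) * (1 + \<bar>\<zeta>\<bar>) powr (-1)" for t \<zeta>
  proof (cases "\<bar>t\<bar> \<le> 2")
    case False then show ?thesis using chi_bounds(3)[of t] D(3) by simp
  next
    case t: True
    have cc: "continuous_on UNIV (\<lambda>r. complex_of_real (chi r) * cis (r * \<zeta>))"
      by (intro continuous_intros continuous_on_of_real chi_continuous)
    have cD: "continuous_on UNIV (\<lambda>r. complex_of_real (D r) * cis (r * \<zeta>))"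
      by (intro continuous_intros continuous_on_of_real D)
    have o1: "cmod (osc chi t \<zeta>) \<le> 2"
    proof -
      have "cmod (LBINT r=ereal 0..ereal t. of_real (chi r) * cis (r * \<zeta>)) \<le> 1 * \<bar>t - 0\<bar>"
        by (rule interval_integral_norm_le[OF cc]) (use chi_bounds in \<open>auto simp: norm_mult\<close>)
      then show ?thesis using t by (simp add: osc_def zero_ereal_def)
    qed
    have Dr: "(chi has_real_derivative D r) (at r within S)" for r S
      using D(1)[of r] by (simp add: has_real_derivative_iff_has_vector_derivative[symmetric]
        has_field_derivative_at_within)
    have d: "((\<lambda>r. complex_of_real (chi r) * cis (r * \<zeta>)) has_vector_derivative
       (complex_of_real (chi r) * (\<i> * of_real \<zeta> * cis (r * \<zeta>)) + complex_of_real (D r) * cis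
         (r * \<zeta>))) (at r within S)" for r S
      by (intro has_vector_derivative_mult has_vector_derivative_of_real cis_has_vector_derivative
        Dr)
    have "(LBINT r=ereal 0..ereal t. complex_of_real (chi r) * (\<i> * of_real \<zeta> * cis (r * \<zeta>))
      + complex_of_real (D r) * cis (r * \<zeta>)) = of_real (chi t) * cis (t * \<zeta>) - of_real (chi 0) * cis
      (0 * \<zeta>)"
      by (rule interval_integral_FTC_finite[OF _ d])
         (intro continuous_intros continuous_on_of_real chi_continuous continuous_on_subset[OF
           D(2)], auto)
    note e1 = this
    have e2: "(LBINT r=ereal 0..ereal t. complex_of_real (chi r) * (\<i> * of_real \<zeta> * cis (r * \<zeta>))
      + complex_of_real (D r) * cis (r * \<zeta>))
       = (LBINT r=ereal 0..ereal t. complex_of_real (chi r) * (\<i> * of_real \<zeta> * cis (r * \<zeta>)))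
         + (LBINT r=ereal 0..ereal t. complex_of_real (D r) * cis (r * \<zeta>))"
    proof (rule interval_lebesgue_integral_add(2))
      show "interval_lebesgue_integrable lborel (ereal 0) (ereal t) (\<lambda>r. complex_of_real (chi r) *
        (\<i> * of_real \<zeta> * cis (r * \<zeta>)))"
        by (intro interval_integrable_isCont continuous_on_interior[where S=UNIV] continuous_intros
          continuous_on_of_real chi_continuous) auto
      show "interval_lebesgue_integrable lborel (ereal 0) (ereal t) (\<lambda>r. complex_of_real (D r) * cis
        (r * \<zeta>))"
        by (intro interval_integrable_isCont continuous_on_interior[OF cD]) auto
    qed
    have e3: "(LBINT r=ereal 0..ereal t. complex_of_real (chi r) * (\<i> * of_real \<zeta> * cis (r * \<zeta>)))
      = \<i> * of_real \<zeta> * osc chi t \<zeta>"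
      unfolding osc_def zero_ereal_def interval_lebesgue_integral_mult_right[symmetric]
        by (simp add: mult_ac)
    have "\<i> * of_real \<zeta> * osc chi t \<zeta> = of_real (chi t) * cis (t * \<zeta>) - of_real (chi 0) -
      (LBINT r=ereal 0..ereal t. complex_of_real (D r) * cis (r * \<zeta>))"
      using e1 unfolding e2 e3 by (simp add: eq_diff_eq)
    then have "\<bar>\<zeta>\<bar> * cmod (osc chi t \<zeta>) = cmod (of_real (chi t) * cis (t * \<zeta>) - of_real (chi 0) -
      (LBINT r=ereal 0..ereal t. complex_of_real (D r) * cis (r * \<zeta>)))"
      by (metis mult_1 norm_ii norm_mult norm_of_real)
    also have "\<dots> \<le> cmod (of_real (chi t) * cis (t * \<zeta>)) + cmod (of_real (chi 0))
      + cmod (LBINT r=ereal 0..ereal t. complex_of_real (D r) * cis (r * \<zeta>))"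
      by (meson add_mono norm_triangle_ineq4 order_refl order_trans)
    also have "\<dots> \<le> 1 + 1 + L * \<bar>t - 0\<bar>"
      by (intro add_mono interval_integral_norm_le[OF cD]) (use chi_bounds D(4) t in \<open>auto simp:
        norm_mult\<close>)
    also have "\<dots> \<le> 2 + 2 * L" using t D(3) mult_left_mono[of "\<bar>t\<bar>" 2 L] by simp
    finally have "(1 + \<bar>\<zeta>\<bar>) * cmod (osc chi t \<zeta>) \<le> 4 + 2 * L" using o1 by (simp add: distrib_right)
    then have "cmod (osc chi t \<zeta>) \<le> (4 + 2 * L) * (1 + \<bar>\<zeta>\<bar>) powr (-1)"
      by (simp add: powr_minus field_simps powr_one add_pos_nonneg)
    moreover have "cmod (of_real (chi t) * osc chi t \<zeta>) \<le> 1 * cmod (osc chi t \<zeta>)"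
      unfolding norm_mult using chi_bounds[of t] by (intro mult_right_mono) auto
    ultimately show ?thesis by linarith
  qed
  then show ?thesis using D(3) by (intro exI[of _ "4 + 2 * L"]) auto
qed

text \<open>Between two consecutive bands either |\<xi>| > 2^(2n) or |\<eta>| > 2^n, so a gain
  2^(-\<kappa> n) can be bought with \<kappa> powers of the frequencies. This is the source of
  summability over \<open>n\<close>.\<close>

lemma band_increment_le:
  assumes "0 \<le> \<kappa>"
  shows "\<bar>indicator (band (Suc n)) (\<xi>, \<eta>) - indicator (band n) (\<xi>, \<eta>)\<bar> \<le> 2 powr (- \<kappa> * real n) *
    ((1 + \<bar>\<xi>\<bar>) powr \<kappa> * (1 + \<bar>\<eta>\<bar>) powr \<kappa>)"
proof -
  have ge1: "1 \<le> (1 + \<bar>x\<bar>) powr \<kappa>" for x :: real using assms by (intro ge_one_powr_ge_zero) auto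
  show ?thesis
  proof (cases "(\<xi>, \<eta>) \<in> band n \<or> (\<xi>, \<eta>) \<notin> band (Suc n)")
    case True
    have "(2::real) ^ (2 * n) \<le> 2 ^ (2 * Suc n)" "(2::real) ^ n \<le> 2 ^ Suc n"
      by (intro power_increasing, auto)+
    then have "band n \<subseteq> band (Suc n)" by (auto simp: band_def intro: order_trans)
    then show ?thesis using True by (auto simp: indicator_def)
  next
    case False
    \<comment> \<open>For n = 0 the smaller band is empty by convention, but the left side is 1 and
      nothing has to be gained.\<close>
    have "2 powr (\<kappa> * real n) \<le> (1 + \<bar>\<xi>\<bar>) powr \<kappa> * (1 + \<bar>\<eta>\<bar>) powr \<kappa>"
    proof (cases "n = 0")
      case True then show ?thesis using mult_mono[OF ge1[of \<xi>] ge1[of \<eta>]] by simp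
    next
      case n: False
      have p: "2 powr (\<kappa> * real n) = (2 ^ n) powr \<kappa>" by (simp add: powr_powr powr_realpow[symmetric]
        mult.commute)
      have "2 ^ (2 * n) < \<bar>\<xi>\<bar> \<or> 2 ^ n < \<bar>\<eta>\<bar>" using False n by (auto simp: band_def)
      then show ?thesis
      proof
        assume a: "2 ^ (2 * n) < \<bar>\<xi>\<bar>"
        have "(2::real) ^ n \<le> 2 ^ (2 * n)" by (rule power_increasing) auto
        then have "2 ^ n \<le> 1 + \<bar>\<xi>\<bar>" using a by linarith
        then have "(2 ^ n) powr \<kappa> \<le> (1 + \<bar>\<xi>\<bar>) powr \<kappa>" using assms by (intro powr_mono2) auto
        then show ?thesis using mult_mono[OF _ ge1[of \<eta>]] p by fastforce
      next
        assume a: "2 ^ n < \<bar>\<eta>\<bar>"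
        then have "(2 ^ n) powr \<kappa> \<le> (1 + \<bar>\<eta>\<bar>) powr \<kappa>" using assms by (intro powr_mono2) auto
        then show ?thesis using mult_mono[OF ge1[of \<xi>]] p by fastforce
      qed
    qed
    then have "2 powr (- \<kappa> * real n) * 2 powr (\<kappa> * real n) \<le> 2 powr (- \<kappa> * real n) * ((1 + \<bar>\<xi>\<bar>) powr
      \<kappa> * (1 + \<bar>\<eta>\<bar>) powr \<kappa>)"
      by (intro mult_left_mono) auto
    moreover have "2 powr (- \<kappa> * real n) * 2 powr (\<kappa> * real n) = 1"
      by (simp add: powr_add[symmetric])
    ultimately have "1 \<le> 2 powr (- \<kappa> * real n) * ((1 + \<bar>\<xi>\<bar>) powr \<kappa> * (1 + \<bar>\<eta>\<bar>) powr \<kappa>)"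
      by (simp only:)
    then show ?thesis by (auto simp: indicator_def)
  qed
qed

definition psi_increment :: "nat \<Rightarrow> real \<Rightarrow> int set \<Rightarrow> (int \<Rightarrow> complex) \<Rightarrow> real \<times> real \<Rightarrow> complex" where
  "psi_increment n t K e = (\<lambda>z. \<Sum>k\<in>K. e k * (psi_kernel c H0 H1 chi (Suc n) k t z - psi_kernel c H0
    H1 chi n k t z))"

lemma psi_kernel_0: "psi_kernel c H0 H1 chi 0 k t = (\<lambda>z. 0)"
  by (auto simp: psi_kernel_def band_def)

lemma psi_kernel_square_integrable: "psi_kernel c H0 H1 chi n k t \<in> square_integrable"
  using psi_W(1)[of n k t] by (cases "n = 0") (auto simp: psi_kernel_0 square_integrable_zero)

lemma psi_increment_square_integrable:
  "finite K \<Longrightarrow> psi_increment n t K e \<in> square_integrable"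
  unfolding psi_increment_def
  using square_integrable_lin[OF psi_kernel_square_integrable psi_kernel_square_integrable, of 1 _ _
    _ "-1"]
  by (intro square_integrable_sum) auto

text \<open>
  Cauchy--Schwarz over \<open>k\<close> with weights \<open>(1 + |\<xi> - k^2|)^(-\<theta>)\<close>: their sum over \<open>k\<close> is bounded uniformly
  in \<open>\<xi>\<close> as soon as \<open>\<theta> > 1/2\<close>, which absorbs the correlations between different \<open>k\<close> caused by the lack
  of periodicity of the noise. The remaining decay \<open>(1 + |\<xi> - k^2|)^(\<theta> - 2)\<close> still beats \<open>|\<xi>|^(1 - 2 H0)\<close>
  for \<open>\<theta>\<close> close to \<open>1/2\<close>, because \<open>H0 > 1/4\<close>.
\<close>

lemma psi_increment_le:
  assumes \<kappa>: "0 \<le> \<kappa>" and \<theta>: "1/2 < \<theta>"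
  shows "\<exists>C\<ge>0. \<forall>n t K e \<xi> \<eta>. finite K \<longrightarrow> (cmod (psi_increment n t K e (\<xi>, \<eta>)))\<^sup>2 \<le>
    C * 2 powr (- \<kappa> * real n) * (\<Sum>k\<in>K. (cmod (e k))\<^sup>2 *
      ((\<bar>\<xi>\<bar> powr (1 - 2 * H0) * (1 + \<bar>\<xi>\<bar>) powr \<kappa> * (1 + \<bar>\<xi> - (of_int k)\<^sup>2\<bar>) powr (-(2 - \<theta>))) *
       (\<bar>\<eta>\<bar> powr (1 - 2 * H1) * (1 + \<bar>\<eta>\<bar>) powr \<kappa> * (1 + \<bar>\<eta> - of_int k\<bar>) powr (-2))))"
proof -
  obtain C1 where C1: "C1 \<ge> 0" "\<And>t \<zeta>. cmod (of_real (chi t) * osc chi t \<zeta>) \<le> C1 * (1 + \<bar>\<zeta>\<bar>) powr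
    (-1)"
    using osc_bound by blast
  obtain C2 where C2: "C2 \<ge> 0" "\<And>(K::int set) \<xi>. finite K \<Longrightarrow> (\<Sum>k\<in>K. (1 + \<bar>\<xi> - (of_int k)\<^sup>2\<bar>) powr
    (-\<theta>)) \<le> C2"
    using sum_resonance[OF \<theta>] by blast
  have "(cmod (psi_increment n t K e (\<xi>, \<eta>)))\<^sup>2 \<le>
    (c\<^sup>2 * (4 * C1\<^sup>2) * C2) * 2 powr (- \<kappa> * real n) * (\<Sum>k\<in>K. (cmod (e k))\<^sup>2 *
      ((\<bar>\<xi>\<bar> powr (1 - 2 * H0) * (1 + \<bar>\<xi>\<bar>) powr \<kappa> * (1 + \<bar>\<xi> - (of_int k)\<^sup>2\<bar>) powr (-(2 - \<theta>))) *
       (\<bar>\<eta>\<bar> powr (1 - 2 * H1) * (1 + \<bar>\<eta>\<bar>) powr \<kappa> * (1 + \<bar>\<eta> - of_int k\<bar>) powr (-2))))"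
    if K: "finite K" for n t K e \<xi> \<eta>
  proof -
    define \<delta> :: real where "\<delta> = indicator (band (Suc n)) (\<xi>, \<eta>) - indicator (band n) (\<xi>, \<eta>)"
    define s where "s = (\<Sum>k\<in>K. e k * (window k \<eta> * (- \<i> * of_real (chi t) * osc chi t
      (\<xi> - (of_int k)\<^sup>2))))"
    \<comment> \<open>The decay (1 + |\<xi> - k^2|)^(-1) is split: the power \<theta>/2 goes to
      \<open>a\<close>, whose squares have sum at most \<open>C2\<close>, and the remaining 1 -
      \<theta>/2 goes to \<open>b\<close> together with the decay in \<eta>.\<close>
    define a where "a k = (1 + \<bar>\<xi> - (of_int k)\<^sup>2\<bar>) powr (-\<theta>/2)" for k :: int
    define b where "b k = cmod (e k) * (1 + \<bar>\<eta> - of_int k\<bar>) powr (-1) * (1 + \<bar>\<xi> - (of_int k)\<^sup>2\<bar>)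
      powr (-(1 - \<theta>/2))" for k :: int
    have "psi_increment n t K e (\<xi>, \<eta>) = of_real (c * \<delta>) * (amp H0 \<xi> * amp H1 \<eta>) * s"
      unfolding psi_increment_def psi_kernel_def \<delta>_def s_def sum_distrib_left
      by (intro sum.cong) (auto simp: algebra_simps)
    then have "(cmod (psi_increment n t K e (\<xi>, \<eta>)))\<^sup>2 = c\<^sup>2 * \<bar>\<delta>\<bar>\<^sup>2 * (\<bar>\<xi>\<bar> powr (1 - 2 * H0) * \<bar>\<eta>\<bar>
      powr (1 - 2 * H1)) * (cmod s)\<^sup>2"
      using c_pos by (simp add: norm_mult norm_amp power_mult_distrib powr_square
        right_diff_distrib)
    \<comment> \<open>A difference of indicators has square at most its modulus, so the squared
      kernel costs only \<kappa> powers and not 2 \<kappa>.\<close>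
    moreover have "\<bar>\<delta>\<bar>\<^sup>2 \<le> 2 powr (- \<kappa> * real n) * ((1 + \<bar>\<xi>\<bar>) powr \<kappa> * (1 + \<bar>\<eta>\<bar>) powr \<kappa>)"
    proof -
      have "\<bar>\<delta>\<bar>\<^sup>2 \<le> \<bar>\<delta>\<bar>" by (auto simp: \<delta>_def indicator_def)
      then show ?thesis using band_increment_le[OF \<kappa>, of n \<xi> \<eta>] unfolding \<delta>_def by linarith
    qed
    moreover have "(cmod s)\<^sup>2 \<le> (4 * C1\<^sup>2) * (C2 * (\<Sum>k\<in>K. (b k)\<^sup>2))"
    proof -
      have "cmod s \<le> (\<Sum>k\<in>K. (2 * C1) * (a k * b k))" unfolding s_def
      proof (rule order_trans[OF norm_sum], rule sum_mono)
        fix k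
        have "cmod (e k * (window k \<eta> * (- \<i> * of_real (chi t) * osc chi t (\<xi> - (of_int k)\<^sup>2)))) =
           cmod (e k) * (cmod (window k \<eta>) * cmod (of_real (chi t) * osc chi t (\<xi> - (of_int k)\<^sup>2)))"
          by (simp add: norm_mult)
        also have "\<dots> \<le> cmod (e k) * ((2 * (1 + \<bar>\<eta> - of_int k\<bar>) powr (-1)) *
          (C1 * (1 + \<bar>\<xi> - (of_int k)\<^sup>2\<bar>) powr (-1)))"
          by (intro mult_left_mono mult_mono window_le C1) auto
        also have "(1 + \<bar>\<xi> - (of_int k)\<^sup>2\<bar>) powr (-1) = a k * (1 + \<bar>\<xi> - (of_int k)\<^sup>2\<bar>) powr
          (-(1 - \<theta>/2))"
          unfolding a_def powr_add[symmetric] by simp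
        finally show "cmod (e k * (window k \<eta> * (- \<i> * of_real (chi t) * osc chi t
          (\<xi> - (of_int k)\<^sup>2)))) \<le> (2 * C1) * (a k * b k)"
          by (simp add: b_def mult_ac)
      qed
      then have "(cmod s)\<^sup>2 \<le> ((2 * C1) * (\<Sum>k\<in>K. a k * b k))\<^sup>2"
        by (intro power_mono) (auto simp: sum_distrib_left)
      also have "\<dots> = 4 * C1\<^sup>2 * (\<Sum>k\<in>K. a k * b k)\<^sup>2" by (simp add: power_mult_distrib)
      also have "(\<Sum>k\<in>K. a k * b k)\<^sup>2 \<le> (\<Sum>k\<in>K. (a k)\<^sup>2) * (\<Sum>k\<in>K. (b k)\<^sup>2)"
        by (rule Cauchy_Schwarz_ineq_sum)
      also have "(\<Sum>k\<in>K. (a k)\<^sup>2) \<le> C2" using C2(2)[OF K, of \<xi>] by (simp add: a_def powr_square)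
      finally show ?thesis by (simp add: mult_left_mono mult_right_mono sum_nonneg)
    qed
    ultimately have "(cmod (psi_increment n t K e (\<xi>, \<eta>)))\<^sup>2 \<le> c\<^sup>2 * (2 powr (- \<kappa> * real n) *
      ((1 + \<bar>\<xi>\<bar>) powr \<kappa> * (1 + \<bar>\<eta>\<bar>) powr \<kappa>)) * (\<bar>\<xi>\<bar> powr (1 - 2 * H0) * \<bar>\<eta>\<bar> powr (1 - 2 * H1)) *
      ((4 * C1\<^sup>2) * (C2 * (\<Sum>k\<in>K. (b k)\<^sup>2)))"
      using C2(1) by (simp only:) (intro mult_mono mult_left_mono mult_nonneg_nonneg, auto intro:
        sum_nonneg)
    also have "\<dots> = (c\<^sup>2 * (4 * C1\<^sup>2) * C2) * 2 powr (- \<kappa> * real n) * (\<Sum>k\<in>K. ((1 + \<bar>\<xi>\<bar>) powr \<kappa> * (1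
      + \<bar>\<eta>\<bar>) powr \<kappa>) * (\<bar>\<xi>\<bar> powr (1 - 2 * H0) * \<bar>\<eta>\<bar> powr (1 - 2 * H1)) * (b k)\<^sup>2)"
      unfolding sum_distrib_left by (intro sum.cong refl) (simp only: mult_ac)
    also have "(\<Sum>k\<in>K. ((1 + \<bar>\<xi>\<bar>) powr \<kappa> * (1 + \<bar>\<eta>\<bar>) powr \<kappa>) * (\<bar>\<xi>\<bar> powr (1 - 2 * H0) * \<bar>\<eta>\<bar> powr
      (1 - 2 * H1)) * (b k)\<^sup>2) =
      (\<Sum>k\<in>K. (cmod (e k))\<^sup>2 *
      ((\<bar>\<xi>\<bar> powr (1 - 2 * H0) * (1 + \<bar>\<xi>\<bar>) powr \<kappa> * (1 + \<bar>\<xi> - (of_int k)\<^sup>2\<bar>) powr (-(2 - \<theta>))) *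
       (\<bar>\<eta>\<bar> powr (1 - 2 * H1) * (1 + \<bar>\<eta>\<bar>) powr \<kappa> * (1 + \<bar>\<eta> - of_int k\<bar>) powr (-2))))"
    proof (intro sum.cong refl)
      fix k
      have "(b k)\<^sup>2 = (cmod (e k))\<^sup>2 * (1 + \<bar>\<eta> - of_int k\<bar>) powr (-2) * (1 + \<bar>\<xi> - (of_int k)\<^sup>2\<bar>)
        powr (-(2 - \<theta>))"
        unfolding b_def power_mult_distrib powr_square by (simp add: algebra_simps)
      then show "((1 + \<bar>\<xi>\<bar>) powr \<kappa> * (1 + \<bar>\<eta>\<bar>) powr \<kappa>) * (\<bar>\<xi>\<bar> powr (1 - 2 * H0) * \<bar>\<eta>\<bar> powr
        (1 - 2 * H1)) * (b k)\<^sup>2 = (cmod (e k))\<^sup>2 *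
      ((\<bar>\<xi>\<bar> powr (1 - 2 * H0) * (1 + \<bar>\<xi>\<bar>) powr \<kappa> * (1 + \<bar>\<xi> - (of_int k)\<^sup>2\<bar>) powr (-(2 - \<theta>))) *
       (\<bar>\<eta>\<bar> powr (1 - 2 * H1) * (1 + \<bar>\<eta>\<bar>) powr \<kappa> * (1 + \<bar>\<eta> - of_int k\<bar>) powr (-2)))"
        by (simp only: mult_ac)
    qed
    finally show ?thesis .
  qed
  then show ?thesis using C2(1) by (intro exI[of _ "c\<^sup>2 * (4 * C1\<^sup>2) * C2"]) auto
qed

text \<open>The pointwise bound factorises in \<xi> and \<eta>, with bumps centred at k^2 and k. For
  \<theta> = 1/2 + \<kappa> the available decay in \<xi> is 3/2 - \<kappa>, and losing \<kappa> more
  leaves the conditions 2 \<kappa> < 1/2 and 2 \<kappa> < 2 H0 - 1/2; the decay 2 in \<eta> gives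
  \<kappa> < 2 H1.\<close>

lemma sq_norm_psi_increment_le:
  assumes \<kappa>: "0 < \<kappa>" "2 * \<kappa> < 1/2" "2 * \<kappa> < 2 * H0 - 1/2" "\<kappa> < 2 * H1"
  shows "\<exists>C\<ge>0. \<forall>n t K e. finite K \<longrightarrow> sq_norm (psi_increment n t K e) \<le>
    C * 2 powr (- \<kappa> * real n) * (\<Sum>k\<in>K. (cmod (e k))\<^sup>2 * ((1 + (of_int k)\<^sup>2) powr (1 - 2 * H0 + \<kappa>) *
      (1 + \<bar>of_int k\<bar>) powr (1 - 2 * H1 + \<kappa>)))"
proof -
  define \<theta> where "\<theta> = 1/2 + \<kappa>"
  obtain C1 where C1: "C1 \<ge> 0" "\<And>n t K e \<xi> \<eta>. finite K \<Longrightarrow> (cmod (psi_increment n t K e (\<xi>, \<eta>)))\<^sup>2 \<le>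
    C1 * 2 powr (- \<kappa> * real n) * (\<Sum>k\<in>K. (cmod (e k))\<^sup>2 *
      ((\<bar>\<xi>\<bar> powr (1 - 2 * H0) * (1 + \<bar>\<xi>\<bar>) powr \<kappa> * (1 + \<bar>\<xi> - (of_int k)\<^sup>2\<bar>) powr (-(2 - \<theta>))) *
       (\<bar>\<eta>\<bar> powr (1 - 2 * H1) * (1 + \<bar>\<eta>\<bar>) powr \<kappa> * (1 + \<bar>\<eta> - of_int k\<bar>) powr (-2))))"
    using psi_increment_le[of \<kappa> \<theta>] \<kappa> unfolding \<theta>_def by auto
  obtain C2 where C2: "C2 \<ge> 0" "\<And>m. (\<integral>\<^sup>+x. ennreal (\<bar>x\<bar> powr (1 - 2 * H0) * (1 + \<bar>x\<bar>) powr \<kappa> * (1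
    + \<bar>x - m\<bar>) powr (-(2 - \<theta>))) \<partial>lborel) \<le> ennreal (C2 * (1 + \<bar>m\<bar>) powr (1 - 2 * H0 + \<kappa>))"
    using nn_integral_weight_decay[of "1 - 2 * H0" \<kappa> "2 - \<theta>"] \<kappa> H unfolding \<theta>_def by auto
  obtain C3 where C3: "C3 \<ge> 0" "\<And>m. (\<integral>\<^sup>+x. ennreal (\<bar>x\<bar> powr (1 - 2 * H1) * (1 + \<bar>x\<bar>) powr \<kappa> * (1
    + \<bar>x - m\<bar>) powr (-2)) \<partial>lborel) \<le> ennreal (C3 * (1 + \<bar>m\<bar>) powr (1 - 2 * H1 + \<kappa>))"
    using nn_integral_weight_decay[of "1 - 2 * H1" \<kappa> 2] \<kappa> H by auto
  have "sq_norm (psi_increment n t K e) \<le>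
    (C1 * (C2 * C3)) * 2 powr (- \<kappa> * real n) * (\<Sum>k\<in>K. (cmod (e k))\<^sup>2 * ((1 + (of_int k)\<^sup>2) powr
      (1 - 2 * H0 + \<kappa>) * (1 + \<bar>of_int k\<bar>) powr (1 - 2 * H1 + \<kappa>)))"
    if K: "finite K" for n t K e
  proof -
    let ?F = "\<lambda>k x. \<bar>x\<bar> powr (1 - 2 * H0) * (1 + \<bar>x\<bar>) powr \<kappa> * (1 + \<bar>x - (real_of_int k)\<^sup>2\<bar>) powr
      (-(2 - \<theta>))"
    let ?G = "\<lambda>k x. \<bar>x\<bar> powr (1 - 2 * H1) * (1 + \<bar>x\<bar>) powr \<kappa> * (1 + \<bar>x - real_of_int k\<bar>) powr (-2)"
    let ?D = "C1 * 2 powr (- \<kappa> * real n)"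
    have D0: "0 \<le> ?D" using C1 by simp
    note f = psi_increment_square_integrable[OF K, of n t e]
    have "ennreal (sq_norm (psi_increment n t K e))
      = (\<integral>\<^sup>+z. ennreal ((cmod (psi_increment n t K e z))\<^sup>2) \<partial>lborel)"
      unfolding sq_norm_def using f by (intro nn_integral_eq_integral[symmetric])
        (auto simp: square_integrable_def)
    also have "\<dots> \<le> (\<integral>\<^sup>+z. (\<Sum>k\<in>K. ennreal (?D * (cmod (e k))\<^sup>2) * (ennreal (?F k (fst z)) * ennreal
      (?G k (snd z)))) \<partial>lborel)"
    proof (rule nn_integral_mono)
      fix z :: "real \<times> real"
      have "(cmod (psi_increment n t K e z))\<^sup>2 \<le> ?D * (\<Sum>k\<in>K. (cmod (e k))\<^sup>2 * (?F k (fst z) * ?G k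
        (snd z)))"
        using C1(2)[OF K, of n t e "fst z" "snd z"] by simp
      also have "\<dots> = (\<Sum>k\<in>K. (?D * (cmod (e k))\<^sup>2) * (?F k (fst z) * ?G k (snd z)))"
        by (simp only: sum_distrib_left mult.assoc)
      finally have "ennreal ((cmod (psi_increment n t K e z))\<^sup>2)
        \<le> ennreal (\<Sum>k\<in>K. (?D * (cmod (e k))\<^sup>2) * (?F k (fst z) * ?G k (snd z)))"
        by (rule ennreal_leI)
      also have "\<dots> = (\<Sum>k\<in>K. ennreal (?D * (cmod (e k))\<^sup>2) * (ennreal (?F k (fst z)) * ennreal
        (?G k (snd z))))"
        using D0 by (subst sum_ennreal[symmetric]) (auto simp: ennreal_mult' intro!: sum.cong)
      finally show "ennreal ((cmod (psi_increment n t K e z))\<^sup>2) \<le> \<dots>" .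
    qed
    also have "\<dots> = (\<Sum>k\<in>K. ennreal (?D * (cmod (e k))\<^sup>2) * (\<integral>\<^sup>+z. ennreal (?F k (fst z)) * ennreal
      (?G k (snd z)) \<partial>lborel))"
      by (simp add: nn_integral_sum nn_integral_cmult)
    also have "\<dots> = (\<Sum>k\<in>K. ennreal (?D * (cmod (e k))\<^sup>2) * ((\<integral>\<^sup>+x. ennreal (?F k x) \<partial>lborel) *
      (\<integral>\<^sup>+x. ennreal (?G k x) \<partial>lborel)))"
      by (intro sum.cong refl arg_cong2[where f="(*)"] nn_integral_lborel_prod_mult) auto
    also have "\<dots> \<le> (\<Sum>k\<in>K. ennreal (?D * (cmod (e k))\<^sup>2) * (ennreal (C2 * (1 + \<bar>(of_int k)\<^sup>2\<bar>) powr
      (1 - 2 * H0 + \<kappa>)) * ennreal (C3 * (1 + \<bar>of_int k\<bar>) powr (1 - 2 * H1 + \<kappa>))))"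
      by (intro sum_mono mult_left_mono mult_mono C2(2) C3(2)) auto
    also have "\<dots>
      = (\<Sum>k\<in>K. ennreal (?D * (cmod (e k))\<^sup>2 * ((C2 * (1 + \<bar>(of_int k)\<^sup>2\<bar>) powr (1 - 2 * H0 + \<kappa>)) *
      (C3 * (1 + \<bar>of_int k\<bar>) powr (1 - 2 * H1 + \<kappa>)))))"
      using D0 C2(1) C3(1) by (intro sum.cong) (auto simp: ennreal_mult)
    also have "\<dots> = ennreal (\<Sum>k\<in>K. ?D * (cmod (e k))\<^sup>2 * ((C2 * (1 + \<bar>(of_int k)\<^sup>2\<bar>) powr (1 - 2 * H0
      + \<kappa>)) * (C3 * (1 + \<bar>of_int k\<bar>) powr (1 - 2 * H1 + \<kappa>))))"
      using D0 C2(1) C3(1) by (intro sum_ennreal) auto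
    finally have "sq_norm (psi_increment n t K e)
      \<le> (\<Sum>k\<in>K. ?D * (cmod (e k))\<^sup>2 * ((C2 * (1 + \<bar>(of_int k)\<^sup>2\<bar>) powr (1 - 2 * H0 + \<kappa>)) *
      (C3 * (1 + \<bar>of_int k\<bar>) powr (1 - 2 * H1 + \<kappa>))))"
      using D0 C2(1) C3(1) by (subst (asm) ennreal_le_iff) (auto intro!: sum_nonneg
        mult_nonneg_nonneg)
    also have "\<dots> = (\<Sum>k\<in>K. ((C1 * (C2 * C3)) * 2 powr (- \<kappa> * real n)) * ((cmod (e k))\<^sup>2 *
      ((1 + (of_int k)\<^sup>2) powr (1 - 2 * H0 + \<kappa>) * (1 + \<bar>of_int k\<bar>) powr (1 - 2 * H1 + \<kappa>))))"
      by (intro sum.cong refl) (simp add: mult_ac)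
    finally show ?thesis by (simp only: sum_distrib_left)
  qed
  then show ?thesis using C1(1) C2(1) C3(1) by (intro exI[of _ "C1 * (C2 * C3)"]) auto
qed

end

section \<open>Dyadic blocks and path regularity\<close>

text \<open>The shift by 1 puts k = 0, alone, into block 0, so that the blocks partition the
  integers.\<close>

definition block :: "nat \<Rightarrow> int set" where
  "block j = {k. 2 ^ j \<le> \<bar>k\<bar> + 1 \<and> \<bar>k\<bar> + 1 < 2 ^ Suc j}"

lemma block_subset: "block j \<subseteq> {- (2 ^ Suc j) <..< 2 ^ Suc j}"
  by (auto simp: block_def)

lemma finite_block [simp]: "finite (block j)"
  by (rule finite_subset[OF block_subset]) simp

lemma card_block: "real (card (block j)) \<le> 2 ^ (j + 2)"
proof -
  have "card (block j) \<le> card {- (2 ^ Suc j :: int) <..< 2 ^ Suc j}"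
    by (rule card_mono[OF _ block_subset]) simp
  also have "\<dots> \<le> nat (2 ^ (j + 2))" by simp
  also have "\<dots> = 2 ^ (j + 2)" by (simp add: nat_mult_distrib nat_power_eq)
  finally show ?thesis using of_nat_mono by fastforce
qed

lemma disjoint_block: "disjoint_family block"
  unfolding disjoint_family_on_def
proof (intro ballI impI)
  fix i j :: nat assume "i \<noteq> j"
  have *: "block i \<inter> block j = {}" if "i < j" for i j
  proof -
    have "(2::int) ^ Suc i \<le> 2 ^ j" using that by (intro power_increasing) auto
    then show ?thesis by (auto simp: block_def)
  qed
  show "block i \<inter> block j = {}"
    using *[of i j] *[of j i] \<open>i \<noteq> j\<close> by (cases "i < j") auto
qed

lemma UN_block: "(\<Union>j. block j) = UNIV"
proof -
  have "\<exists>j. k \<in> block j" for k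
  proof -
    have "\<exists>m. (2::int) ^ m \<le> \<bar>k\<bar> + 1 \<and> \<bar>k\<bar> + 1 < 2 ^ Suc m"
    proof -
      have ex: "\<exists>m. \<bar>k\<bar> + 1 < (2::int) ^ m"
      proof -
        have "int (nat (\<bar>k\<bar> + 1)) < int (2 ^ nat (\<bar>k\<bar> + 1))" unfolding of_nat_less_iff
          by (rule less_exp)
        then show ?thesis by (intro exI[of _ "nat (\<bar>k\<bar> + 1)"]) simp
      qed
      define m where "m = (LEAST m. \<bar>k\<bar> + 1 < (2::int) ^ m)"
      have 1: "\<bar>k\<bar> + 1 < (2::int) ^ m" unfolding m_def by (rule LeastI_ex[OF ex])
      then have "m \<noteq> 0" by (cases m) auto
      then obtain l where l: "m = Suc l" by (cases m) auto
      have "\<not> \<bar>k\<bar> + 1 < (2::int) ^ l" using not_less_Least[of l "\<lambda>m. \<bar>k\<bar> + 1 < (2::int) ^ m"] l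
        m_def by auto
      then show ?thesis using 1 l by (intro exI[of _ l]) auto
    qed
    then show ?thesis by (auto simp: block_def)
  qed
  then show ?thesis by auto
qed

text \<open>Assuming comparability in both directions lets one statement serve exponents of either
  sign.\<close>

lemma powr_comparable:
  fixes x y c e :: real
  assumes "0 < x" "0 < y" "1 \<le> c" "x \<le> c * y" "y \<le> c * x"
  shows "x powr e \<le> c powr \<bar>e\<bar> * y powr e"
proof (cases "0 \<le> e")
  case True
  have "x powr e \<le> (c * y) powr e" using assms True by (intro powr_mono2) auto
  then show ?thesis using assms True by (simp add: powr_mult)
next
  case False
  have "(c * x) powr e \<le> y powr e" using assms False by (intro powr_mono2') auto
  then have "c powr (-e) * (c * x) powr e \<le> c powr (-e) * y powr e" by (intro mult_left_mono) auto
  moreover have "c powr (-e) * (c * x) powr e = x powr e"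
    using assms powr_mult[of c x e] by (simp add: mult.assoc[symmetric] powr_add[symmetric])
  ultimately show ?thesis using False by simp
qed

lemma bracket_sq: "(bracket k)\<^sup>2 = 1 + (of_int k)\<^sup>2"
  unfolding bracket_def by (rule real_sqrt_pow2) simp

lemma bracket_comparable:
  shows "bracket k \<le> 1 + \<bar>of_int k\<bar>" "1 + \<bar>of_int k\<bar> \<le> 2 * bracket k"
proof -
  have "(bracket k)\<^sup>2 \<le> (1 + \<bar>of_int k\<bar>)\<^sup>2" unfolding bracket_sq
    by (simp add: power2_eq_square algebra_simps)
  then show "bracket k \<le> 1 + \<bar>of_int k\<bar>" by (rule power2_le_imp_le) simp
  have "(of_int k)\<^sup>2 \<le> (bracket k)\<^sup>2" unfolding bracket_sq by simp
  then have "\<bar>of_int k\<bar>\<^sup>2 \<le> (bracket k)\<^sup>2" by simp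
  then have "\<bar>of_int k\<bar> \<le> bracket k" by (rule power2_le_imp_le) (use bracket_ge_1[of k] in simp)
  then show "1 + \<bar>of_int k\<bar> \<le> 2 * bracket k" using bracket_ge_1[of k] by linarith
qed

lemma bracket_powr_comparable:
  "(1 + \<bar>of_int k\<bar>) powr e \<le> 2 powr \<bar>e\<bar> * bracket k powr e"
  by (rule powr_comparable) (use bracket_comparable[of k] bracket_ge_1[of k] in auto)

lemma one_plus_sq_powr: "(1 + (of_int k)\<^sup>2) powr e = bracket k powr (2 * e)"
proof -
  have "(1 + (of_int k)\<^sup>2) powr e = ((bracket k)\<^sup>2) powr e" by (simp add: bracket_sq)
  also have "(bracket k)\<^sup>2 = bracket k powr 2" using bracket_ge_1[of k] by (simp add: powr_numeral)
  finally show ?thesis by (simp add: powr_powr)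
qed

lemma bracket_block:
  assumes "k \<in> block j"
  shows "bracket k powr e \<le> 2 powr \<bar>e\<bar> * (2 ^ j) powr e"
proof (rule powr_comparable)
  have k: "2 ^ j \<le> \<bar>k\<bar> + 1" "\<bar>k\<bar> + 1 < 2 ^ Suc j" using assms by (auto simp: block_def)
  have "real_of_int (2 ^ j) \<le> real_of_int (\<bar>k\<bar> + 1)" using k(1) by (simp only: of_int_le_iff)
  then have 1: "2 ^ j \<le> \<bar>real_of_int k\<bar> + 1" by simp
  have "real_of_int (\<bar>k\<bar> + 1) < real_of_int (2 ^ Suc j)" using k(2) by (simp only: of_int_less_iff)
  then have 2: "\<bar>real_of_int k\<bar> + 1 < 2 * 2 ^ j" by simp
  show "bracket k \<le> 2 * 2 ^ j" using bracket_comparable(1)[of k] 2 by linarith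
  show "2 ^ j \<le> 2 * bracket k" using bracket_comparable(2)[of k] 1 by linarith
qed (use bracket_ge_1[of k] in auto)

lemma block_sum_le:
  "(\<Sum>k\<in>block j. bracket k powr e) \<le> 4 * 2 powr \<bar>e\<bar> * (2 ^ j) powr (1 + e)"
proof -
  have "(\<Sum>k\<in>block j. bracket k powr e) \<le> real (card (block j)) * (2 powr \<bar>e\<bar> * (2 ^ j) powr e)"
    by (rule sum_bounded_above) (rule bracket_block)
  also have "\<dots> \<le> 2 ^ (j + 2) * (2 powr \<bar>e\<bar> * (2 ^ j) powr e)"
    by (intro mult_right_mono card_block) auto
  also have "\<dots> = 4 * 2 powr \<bar>e\<bar> * (2 ^ j) powr (1 + e)" by (simp add: powr_add power_add)
  finally show ?thesis .
qed

text \<open>The weight of the Bessel potential is folded into the character: summing the increments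
  of a block against it gives the value at \<open>x\<close> of the smoothed field.\<close>

definition character :: "real \<Rightarrow> real \<Rightarrow> int \<Rightarrow> complex" where
  "character \<alpha> x k = of_real (bracket k powr (-\<alpha>)) * cis (real_of_int k * x)"

lemma norm_character: "cmod (character \<alpha> x k) = bracket k powr (-\<alpha>)"
  by (simp add: character_def norm_mult)

text \<open>Each frequency contributes at most order k^e to the bound and a block has about 2^j of
  them. Here 1 + e = 2 (2 - (2 H0 + H1) - \<alpha>) + 3 \<kappa>, which is negative once \<kappa> is
  small against the gap in \<alpha>.\<close>

lemma (in sheet) sq_norm_block_le:
  assumes \<alpha>: "2 - (2 * H0 + H1) < \<alpha>" and s: "3/2 < 2 * H0 + H1"
  obtains C \<kappa> where "C \<ge> 0" "\<kappa> > 0" "\<And>n j t x. sq_norm (psi_increment n t (block j) (character \<alpha> x))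
    \<le> C * 2 powr (- \<kappa> * real (n + j))"
proof -
  \<comment> \<open>The first three entries yield the strict inequalities needed for the integrals
    in \<xi> and \<eta> (1/5 is merely below 1/4); the last one gives 1 + e \<le> -\<kappa>.\<close>
  define \<kappa> where "\<kappa> = Min {1/5, (2 * H0 - 1/2) / 3, H1, (\<alpha> - (2 - (2 * H0 + H1))) / 2}"
  have "\<kappa> \<le> 1/5" "\<kappa> \<le> (2 * H0 - 1/2) / 3" "\<kappa> \<le> H1" "\<kappa> \<le> (\<alpha> - (2 - (2 * H0 + H1))) / 2"
    unfolding \<kappa>_def by (rule Min_le, simp, simp)+
  moreover have "0 < \<kappa>" using \<alpha> s H unfolding \<kappa>_def by auto
  ultimately have \<kappa>: "0 < \<kappa>" "\<kappa> \<le> 1/5" "\<kappa> \<le> (2 * H0 - 1/2) / 3" "\<kappa> \<le> H1" "\<kappa>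
    \<le> (\<alpha> - (2 - (2 * H0 + H1))) / 2" by auto
  \<comment> \<open>Since H1 < 1, the lower bound 3/2 on 2 H0 + H1 pushes H0 above 1/4.\<close>
  have H0: "1/4 < H0" using s H by linarith
  obtain C where C: "C \<ge> 0" "\<And>n t K e. finite K \<Longrightarrow> sq_norm (psi_increment n t K e) \<le>
    C * 2 powr (- \<kappa> * real n) * (\<Sum>k\<in>K. (cmod (e k))\<^sup>2 * ((1 + (of_int k)\<^sup>2) powr (1 - 2 * H0 + \<kappa>) *
      (1 + \<bar>of_int k\<bar>) powr (1 - 2 * H1 + \<kappa>)))"
    using sq_norm_psi_increment_le[of \<kappa>] \<kappa> H H0 by auto
  define a where "a = 1 - 2 * H0 + \<kappa>"
  define b where "b = 1 - 2 * H1 + \<kappa>"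
  define e where "e = - 2 * \<alpha> + 2 * a + b"
  have e: "1 + e \<le> - \<kappa>" using \<kappa>(5) unfolding e_def a_def b_def by (simp add: field_simps)
  define C' where "C' = C * (2 powr \<bar>b\<bar> * (4 * 2 powr \<bar>e\<bar>))"
  have "sq_norm (psi_increment n t (block j) (character \<alpha> x)) \<le> C' * 2 powr (- \<kappa> * real (n + j))"
    for n j t x
  proof -
    have "(\<Sum>k\<in>block j. (cmod (character \<alpha> x k))\<^sup>2 * ((1 + (of_int k)\<^sup>2) powr a * (1 + \<bar>of_int k\<bar>)
      powr b))
      \<le> (\<Sum>k\<in>block j. 2 powr \<bar>b\<bar> * bracket k powr e)"
    proof (rule sum_mono)
      fix k
      have "(cmod (character \<alpha> x k))\<^sup>2 * ((1 + (of_int k)\<^sup>2) powr a * (1 + \<bar>of_int k\<bar>) powr b) \<le>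
        bracket k powr (2 * (-\<alpha>)) * (bracket k powr (2 * a) * (2 powr \<bar>b\<bar> * bracket k powr b))"
        unfolding norm_character powr_square one_plus_sq_powr
        by (intro mult_left_mono bracket_powr_comparable) auto
      also have "\<dots> = 2 powr \<bar>b\<bar> * bracket k powr e" unfolding e_def powr_add by (simp add: mult_ac)
      finally show "(cmod (character \<alpha> x k))\<^sup>2 * ((1 + (of_int k)\<^sup>2) powr a * (1 + \<bar>of_int k\<bar>) powr
        b) \<le> 2 powr \<bar>b\<bar> * bracket k powr e" .
    qed
    also have "\<dots> \<le> 2 powr \<bar>b\<bar> * (4 * 2 powr \<bar>e\<bar> * (2 ^ j) powr (1 + e))"
      unfolding sum_distrib_left[symmetric] by (intro mult_left_mono block_sum_le) auto
    also have "\<dots> \<le> 2 powr \<bar>b\<bar> * (4 * 2 powr \<bar>e\<bar> * (2 ^ j) powr (-\<kappa>))"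
      using e by (intro mult_left_mono powr_mono) auto
    also have "(2 ^ j) powr (-\<kappa>) = 2 powr (- \<kappa> * real j)" by (simp add: powr_realpow[symmetric]
      powr_powr mult.commute)
    finally have "C * 2 powr (- \<kappa> * real n) * (\<Sum>k\<in>block j. (cmod (character \<alpha> x k))\<^sup>2 *
      ((1 + (of_int k)\<^sup>2) powr a * (1 + \<bar>of_int k\<bar>) powr b)) \<le>
       C * 2 powr (- \<kappa> * real n) * (2 powr \<bar>b\<bar> * (4 * 2 powr \<bar>e\<bar> * 2 powr (- \<kappa> * real j)))"
      using C(1) by (intro mult_left_mono) auto
    also have "\<dots> = C' * 2 powr (- \<kappa> * real (n + j))"
      unfolding C'_def by (simp add: powr_add[symmetric] algebra_simps)
    finally show ?thesis using C(2)[of "block j" n t "character \<alpha> x"] unfolding a_def b_def by simp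
  qed
  moreover have "C' \<ge> 0" using C(1) by (simp add: C'_def)
  ultimately show ?thesis using that \<kappa>(1) by blast
qed

text \<open>\<open>|b| \<le> \<lambda> + |b|\<^sup>2/\<lambda>\<close> trades the square integral of a path against a small multiple of it.\<close>

lemma interval_integral_le_square:
  fixes b f :: "real \<Rightarrow> complex"
  assumes b: "continuous_on UNIV b" and f: "continuous_on UNIV f" and le: "\<And>r. cmod (f r)
    \<le> cmod (b r)"
    and l: "0 < l" and st: "\<bar>s\<bar> \<le> 2" "\<bar>t\<bar> \<le> 2"
  shows "cmod (LBINT r=ereal s..ereal t. f r) \<le> l * \<bar>t - s\<bar> + integral {-2..2} (\<lambda>r. (cmod (b r))\<^sup>2)
    / l"
proof -
  have *: "cmod (LBINT r=ereal s..ereal t. f r) \<le> l * (t - s) + integral {-2..2}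
    (\<lambda>r. (cmod (b r))\<^sup>2) / l"
    if st: "s \<le> t" "\<bar>s\<bar> \<le> 2" "\<bar>t\<bar> \<le> 2" for s t
  proof -
    have c: "continuous_on S f" "continuous_on S (\<lambda>r. (cmod (b r))\<^sup>2)" for S
      using b f by (auto intro!: continuous_intros intro: continuous_on_subset)
    have i: "(\<lambda>r. (cmod (b r))\<^sup>2) integrable_on {x..y}" for x y
      by (rule integrable_continuous_real[OF c(2)])
    have "cmod (LBINT r=ereal s..ereal t. f r) = cmod (integral {s..t} f)"
      unfolding interval_integral_Icc[OF st(1)] integral_Icc_eq_HK(1)[OF c(1)] ..
    also have "\<dots> \<le> integral {s..t} (\<lambda>r. l + (cmod (b r))\<^sup>2 / l)"
    proof (rule integral_norm_bound_integral)
      show "f integrable_on {s..t}" by (rule integrable_continuous_real[OF c(1)])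
      show "(\<lambda>r. l + (cmod (b r))\<^sup>2 / l) integrable_on {s..t}"
        by (intro integrable_continuous_real continuous_intros c(2)) (use l in auto)
      fix r
      have "0 \<le> (cmod (b r) - l)\<^sup>2" by simp
      moreover have "0 \<le> cmod (b r) * l" using l by simp
      ultimately have "cmod (b r) * l \<le> l * l + (cmod (b r))\<^sup>2"
        by (simp add: power2_diff power2_eq_square algebra_simps)
      then have "cmod (b r) \<le> l + (cmod (b r))\<^sup>2 / l" using l by (simp add: field_simps)
      then show "norm (f r) \<le> l + (cmod (b r))\<^sup>2 / l" using le order_trans by blast
    qed
    also have "\<dots> = l * (t - s) + integral {s..t} (\<lambda>r. (cmod (b r))\<^sup>2) / l"
      using st i l by (subst Henstock_Kurzweil_Integration.integral_add) (auto intro!: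
        integrable_continuous_real continuous_intros c(2))
    also have "integral {s..t} (\<lambda>r. (cmod (b r))\<^sup>2) \<le> integral {-2..2} (\<lambda>r. (cmod (b r))\<^sup>2)"
      by (rule integral_subset_le) (use st i in auto)
    finally show ?thesis using l by (simp add: divide_right_mono)
  qed
  show ?thesis
  proof (cases "s \<le> t")
    case True then show ?thesis using *[of s t] st by simp
  next
    case False then show ?thesis using *[of t s] st
      unfolding interval_integral_endpoints_reverse[of "ereal s" "ereal t"] by simp
  qed
qed

section \<open>Pathwise energy of the noise and modulus of continuity of the process\<close>

context sheet
begin

text \<open>The interval [-2, 2] contains the support of the cutoff, outside which the process
  vanishes.\<close>

definition noise_energy :: "nat \<Rightarrow> int \<Rightarrow> 'a \<Rightarrow> real" where
  "noise_energy n k \<omega> = integral {-2..2} (\<lambda>r. (cmod (noise_coeff n \<omega> k r))\<^sup>2)"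

lemma noise_energy_nonneg: "0 \<le> noise_energy n k \<omega>"
  unfolding noise_energy_def by (cases "(\<lambda>r. (cmod (noise_coeff n \<omega> k r))\<^sup>2) integrable_on {-2..2}")
   (auto intro: Henstock_Kurzweil_Integration.integral_nonneg simp: not_integrable_integral)

lemma noise_coeff_measurable:
  assumes "n \<ge> 1" shows "(\<lambda>\<omega>. noise_coeff n \<omega> k r) \<in> borel_measurable M"
  by (rule borel_measurable_AE_eq[OF W_measurable[OF noise_coeff_W(1)[OF assms, of k r]]])
     (use noise_coeff_W(2)[OF assms, of k r] in \<open>auto elim!: eventually_mono\<close>)

text \<open>Bounding \<open>window\<close> by 1 leaves the envelope; since 2 - 2 H \<le> 2, its two
  factors contribute at most 2^(4n) and 2^(2n).\<close>

lemma sq_norm_noise_kernel_le: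
  "\<exists>C\<ge>0. \<forall>n\<ge>1. \<forall>k r. sq_norm (noise_kernel c H0 H1 n k r) \<le> C * 2 ^ (6 * n)"
proof -
  define C where "C = c\<^sup>2 * (2 / (2 - 2 * H0) * (2 / (2 - 2 * H1)))"
  have "sq_norm (noise_kernel c H0 H1 n k r) \<le> C * 2 ^ (6 * n)" if n: "n \<ge> 1" for n k r
  proof -
    let ?g = "amp_weight H0 H1 n"
    have "ennreal (sq_norm (noise_kernel c H0 H1 n k r))
      = (\<integral>\<^sup>+z. ennreal ((cmod (noise_kernel c H0 H1 n k r z))\<^sup>2) \<partial>lborel)"
      unfolding sq_norm_def using noise_coeff_W(1)[OF n, of k r]
        by (intro nn_integral_eq_integral[symmetric]) (auto simp: square_integrable_def)
    also have "\<dots> \<le> (\<integral>\<^sup>+z. ennreal (c\<^sup>2) * ennreal ((?g z)\<^sup>2) \<partial>lborel)"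
    proof (rule nn_integral_mono)
      fix z :: "real \<times> real"
      obtain \<xi> \<eta> where z: "z = (\<xi>, \<eta>)" by (cases z)
      have g0: "0 \<le> ?g z" by (simp add: z amp_weight_def)
      have "cmod (noise_kernel c H0 H1 n k r z) = (c * ?g z) * cmod (window k \<eta>)"
        using c_pos unfolding z by (auto simp: norm_mult norm_amp amp_weight_def indicator_def
          noise_kernel_def)
      also have "\<dots> \<le> (c * ?g z) * 1" using c_pos g0 norm_window_le_1 by (intro mult_left_mono) auto
      finally have "(cmod (noise_kernel c H0 H1 n k r z))\<^sup>2 \<le> (c * ?g z)\<^sup>2" by (intro power_mono)
        auto
      then show "ennreal ((cmod (noise_kernel c H0 H1 n k r z))\<^sup>2) \<le> ennreal (c\<^sup>2) * ennreal
        ((?g z)\<^sup>2)"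
        by (simp add: ennreal_mult[symmetric] power_mult_distrib ennreal_leI)
    qed
    also have "\<dots> = ennreal (c\<^sup>2) * (\<integral>\<^sup>+z. ennreal ((?g z)\<^sup>2) \<partial>lborel)" by (rule nn_integral_cmult)
      simp
    also have "\<dots> \<le> ennreal (c\<^sup>2) * (ennreal (2 * (2 ^ (2 * n)) powr (2 - 2 * H0) / (2 - 2 * H0)) *
      ennreal (2 * (2 ^ n) powr (2 - 2 * H1) / (2 - 2 * H1)))"
      by (intro mult_left_mono amp_weight_nn_integral H) simp
    also have "\<dots> = ennreal (c\<^sup>2 * ((2 * (2 ^ (2 * n)) powr (2 - 2 * H0) / (2 - 2 * H0)) *
      (2 * (2 ^ n) powr (2 - 2 * H1) / (2 - 2 * H1))))"
      using H by (subst ennreal_mult[symmetric], simp, simp, subst ennreal_mult[symmetric]) auto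
    finally have "sq_norm (noise_kernel c H0 H1 n k r) \<le> c\<^sup>2 * ((2 * (2 ^ (2 * n)) powr (2 - 2 * H0)
      / (2 - 2 * H0)) * (2 * (2 ^ n) powr (2 - 2 * H1) / (2 - 2 * H1)))"
      using H by (subst (asm) ennreal_le_iff) auto
    also have "\<dots> = C * ((2 ^ (2 * n)) powr (2 - 2 * H0) * (2 ^ n) powr (2 - 2 * H1))"
      by (simp add: C_def)
    also have "\<dots> \<le> C * ((2 ^ (2 * n)) powr 2 * (2 ^ n) powr 2)"
      using H by (intro mult_left_mono mult_mono powr_mono) (auto simp: C_def)
    also have "(2 ^ (2 * n)) powr 2 * (2 ^ n) powr 2 = (2 :: real) ^ (6 * n)"
      by (simp add: powr_numeral power_mult[symmetric] power_add[symmetric])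
    finally show ?thesis .
  qed
  moreover have "C \<ge> 0" using H by (simp add: C_def)
  ultimately show ?thesis by blast
qed

text \<open>Tonelli's theorem is applied to a jointly measurable version; the factor 4 is the length
  of [-2, 2]. Exponential growth in \<open>n\<close> is acceptable because the grid will be
  exponentially fine.\<close>

lemma noise_energy_expectation:
  "\<exists>C\<ge>0. \<forall>n\<ge>1. \<forall>k. noise_energy n k \<in> borel_measurable M \<and> (\<integral>\<^sup>+\<omega>. ennreal (noise_energy n k \<omega>) \<partial>M)
    \<le> ennreal (C * 2 ^ (6 * n))"
proof -
  obtain C where C: "C \<ge> 0" "\<And>n k r. n \<ge> 1 \<Longrightarrow> sq_norm (noise_kernel c H0 H1 n k r) \<le> C * 2 ^ (6 * n)"
    using sq_norm_noise_kernel_le by blast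
  interpret P: pair_sigma_finite M lborel ..
  have "noise_energy n k \<in> borel_measurable M \<and> (\<integral>\<^sup>+\<omega>. ennreal (noise_energy n k \<omega>) \<partial>M)
    \<le> ennreal ((4 * C) * 2 ^ (6 * n))" if n: "n \<ge> 1" for n k
  proof -
    have cae: "AE \<omega> in M. continuous_on UNIV (noise_coeff n \<omega> k)" using noise_coeff_continuous[OF n]
      by eventually_elim blast
    obtain Z where Z: "(\<lambda>(\<omega>, r). Z \<omega> r) \<in> borel_measurable (M \<Otimes>\<^sub>M lborel)" "AE \<omega> in M. Z \<omega>
      = noise_coeff n \<omega> k"
      using caratheodory_version[of "\<lambda>\<omega>. noise_coeff n \<omega> k", OF noise_coeff_measurable[OF n] cae]
        by blast
    note [measurable] = Z(1)
    let ?E = "\<lambda>\<omega>. \<integral>\<^sup>+r. ennreal ((cmod (Z \<omega> r))\<^sup>2) * indicator {-2..2} r \<partial>lborel"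
    have E: "?E \<in> borel_measurable M" by measurable
    have ae: "AE \<omega> in M. ennreal (noise_energy n k \<omega>) = ?E \<omega>"
      using cae Z(2)
    proof eventually_elim
      case (elim \<omega>)
      have "(\<lambda>r. (cmod (noise_coeff n \<omega> k r))\<^sup>2) integrable_on {-2..2}"
        by (intro integrable_continuous_real continuous_intros continuous_on_subset[OF elim(1)])
          simp
      then show ?case unfolding noise_energy_def elim(2)
        by (intro nn_integral_has_integral_lebesgue'[symmetric]) (auto simp: has_integral_integral)
    qed
    have "(\<lambda>\<omega>. enn2real (?E \<omega>)) \<in> borel_measurable M" using E by measurable
    moreover have "AE \<omega> in M. enn2real (?E \<omega>) = noise_energy n k \<omega>"
      using ae by eventually_elim (metis enn2real_ennreal noise_energy_nonneg)
    ultimately have m: "noise_energy n k \<in> borel_measurable M" by (rule borel_measurable_AE_eq)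
    have "(\<integral>\<^sup>+\<omega>. ennreal (noise_energy n k \<omega>) \<partial>M) = (\<integral>\<^sup>+\<omega>. ?E \<omega> \<partial>M)"
      by (rule nn_integral_cong_AE[OF ae])
    also have "\<dots> = (\<integral>\<^sup>+r. (\<integral>\<^sup>+\<omega>. ennreal ((cmod (Z \<omega> r))\<^sup>2) * indicator {-2..2} r \<partial>M) \<partial>lborel)"
      by (rule P.Fubini'[symmetric]) measurable
    also have "\<dots> \<le> (\<integral>\<^sup>+r. ennreal (C * 2 ^ (6 * n)) * indicator {-2..2::real} r \<partial>lborel)"
    proof (rule nn_integral_mono)
      fix r :: real
      have "(\<integral>\<^sup>+\<omega>. ennreal ((cmod (Z \<omega> r))\<^sup>2) \<partial>M)
        = (\<integral>\<^sup>+\<omega>. ennreal ((cmod (W (noise_kernel c H0 H1 n k r) \<omega>))\<^sup>2) \<partial>M)"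
        by (rule nn_integral_cong_AE) (use Z(2) noise_coeff_W(2)[OF n, of k r] in \<open>eventually_elim,
          simp\<close>)
      also have "\<dots> = ennreal (sq_norm (noise_kernel c H0 H1 n k r))"
        by (rule W_nn_isometry[OF noise_coeff_W(1)[OF n]])
      also have "\<dots> \<le> ennreal (C * 2 ^ (6 * n))" by (intro ennreal_leI C n)
      finally show "(\<integral>\<^sup>+\<omega>. ennreal ((cmod (Z \<omega> r))\<^sup>2) * indicator {-2..2} r \<partial>M)
        \<le> ennreal (C * 2 ^ (6 * n)) * indicator {-2..2::real} r"
        by (auto simp: indicator_def)
    qed
    also have "\<dots> = ennreal (C * 2 ^ (6 * n)) * 4" by (simp add: nn_integral_cmult)
    also have "\<dots> = ennreal ((4 * C) * 2 ^ (6 * n))"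
      using C(1) by (subst ennreal_numeral[symmetric], subst ennreal_mult[symmetric])
        (auto simp: mult_ac)
    finally show ?thesis using m by blast
  qed
  then show ?thesis using C(1) by (intro exI[of _ "4 * C"]) auto
qed

text \<open>The value 0 at level 0 matches the empty \<open>band 0\<close>, so kernels and paths
  agree at every level.\<close>

definition PsiN :: "nat \<Rightarrow> 'a \<Rightarrow> real \<Rightarrow> int \<Rightarrow> complex" where
  "PsiN n \<omega> t k = (if n = 0 then 0 else Psi chi (B n \<omega>) t k)"

lemma PsiN_W: "AE \<omega> in M. PsiN n \<omega> t k = W (psi_kernel c H0 H1 chi n k t) \<omega>"
  using psi_W(2)[of n t k] W_zero by (cases "n = 0") (auto simp: PsiN_def psi_kernel_0 elim!:
    eventually_mono)

lemma PsiN_measurable [measurable]: "(\<lambda>\<omega>. PsiN n \<omega> t k) \<in> borel_measurable M"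
  by (rule borel_measurable_AE_eq[OF W_measurable[OF psi_kernel_square_integrable[of n k t]]])
     (use PsiN_W[of n t k] in \<open>auto elim!: eventually_mono\<close>)

lemma PsiN_outside: "2 \<le> \<bar>t\<bar> \<Longrightarrow> PsiN n \<omega> t k = 0"
  using chi_bounds(3)[of t] by (simp add: PsiN_def Psi_def)

definition path_energy :: "nat \<Rightarrow> int \<Rightarrow> 'a \<Rightarrow> real" where
  "path_energy n k \<omega> = (if n = 0 then 0 else noise_energy n k \<omega>)"

text \<open>The bounds are deterministic on the event where the noise coefficients are continuous.
  The free parameter \<open>l\<close> trades an absolute value for a square; it is later taken to be
  the square root of the number of grid intervals.\<close>

lemma PsiN_path:
  assumes lip: "L-lipschitz_on {-2..2} chi"
  shows "AE \<omega> in M. \<forall>k. continuous_on UNIV (\<lambda>t. PsiN n \<omega> t k) \<and>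
    (\<forall>s t. \<forall>l>0. \<bar>s\<bar> \<le> 2 \<longrightarrow> \<bar>t\<bar> \<le> 2 \<longrightarrow> cmod (PsiN n \<omega> t k) \<le> 2 + path_energy n k \<omega> \<and>
       cmod (PsiN n \<omega> t k - PsiN n \<omega> s k) \<le> L * \<bar>t - s\<bar> * (2 + path_energy n k \<omega>) + l * \<bar>t - s\<bar>
         + path_energy n k \<omega> / l)"
proof (cases "n = 0")
  case True then show ?thesis using lipschitz_on_nonneg[OF lip]
    by (auto simp: PsiN_def path_energy_def)
next
  case False
  then have n: "n \<ge> 1" by simp
  have L: "0 \<le> L" "\<bar>chi t - chi s\<bar> \<le> L * \<bar>t - s\<bar>" if "\<bar>s\<bar> \<le> 2" "\<bar>t\<bar> \<le> 2" for s t
    using lipschitz_onD[OF lip, of t s] lipschitz_on_nonneg[OF lip] that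
      by (auto simp: dist_real_def abs_le_iff)
  have abs_chi: "\<bar>chi r\<bar> \<le> 1" for r using chi_bounds[of r] by simp
  have gen: "cmod (- \<i> * (of_real a * X) - \<i> * (of_real b * Y)) \<le> \<bar>a\<bar> * cmod X + \<bar>b\<bar> * cmod Y" for a
    b X Y
    using norm_triangle_ineq4[of "- \<i> * (of_real a * X)" "\<i> * (of_real b * Y)"]
      by (simp add: norm_mult)
  show ?thesis using noise_coeff_continuous[OF n]
  proof eventually_elim
    case (elim \<omega>)
    show ?case
    proof (intro allI conjI impI)
      fix k
      let ?b = "noise_coeff n \<omega> k"
      let ?f = "\<lambda>r. complex_of_real (chi r) * cis (- (r * (real_of_int k)\<^sup>2)) * ?b r"
      let ?J = "\<lambda>t. LBINT r=ereal 0..ereal t. ?f r"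
      have b: "continuous_on UNIV ?b" using elim by blast
      have f: "continuous_on UNIV ?f" by (intro continuous_intros continuous_on_of_real
        chi_continuous b)
      have fb: "cmod (?f r) \<le> cmod (?b r)" for r
      proof -
        have "cmod (?f r) = \<bar>chi r\<bar> * cmod (?b r)" by (simp add: norm_mult)
        also have "\<dots> \<le> 1 * cmod (?b r)" using chi_bounds[of r] by (intro mult_right_mono) auto
        finally show ?thesis by simp
      qed
      have P: "PsiN n \<omega> t k = - \<i> * of_real (chi t) * ?J t" for t
        using False by (simp add: PsiN_def Psi_def noise_coeff_def[symmetric] zero_ereal_def)
      have E: "path_energy n k \<omega> = integral {-2..2} (\<lambda>r. (cmod (?b r))\<^sup>2)"
        using False by (simp add: path_energy_def noise_energy_def)
      have Jc: "continuous_on {-T..T} ?J" if "T > 0" for T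
      proof -
        have "(?J has_vector_derivative ?f x) (at x within {-T..T})" if "x \<in> {-T..T}" for x
          by (rule interval_integral_FTC2) (use \<open>T > 0\<close> that in \<open>auto intro: continuous_on_subset[OF
            f]\<close>)
        then show ?thesis
          by (intro continuous_on_eq_continuous_within[THEN iffD2] ballI)
            (rule has_vector_derivative_continuous)
      qed
      have "isCont ?J t" for t
      proof -
        have "t \<in> {-(\<bar>t\<bar>+1)<..<\<bar>t\<bar>+1}" by auto
        then have "t \<in> interior {-(\<bar>t\<bar>+1)..\<bar>t\<bar>+1}" by (simp add: interior_atLeastAtMost_real)
        then show ?thesis by (rule continuous_on_interior[OF Jc, rotated]) auto
      qed
      then have "continuous_on UNIV ?J" by (simp add: continuous_on_eq_continuous_at)
      then show "continuous_on UNIV (\<lambda>t. PsiN n \<omega> t k)"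
        unfolding P by (intro continuous_intros continuous_on_of_real chi_continuous)
      fix s t l :: real assume l: "l > 0" and s: "\<bar>s\<bar> \<le> 2" and t: "\<bar>t\<bar> \<le> 2"
      have J: "cmod (?J t) \<le> 2 + path_energy n k \<omega>"
        using interval_integral_le_square[OF b f fb, of 1 0 t] t unfolding E by simp
      have "cmod (PsiN n \<omega> t k) = \<bar>chi t\<bar> * cmod (?J t)" by (simp add: P norm_mult)
      also have "\<dots> \<le> 1 * cmod (?J t)" using chi_bounds[of t] by (intro mult_right_mono) auto
      finally show "cmod (PsiN n \<omega> t k) \<le> 2 + path_energy n k \<omega>" using J by simp
      have Jd: "?J t - ?J s = (LBINT r=ereal s..ereal t. ?f r)"
      proof -
        have "(LBINT r=ereal 0..ereal s. ?f r) + (LBINT r=ereal s..ereal t. ?f r)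
          = (LBINT r=ereal 0..ereal t. ?f r)"
        proof (rule interval_integral_sum)
          show "interval_lebesgue_integrable lborel (min (ereal 0) (min (ereal s) (ereal t)))
            (max (ereal 0) (max (ereal s) (ereal t))) ?f"
            unfolding ereal_min[symmetric] ereal_max[symmetric]
            by (rule interval_integrable_isCont)
              (use f in \<open>simp add: continuous_on_eq_continuous_at\<close>)
        qed
        then show ?thesis by (simp add: algebra_simps)
      qed
      \<comment> \<open>Product rule for increments: the cutoff moves at its Lipschitz rate, the
        integral by its part between \<open>s\<close> and \<open>t\<close>.\<close>
      have eq: "PsiN n \<omega> t k - PsiN n \<omega> s k = - \<i> * (of_real (chi t - chi s) * ?J t) - \<i> *
        (of_real (chi s) * (?J t - ?J s))"
        unfolding P by (simp add: algebra_simps)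
      have "cmod (PsiN n \<omega> t k - PsiN n \<omega> s k) \<le> \<bar>chi t - chi s\<bar> * cmod (?J t)
        + \<bar>chi s\<bar> * cmod (?J t - ?J s)"
        unfolding eq by (rule gen)
      also have "\<dots> \<le> (L * \<bar>t - s\<bar>) * (2 + path_energy n k \<omega>) + 1 * (l * \<bar>t - s\<bar> + path_energy n k \<omega>
        / l)"
      proof (rule add_mono)
        show "\<bar>chi t - chi s\<bar> * cmod (?J t) \<le> (L * \<bar>t - s\<bar>) * (2 + path_energy n k \<omega>)"
          by (rule mult_mono[OF L(2)[OF s t] J _ norm_ge_zero]) (simp add: lipschitz_on_nonneg[OF
            lip])
        have "cmod (?J t - ?J s) \<le> l * \<bar>t - s\<bar> + path_energy n k \<omega> / l"
          unfolding Jd E by (rule interval_integral_le_square[OF b f fb l s t])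
        then show "\<bar>chi s\<bar> * cmod (?J t - ?J s) \<le> 1 * (l * \<bar>t - s\<bar> + path_energy n k \<omega> / l)"
          by (rule mult_mono[rotated]) (rule zero_le_one, rule norm_ge_zero, rule abs_chi)
      qed
      finally show "cmod (PsiN n \<omega> t k - PsiN n \<omega> s k) \<le> L * \<bar>t - s\<bar> * (2 + path_energy n k \<omega>)
        + l * \<bar>t - s\<bar> + path_energy n k \<omega> / l"
        by simp
    qed
  qed
qed

end

section \<open>Uniform bounds\<close>

lemma grid_point:
  fixes a len t :: real and m :: nat
  assumes "a \<le> t" "t \<le> a + len" "0 < len" "0 < m"
  shows "\<exists>i\<le>m. \<bar>t - (a + len * real i / real m)\<bar> \<le> len / real m"
proof -
  define y where "y = (t - a) * real m / len"
  have y: "0 \<le> y" "y \<le> real m" using assms by (auto simp: y_def divide_le_eq mult.commute intro!: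
    mult_right_mono)
  define i where "i = nat \<lfloor>y\<rfloor>"
  have i: "real i \<le> y" "y \<le> real i + 1" using y(1) unfolding i_def by linarith+
  have "i \<le> m" using i(1) y(2) by linarith
  moreover have "t - (a + len * real i / real m) = (y - real i) * (len / real m)"
    using assms by (simp add: y_def field_simps)
  then have "\<bar>t - (a + len * real i / real m)\<bar> = \<bar>y - real i\<bar> * (len / real m)" using assms
    by (simp add: abs_mult)
  then have "\<bar>t - (a + len * real i / real m)\<bar> \<le> 1 * (len / real m)"
    using i assms by (simp only:) (intro mult_right_mono, auto)
  ultimately show ?thesis by auto
qed

text \<open>Either a \<le> \<epsilon>, or a / \<epsilon> exceeds 1 and a power only enlarges it.
  Used at grid points, it replaces a maximum by \<epsilon> plus a sum of moments.\<close>

lemma le_eps_plus_power: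
  fixes a \<epsilon> :: real
  assumes "0 \<le> a" "0 < \<epsilon>" "\<epsilon> \<le> 1" "1 \<le> p"
  shows "a \<le> \<epsilon> + (a / \<epsilon>) ^ (2 * p)"
proof (cases "a \<le> \<epsilon>")
  case True
  moreover have "0 \<le> (a / \<epsilon>) ^ (2 * p)" using assms by simp
  ultimately show ?thesis by linarith
next
  case False
  then have 1: "1 \<le> a / \<epsilon>" using assms by simp
  have "a \<le> a / \<epsilon>" using assms by (simp add: le_divide_eq mult_left_le)
  also have "\<dots> \<le> (a / \<epsilon>) ^ (2 * p)" using 1 assms(4) self_le_power[OF 1, of "2 * p"] by simp
  finally show ?thesis using assms by linarith
qed

lemma cis_2pi_periodic: "cis (real_of_int k * (x + 2 * pi * real_of_int q))
  = cis (real_of_int k * x)"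
proof -
  have "real_of_int k * (x + 2 * pi * real_of_int q) = real_of_int k * x + 2 * pi * real_of_int
    (k * q)" by (simp add: algebra_simps)
  then show ?thesis by (simp only: cis_mult[symmetric] cis_multiple_2pi[OF Ints_of_int]) simp
qed

text \<open>A double series of nonnegative variables with finite expectation is almost surely
  finite, which gives inner and outer summability together.\<close>

lemma AE_summable_double:
  fixes U :: "nat \<Rightarrow> nat \<Rightarrow> 'a \<Rightarrow> real"
  assumes m [measurable]: "\<And>n j. U n j \<in> borel_measurable M" and nn: "\<And>n j \<omega>. 0 \<le> U n j \<omega>"
    and C: "0 \<le> C" and r: "0 \<le> r" "r < 1"
    and le: "\<And>n j. (\<integral>\<^sup>+\<omega>. ennreal (U n j \<omega>) \<partial>M) \<le> ennreal (C * r ^ (n + j))"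
  shows "AE \<omega> in M. (\<forall>n. summable (\<lambda>j. U n j \<omega>)) \<and> summable (\<lambda>n. \<Sum>j. U n j \<omega>)"
proof -
  have g: "summable (\<lambda>i. r ^ i)" using r by (simp add: summable_geometric)
  have "(\<integral>\<^sup>+\<omega>. (\<Sum>n. \<Sum>j. ennreal (U n j \<omega>)) \<partial>M) = (\<Sum>n. \<Sum>j. \<integral>\<^sup>+\<omega>. ennreal (U n j \<omega>) \<partial>M)"
    by (simp add: nn_integral_suminf)
  also have "\<dots> \<le> (\<Sum>n. \<Sum>j. ennreal (C * r ^ (n + j)))"
    by (intro suminf_le le) auto
  also have "\<dots> = (\<Sum>n. ennreal (C * r ^ n * (\<Sum>j. r ^ j)))"
  proof (intro suminf_cong)
    fix n
    have "(\<Sum>j. ennreal (C * r ^ (n + j))) = (\<Sum>j. ennreal (C * r ^ n * r ^ j))"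
      by (simp add: power_add mult_ac)
    also have "\<dots> = ennreal (\<Sum>j. C * r ^ n * r ^ j)"
      using C r g by (intro suminf_ennreal2) (auto intro: summable_mult)
    finally show "(\<Sum>j. ennreal (C * r ^ (n + j))) = ennreal (C * r ^ n * (\<Sum>j. r ^ j))"
      by (simp add: suminf_mult[OF g])
  qed
  also have "\<dots> = ennreal (\<Sum>n. C * r ^ n * (\<Sum>j. r ^ j))"
    using C r g by (intro suminf_ennreal2) (auto intro!: summable_mult summable_mult2
      mult_nonneg_nonneg suminf_nonneg)
  finally have "(\<integral>\<^sup>+\<omega>. (\<Sum>n. \<Sum>j. ennreal (U n j \<omega>)) \<partial>M) \<noteq> \<infinity>" by (auto simp: top_unique)
  then have "AE \<omega> in M. (\<Sum>n. \<Sum>j. ennreal (U n j \<omega>)) \<noteq> \<infinity>"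
    by (intro nn_integral_PInf_AE) auto
  then show ?thesis
  proof eventually_elim
    case (elim \<omega>)
    have 1: "summable (\<lambda>j. U n j \<omega>)" for n
    proof (rule summable_suminf_not_top[OF nn])
      have "(\<Sum>j. ennreal (U n j \<omega>)) \<le> (\<Sum>n. \<Sum>j. ennreal (U n j \<omega>))"
        using sum_le_suminf[of "\<lambda>n. \<Sum>j. ennreal (U n j \<omega>)" "{n}"] by simp
      then show "(\<Sum>j. ennreal (U n j \<omega>)) \<noteq> top" using elim by (auto simp: top_unique)
    qed
    have e: "(\<Sum>j. ennreal (U n j \<omega>)) = ennreal (\<Sum>j. U n j \<omega>)" for n
      by (rule suminf_ennreal2[OF nn 1])
    have "summable (\<lambda>n. \<Sum>j. U n j \<omega>)"
      by (rule summable_suminf_not_top) (use elim e suminf_nonneg[OF 1 nn] in auto)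
    then show ?case using 1 by blast
  qed
qed

section \<open>From grid points to uniform bounds on blocks\<close>

context sheet
begin

definition block_field :: "real \<Rightarrow> nat \<Rightarrow> nat \<Rightarrow> 'a \<Rightarrow> real \<Rightarrow> real \<Rightarrow> complex" where
  "block_field \<alpha> n j \<omega> t x = (\<Sum>k\<in>block j. character \<alpha> x k * (PsiN (Suc n) \<omega> t k - PsiN n \<omega> t k))"

lemma block_field_measurable [measurable]: "(\<lambda>\<omega>. block_field \<alpha> n j \<omega> t x) \<in> borel_measurable M"
  unfolding block_field_def by measurable

lemma block_field_W: "AE \<omega> in M. block_field \<alpha> n j \<omega> t x = W (psi_increment n t (block j)
  (character \<alpha> x)) \<omega>"
proof -
  let ?f = "\<lambda>k z. psi_kernel c H0 H1 chi (Suc n) k t z - psi_kernel c H0 H1 chi n k t z"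
  have f: "?f k \<in> square_integrable" for k
    using square_integrable_lin[OF psi_kernel_square_integrable[of "Suc n" k t]
      psi_kernel_square_integrable[of n k t], of 1 "-1"] by simp
  have "AE \<omega> in M. W (psi_increment n t (block j) (character \<alpha> x)) \<omega>
    = (\<Sum>k\<in>block j. character \<alpha> x k * W (?f k) \<omega>)"
    unfolding psi_increment_def by (rule W_sum) (auto simp: f)
  moreover have "AE \<omega> in M. \<forall>k\<in>block j. PsiN (Suc n) \<omega> t k - PsiN n \<omega> t k = W (?f k) \<omega>"
  proof (rule AE_finite_allI)
    fix k
    show "AE \<omega> in M. PsiN (Suc n) \<omega> t k - PsiN n \<omega> t k = W (?f k) \<omega>"
      using PsiN_W[of "Suc n" t k] PsiN_W[of n t k] W_diff[OF psi_kernel_square_integrable[of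
        "Suc n" k t] psi_kernel_square_integrable[of n k t]]
      by eventually_elim simp
  qed simp
  ultimately show ?thesis by eventually_elim (simp add: block_field_def)
qed

lemma block_field_moment:
  assumes "1 \<le> p"
  shows "(\<integral>\<^sup>+\<omega>. ennreal (cmod (block_field \<alpha> n j \<omega> t x) ^ (2 * p)) \<partial>M) \<le>
    ennreal (moment_const p * sq_norm (psi_increment n t (block j) (character \<alpha> x)) ^ p)"
proof -
  have "(\<integral>\<^sup>+\<omega>. ennreal (cmod (block_field \<alpha> n j \<omega> t x) ^ (2 * p)) \<partial>M) =
     (\<integral>\<^sup>+\<omega>. ennreal (cmod (W (psi_increment n t (block j) (character \<alpha> x)) \<omega>) ^ (2 * p)) \<partial>M)"
    by (rule nn_integral_cong_AE) (use block_field_W[of \<alpha> n j t x] in \<open>auto elim!: eventually_mono\<close>)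
  also have "\<dots> \<le> ennreal (moment_const p * sq_norm (psi_increment n t (block j) (character \<alpha> x)) ^
    p)"
    by (rule W_moment[OF psi_increment_square_integrable assms]) simp
  finally show ?thesis .
qed

lemma path_energy_nonneg: "0 \<le> path_energy n k \<omega>"
  by (simp add: path_energy_def noise_energy_nonneg)

definition block_energy :: "nat \<Rightarrow> nat \<Rightarrow> 'a \<Rightarrow> real" where
  "block_energy n j \<omega> = (\<Sum>k\<in>block j. 2 + path_energy (Suc n) k \<omega> + path_energy n k \<omega>)"

text \<open>At distance 8 / l^2 the term l |t - s| and the energy divided by \<open>l\<close> are
  both of order 1/l, and |k| \<le> l makes the variation of the character at most 8/l. The constant
  16 L + 25 adds 16 L + 9 from the time increment and 16 from the character.\<close>

lemma block_field_modulus: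
  assumes \<alpha>: "0 \<le> \<alpha>" and L: "0 \<le> L" and l: "2 ^ Suc j \<le> l"
    and path: "\<And>i k s t l. i \<in> {n, Suc n} \<Longrightarrow> 0 < l \<Longrightarrow> \<bar>s\<bar> \<le> 2 \<Longrightarrow> \<bar>t\<bar> \<le> 2 \<Longrightarrow> cmod (PsiN i \<omega> t k) \<le> 2
      + path_energy i k \<omega> \<and>
       cmod (PsiN i \<omega> t k - PsiN i \<omega> s k) \<le> L * \<bar>t - s\<bar> * (2 + path_energy i k \<omega>) + l * \<bar>t - s\<bar>
         + path_energy i k \<omega> / l"
    and st: "\<bar>s\<bar> \<le> 2" "\<bar>t\<bar> \<le> 2" "\<bar>t - s\<bar> \<le> 8 / l\<^sup>2" and xy: "\<bar>x - y\<bar> \<le> 8 / l\<^sup>2"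
  shows "cmod (block_field \<alpha> n j \<omega> t x - block_field \<alpha> n j \<omega> s y) \<le> (16 * L + 25) / l * block_energy
    n j \<omega>"
proof -
  have l1: "1 \<le> l" using l one_le_power[of "2::real" "Suc j"] by linarith
  have l8: "8 / l\<^sup>2 \<le> 8 / l" using l1 by (simp add: divide_le_eq power2_eq_square)
  have le: "cmod (character \<alpha> x k * (PsiN (Suc n) \<omega> t k - PsiN n \<omega> t k) - character \<alpha> y k *
    (PsiN (Suc n) \<omega> s k - PsiN n \<omega> s k))
    \<le> (16 * L + 25) / l * (2 + path_energy (Suc n) k \<omega> + path_energy n k \<omega>)" if k: "k \<in> block j" for
      k
  proof -
    define S where "S = 2 + path_energy (Suc n) k \<omega> + path_energy n k \<omega>"
    define E1 where "E1 = path_energy (Suc n) k \<omega>"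
    define E0 where "E0 = path_energy n k \<omega>"
    have E: "0 \<le> E1" "0 \<le> E0" by (auto simp: E1_def E0_def path_energy_nonneg)
    have SE: "S = 2 + E1 + E0" by (simp add: S_def E1_def E0_def)
    let ?D = "\<lambda>t. PsiN (Suc n) \<omega> t k - PsiN n \<omega> t k"
    have br: "bracket k powr (-\<alpha>) \<le> 1"
      using powr_mono[of "-\<alpha>" 0 "bracket k"] \<alpha> bracket_ge_1[of k] by simp
    have l0: "0 < l" using l1 by linarith
    have P1: "cmod (PsiN (Suc n) \<omega> t k) \<le> 2 + E1" "cmod (PsiN (Suc n) \<omega> t k - PsiN (Suc n) \<omega> s k)
      \<le> L * \<bar>t - s\<bar> * (2 + E1) + l * \<bar>t - s\<bar> + E1 / l"
      using path[of "Suc n" l s t k] l0 st unfolding E1_def by blast+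
    have P0: "cmod (PsiN n \<omega> t k) \<le> 2 + E0" "cmod (PsiN n \<omega> t k - PsiN n \<omega> s k) \<le> L * \<bar>t - s\<bar> * (2
      + E0) + l * \<bar>t - s\<bar> + E0 / l"
      using path[of n l s t k] l0 st unfolding E0_def by blast+
    have D1: "cmod (?D t) \<le> 2 * S"
    proof -
      have "cmod (?D t) \<le> cmod (PsiN (Suc n) \<omega> t k) + cmod (PsiN n \<omega> t k)"
        by (rule norm_triangle_ineq4)
      also have "\<dots> \<le> (2 + E1) + (2 + E0)" by (intro add_mono P1 P0)
      finally show ?thesis using E SE by linarith
    qed
    have D2: "cmod (?D t - ?D s) \<le> (16 * L + 9) / l * S"
    proof -
      have eq: "?D t - ?D s = (PsiN (Suc n) \<omega> t k - PsiN (Suc n) \<omega> s k) - (PsiN n \<omega> t k - PsiN n \<omega> s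
        k)" by simp
      have "cmod (?D t - ?D s) \<le> cmod (PsiN (Suc n) \<omega> t k - PsiN (Suc n) \<omega> s k)
        + cmod (PsiN n \<omega> t k - PsiN n \<omega> s k)"
        unfolding eq by (rule norm_triangle_ineq4)
      also have "\<dots> \<le> (L * \<bar>t - s\<bar> * (2 + E1) + l * \<bar>t - s\<bar> + E1 / l) + (L * \<bar>t - s\<bar> * (2 + E0)
        + l * \<bar>t - s\<bar> + E0 / l)"
        by (rule add_mono[OF P1(2) P0(2)])
      also have "\<dots> = L * \<bar>t - s\<bar> * (2 + S) + 2 * (l * \<bar>t - s\<bar>) + (S - 2) / l" unfolding SE
        by (simp add: algebra_simps add_divide_distrib)
      also have "\<dots> \<le> L * (8 / l) * (2 * S) + 2 * (8 / l) + S / l"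
      proof (intro add_mono)
        show "L * \<bar>t - s\<bar> * (2 + S) \<le> L * (8 / l) * (2 * S)"
          using st(3) l8 l0 L E SE by (intro mult_mono mult_left_mono) auto
        have "l * \<bar>t - s\<bar> \<le> l * (8 / l\<^sup>2)" using st(3) l0 by (intro mult_left_mono) auto
        then show "2 * (l * \<bar>t - s\<bar>) \<le> 2 * (8 / l)" using l0 by (simp add: power2_eq_square)
        show "(S - 2) / l \<le> S / l" using l0 by (simp add: divide_right_mono)
      qed
      also have "\<dots> = (16 * L * S + 16 + S) / l" by (simp add: add_divide_distrib)
      also have "\<dots> \<le> ((16 * L + 9) * S) / l" using l0 E SE by (intro divide_right_mono)
        (auto simp: algebra_simps)
      finally show ?thesis by simp
    qed
    have ch: "cmod (character \<alpha> x k - character \<alpha> y k) \<le> 8 / l"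
    proof -
      have "character \<alpha> x k - character \<alpha> y k = of_real (bracket k powr (-\<alpha>)) *
        (cis (real_of_int k * x) - cis (real_of_int k * y))"
        by (simp add: character_def algebra_simps)
      then have "cmod (character \<alpha> x k - character \<alpha> y k) = bracket k powr (-\<alpha>) * cmod
        (cis (real_of_int k * x) - cis (real_of_int k * y))" by (simp add: norm_mult)
      also have "\<dots> \<le> 1 * \<bar>real_of_int k * x - real_of_int k * y\<bar>"
        by (intro mult_mono br cmod_cis_diff_le) auto
      also have "\<dots> = \<bar>real_of_int k\<bar> * \<bar>x - y\<bar>" by (simp add: right_diff_distrib[symmetric]
        abs_mult)
      also have "\<dots> \<le> l * (8 / l\<^sup>2)"
      proof (intro mult_mono xy)
        have "\<bar>k\<bar> < 2 ^ Suc j" using k by (simp add: block_def)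
        then have "real_of_int \<bar>k\<bar> < real_of_int (2 ^ Suc j)" by (simp only: of_int_less_iff)
        then show "\<bar>real_of_int k\<bar> \<le> l" using l by simp
      qed (use l0 in auto)
      also have "\<dots> = 8 / l" using l0 by (simp add: power2_eq_square)
      finally show ?thesis .
    qed
    have eq: "character \<alpha> x k * ?D t - character \<alpha> y k * ?D s = (character \<alpha> x k - character \<alpha> y k)
      * ?D t + character \<alpha> y k * (?D t - ?D s)"
      by (simp add: algebra_simps)
    have "cmod (character \<alpha> x k * ?D t - character \<alpha> y k * ?D s) \<le> cmod (character \<alpha> x k - character
      \<alpha> y k) * cmod (?D t) + cmod (character \<alpha> y k) * cmod (?D t - ?D s)"
      unfolding eq norm_mult[symmetric] by (rule norm_triangle_ineq)
    also have "\<dots> \<le> 8 / l * (2 * S) + 1 * ((16 * L + 9) / l * S)"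
      using br L l0 by (intro add_mono mult_mono ch D1 D2) (auto simp: norm_character)
    also have "\<dots> = (16 * L + 25) / l * S" using l0 by (simp add: field_simps)
    finally show ?thesis unfolding S_def .
  qed
  have "cmod (block_field \<alpha> n j \<omega> t x - block_field \<alpha> n j \<omega> s y) \<le> (\<Sum>k\<in>block j. (16 * L + 25) / l *
    (2 + path_energy (Suc n) k \<omega> + path_energy n k \<omega>))"
    unfolding block_field_def sum_subtractf[symmetric] by (rule order_trans[OF norm_sum])
      (intro sum_mono le)
  then show ?thesis by (simp only: block_energy_def sum_distrib_left)
qed

lemma path_energy_expectation:
  "\<exists>C\<ge>0. \<forall>n k. path_energy n k \<in> borel_measurable M \<and> (\<integral>\<^sup>+\<omega>. ennreal (path_energy n k \<omega>) \<partial>M)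
    \<le> ennreal (C * 2 ^ (6 * n))"
proof -
  obtain C where C: "C \<ge> 0" "\<And>n k. n \<ge> 1 \<Longrightarrow> noise_energy n k \<in> borel_measurable M
    \<and> (\<integral>\<^sup>+\<omega>. ennreal (noise_energy n k \<omega>) \<partial>M) \<le> ennreal (C * 2 ^ (6 * n))"
    using noise_energy_expectation by blast
  have "path_energy n k \<in> borel_measurable M \<and> (\<integral>\<^sup>+\<omega>. ennreal (path_energy n k \<omega>) \<partial>M)
    \<le> ennreal (C * 2 ^ (6 * n))" for n k
  proof (cases "n = 0")
    case True
    then have "path_energy n k = (\<lambda>_. 0)" by (auto simp: path_energy_def)
    then show ?thesis by simp
  next
    case False
    then have "path_energy n k = noise_energy n k" by (auto simp: path_energy_def)
    then show ?thesis using C(2)[of n k] False by simp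
  qed
  then show ?thesis using C(1) by blast
qed

text \<open>The factor 65 = 2^6 + 1 adds the levels n + 1 and n. A block has at most 2^(j+2)
  frequencies, and j + 6 n \<le> 7 (n + j).\<close>

lemma block_energy_expectation:
  "\<exists>C\<ge>0. \<forall>n j. block_energy n j \<in> borel_measurable M \<and> (\<integral>\<^sup>+\<omega>. ennreal (block_energy n j \<omega>) \<partial>M)
    \<le> ennreal (C * 2 ^ (7 * (n + j)))"
proof -
  obtain C where C: "C \<ge> 0" "\<And>n k. path_energy n k \<in> borel_measurable M"
    "\<And>n k. (\<integral>\<^sup>+\<omega>. ennreal (path_energy n k \<omega>) \<partial>M) \<le> ennreal (C * 2 ^ (6 * n))"
    using path_energy_expectation by blast
  note [measurable] = C(2)
  have "block_energy n j \<in> borel_measurable M \<and> (\<integral>\<^sup>+\<omega>. ennreal (block_energy n j \<omega>) \<partial>M)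
    \<le> ennreal ((4 * (2 + 65 * C)) * 2 ^ (7 * (n + j)))" for n j
  proof
    show "block_energy n j \<in> borel_measurable M" unfolding block_energy_def[abs_def] by measurable
    have "(\<integral>\<^sup>+\<omega>. ennreal (block_energy n j \<omega>) \<partial>M)
      = (\<integral>\<^sup>+\<omega>. (\<Sum>k\<in>block j. (2 + ennreal (path_energy (Suc n) k \<omega>)) + ennreal (path_energy n k \<omega>))
      \<partial>M)"
      unfolding block_energy_def
      by (intro nn_integral_cong) (simp add: sum_ennreal[symmetric] path_energy_nonneg
        add_nonneg_nonneg ennreal_plus del: sum_ennreal)
    also have "\<dots> = (\<Sum>k\<in>block j. (2 + (\<integral>\<^sup>+\<omega>. ennreal (path_energy (Suc n) k \<omega>) \<partial>M))
      + (\<integral>\<^sup>+\<omega>. ennreal (path_energy n k \<omega>) \<partial>M))"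
      by (simp add: nn_integral_sum nn_integral_add emeasure_space_1)
    also have "\<dots> \<le> (\<Sum>k\<in>block j. (2 + ennreal (C * 2 ^ (6 * Suc n))) + ennreal (C * 2 ^ (6 * n)))"
      by (intro sum_mono add_mono C(3) order_refl)
    also have "\<dots> = (\<Sum>k\<in>block j. ennreal (2 + C * 2 ^ (6 * Suc n) + C * 2 ^ (6 * n)))"
      using C(1) by (simp add: ennreal_plus)
    also have "\<dots> = ennreal (real (card (block j)) * (2 + C * 2 ^ (6 * Suc n) + C * 2 ^ (6 * n)))"
      using C(1) by (subst sum_ennreal) auto
    also have "\<dots> \<le> ennreal ((4 * (2 + 65 * C)) * 2 ^ (7 * (n + j)))"
    proof (rule ennreal_leI)
      have p: "(1::real) \<le> 2 ^ (6 * n)" by simp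
      have "2 + C * 2 ^ (6 * Suc n) + C * 2 ^ (6 * n) = 2 + 65 * C * 2 ^ (6 * n)"
        by (simp add: power_add algebra_simps)
      also have "\<dots> \<le> (2 + 65 * C) * 2 ^ (6 * n)" using p by (simp add: algebra_simps)
      finally have "real (card (block j)) * (2 + C * 2 ^ (6 * Suc n) + C * 2 ^ (6 * n))
        \<le> 2 ^ (j + 2) * ((2 + 65 * C) * 2 ^ (6 * n))"
        using C(1) by (intro mult_mono card_block) auto
      also have "\<dots> = (4 * (2 + 65 * C)) * 2 ^ (j + 6 * n)" by (simp add: power_add)
      also have "\<dots> \<le> (4 * (2 + 65 * C)) * 2 ^ (7 * (n + j))"
        using C(1) by (intro mult_left_mono power_increasing) auto
      finally show "real (card (block j)) * (2 + C * 2 ^ (6 * Suc n) + C * 2 ^ (6 * n))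
        \<le> (4 * (2 + 65 * C)) * 2 ^ (7 * (n + j))" .
    qed
    finally show "(\<integral>\<^sup>+\<omega>. ennreal (block_energy n j \<omega>) \<partial>M) \<le> ennreal ((4 * (2 + 65 * C)) * 2 ^
      (7 * (n + j)))" .
  qed
  then show ?thesis using C(1) by (intro exI[of _ "4 * (2 + 65 * C)"]) auto
qed

text \<open>
  A maximum over a space-time grid costs a power of the number of points, which moments of high order
  \<open>2 p\<close> absorb. The mesh \<open>2^(-16(n + j))\<close> is so fine that the exponentially large energy of the noise at
  level \<open>n\<close> suffices to control the oscillation between the grid points.
\<close>

definition grid_bound :: "real \<Rightarrow> real \<Rightarrow> real \<Rightarrow> nat \<Rightarrow> nat \<Rightarrow> nat \<Rightarrow> 'a \<Rightarrow> real" where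
  "grid_bound \<alpha> \<epsilon> L p n j \<omega> = \<epsilon> +
     (\<Sum>i\<le>2 ^ (16 * (n + j) + 2). \<Sum>l\<le>2 ^ (16 * (n + j) + 2).
        (cmod (block_field \<alpha> n j \<omega> (- 2 + 4 * real i / 2 ^ (16 * (n + j) + 2)) (2 * pi * real l / 2
          ^ (16 * (n + j) + 2))) / \<epsilon>) ^ (2 * p)) +
     (16 * L + 25) / 2 ^ (8 * (n + j) + 1) * block_energy n j \<omega>"

lemma block_energy_nonneg: "0 \<le> block_energy n j \<omega>"
  unfolding block_energy_def by (intro sum_nonneg add_nonneg_nonneg path_energy_nonneg) auto

text \<open>Inside [-2, 2] a point is compared with a nearby grid point, where the value is at most
  \<epsilon> plus a single term of the sum. Outside, the field vanishes, and periodicity reduces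
  \<open>x\<close> to one period.\<close>

lemma block_field_le_grid_bound:
  assumes \<alpha>: "0 \<le> \<alpha>" and lip: "L-lipschitz_on {-2..2} chi"
    and \<epsilon>: "0 < \<epsilon>" "\<epsilon> \<le> 1" and p: "1 \<le> p"
  shows "AE \<omega> in M. \<forall>t x. cmod (block_field \<alpha> n j \<omega> t x) \<le> grid_bound \<alpha> \<epsilon> L p n j \<omega>"
  using PsiN_path[OF lip, of n] PsiN_path[OF lip, of "Suc n"]
proof eventually_elim
  case (elim \<omega>)
  note L = lipschitz_on_nonneg[OF lip]
  have path: "cmod (PsiN i \<omega> t k) \<le> 2 + path_energy i k \<omega> \<and>
       cmod (PsiN i \<omega> t k - PsiN i \<omega> s k) \<le> L * \<bar>t - s\<bar> * (2 + path_energy i k \<omega>) + l * \<bar>t - s\<bar>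
         + path_energy i k \<omega> / l"
    if "i \<in> {n, Suc n}" "0 < l" "\<bar>s\<bar> \<le> 2" "\<bar>t\<bar> \<le> 2" for i k s t l
    using elim that by blast
  define m :: nat where "m = 2 ^ (16 * (n + j) + 2)"
  \<comment> \<open>Chosen so that l^2 = m: the mesh widths 4/m and 2 pi/m are then at most 8 / l^2,
    while \<open>l\<close> still exceeds the frequencies of block \<open>j\<close>.\<close>
  define l :: real where "l = 2 ^ (8 * (n + j) + 1)"
  have lj: "2 ^ Suc j \<le> l" unfolding l_def by (intro power_increasing) auto
  have "l\<^sup>2 = 2 ^ ((8 * (n + j) + 1) * 2)" unfolding l_def by (rule power_mult[symmetric])
  also have "(8 * (n + j) + 1) * 2 = 16 * (n + j) + 2" by simp
  finally have lm: "l\<^sup>2 = real m" by (simp add: m_def)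
  have m0: "0 < m" by (simp add: m_def)
  let ?G = "grid_bound \<alpha> \<epsilon> L p n j \<omega>"
  define g where "g i l = (cmod (block_field \<alpha> n j \<omega> (- 2 + 4 * real i / real m) (2 * pi * real l /
    real m)) / \<epsilon>) ^ (2 * p)" for i l :: nat
  have g0: "0 \<le> g i l" for i l using \<epsilon> by (simp add: g_def)
  have G: "?G = \<epsilon> + (\<Sum>i\<le>m. \<Sum>l\<le>m. g i l) + (16 * L + 25) / l * block_energy n j \<omega>"
    unfolding grid_bound_def m_def l_def g_def by simp
  have G0: "0 \<le> ?G" unfolding G using \<epsilon> L g0 block_energy_nonneg[of n j \<omega>]
    by (intro add_nonneg_nonneg sum_nonneg mult_nonneg_nonneg) (auto simp: l_def)
  have main: "cmod (block_field \<alpha> n j \<omega> t x) \<le> ?G" if t: "\<bar>t\<bar> \<le> 2" and x: "0 \<le> x" "x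
    \<le> 2 * pi" for t x
  proof -
    have t': "- 2 \<le> t" "t \<le> - 2 + 4" using t by auto
    obtain i where i: "i \<le> m" "\<bar>t - (- 2 + 4 * real i / real m)\<bar> \<le> 4 / real m"
      using grid_point[OF t' _ m0] zero_less_numeral by blast
    obtain q where q: "q \<le> m" "\<bar>x - (0 + 2 * pi * real q / real m)\<bar> \<le> 2 * pi / real m"
      using grid_point[of 0 x "2 * pi" m] x m0 by auto
    let ?t = "- 2 + 4 * real i / real m" and ?x = "2 * pi * real q / real m"
    have "4 * real i / real m \<le> 4" "0 \<le> 4 * real i / real m" using i(1) m0
      by (auto simp: divide_le_eq)
    then have ti: "\<bar>?t\<bar> \<le> 2" unfolding abs_le_iff by linarith
    have "4 / real m \<le> 8 / real m" "2 * pi / real m \<le> 8 / real m"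
      using pi_less_4 by (auto intro!: divide_right_mono)
    then have d: "\<bar>t - ?t\<bar> \<le> 8 / l\<^sup>2" "\<bar>x - ?x\<bar> \<le> 8 / l\<^sup>2" using i(2) q(2) unfolding lm by auto
    have "cmod (block_field \<alpha> n j \<omega> t x) \<le> cmod (block_field \<alpha> n j \<omega> ?t ?x)
      + cmod (block_field \<alpha> n j \<omega> t x - block_field \<alpha> n j \<omega> ?t ?x)"
      by (metis norm_triangle_sub)
    also have "\<dots> \<le> (\<epsilon> + g i q) + (16 * L + 25) / l * block_energy n j \<omega>"
      unfolding g_def
      by (intro add_mono le_eps_plus_power block_field_modulus[OF \<alpha> L lj path ti t d])
        (use \<epsilon> p in auto)
    also have "g i q \<le> (\<Sum>i\<le>m. \<Sum>l\<le>m. g i l)"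
    proof -
      have "g i q \<le> (\<Sum>l\<le>m. g i l)" by (rule member_le_sum) (use q g0 in auto)
      also have "\<dots> \<le> (\<Sum>i\<le>m. \<Sum>l\<le>m. g i l)" by (rule member_le_sum)
        (use i g0 in \<open>auto intro: sum_nonneg\<close>)
      finally show ?thesis .
    qed
    finally show ?thesis unfolding G by simp
  qed
  show ?case
  proof (intro allI)
    fix t x
    show "cmod (block_field \<alpha> n j \<omega> t x) \<le> ?G"
    proof (cases "\<bar>t\<bar> \<le> 2")
      case False
      then have "block_field \<alpha> n j \<omega> t x = 0" by (simp add: block_field_def PsiN_outside)
      then show ?thesis using G0 by simp
    next
      case t: True
      define q where "q = \<lfloor>x / (2 * pi)\<rfloor>"
      define y where "y = x - 2 * pi * real_of_int q"
      have q: "real_of_int q \<le> x / (2 * pi)" "x / (2 * pi) \<le> real_of_int q + 1" unfolding q_def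
        by linarith+
      have y: "0 \<le> y" "y \<le> 2 * pi"
        using q pi_gt_zero by (auto simp: y_def field_simps)
      have "x = y + 2 * pi * real_of_int q" by (simp add: y_def)
      then have "block_field \<alpha> n j \<omega> t x = block_field \<alpha> n j \<omega> t y"
        unfolding block_field_def character_def by (simp only: cis_2pi_periodic)
      then show ?thesis using main[OF t y] by simp
    qed
  qed
qed

lemma grid_bound_measurable [measurable]: "grid_bound \<alpha> \<epsilon> L p n j \<in> borel_measurable M"
proof -
  have [measurable]: "block_energy n j \<in> borel_measurable M" using block_energy_expectation by blast
  show ?thesis unfolding grid_bound_def[abs_def] by measurable
qed

lemma moment_const_nonneg: "0 \<le> moment_const p"
  by (simp add: moment_const_def)

text \<open>With N = n + j, the grid has about 2^(32 N) points, the factor \<epsilon>^(-2p) costs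
  2^(\<kappa> N p / 2), and the moments gain 2^(-\<kappa> N p). The total exponent N (32 - \<kappa>
  p / 2) is at most -N once \<kappa> p \<ge> 66. The energy term is of order 2^(7N - 8N). Both are
  below \<epsilon> = 2^(-\<kappa> N / 4).\<close>

lemma grid_bound_expectation:
  assumes v: "\<And>n j t x. sq_norm (psi_increment n t (block j) (character \<alpha> x))
    \<le> C * 2 powr (- \<kappa> * real (n + j))"
    and C: "0 \<le> C" and \<kappa>: "0 < \<kappa>" "\<kappa> \<le> 1" and p: "66 \<le> \<kappa> * real p" and L: "0 \<le> L"
  shows "\<exists>C'\<ge>0. \<forall>n j. (\<integral>\<^sup>+\<omega>. ennreal (grid_bound \<alpha> (2 powr (- (\<kappa>/4) * real (n + j))) L p n j \<omega>) \<partial>M)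
    \<le> ennreal (C' * (2 powr (- (\<kappa>/4))) ^ (n + j))"
proof -
  obtain CE where CE: "CE \<ge> 0" "\<And>n j. block_energy n j \<in> borel_measurable M"
    "\<And>n j. (\<integral>\<^sup>+\<omega>. ennreal (block_energy n j \<omega>) \<partial>M) \<le> ennreal (CE * 2 ^ (7 * (n + j)))"
    using block_energy_expectation by blast
  note [measurable] = CE(2)
  have p1: "1 \<le> p"
  proof (rule ccontr)
    assume "\<not> 1 \<le> p" then have "p = 0" by simp
    then show False using p by simp
  qed
  define C' where "C' = 1 + 64 * (moment_const p * C ^ p) + (16 * L + 25) * CE"
  have "(\<integral>\<^sup>+\<omega>. ennreal (grid_bound \<alpha> (2 powr (- (\<kappa>/4) * real (n + j))) L p n j \<omega>) \<partial>M)
    \<le> ennreal (C' * (2 powr (- (\<kappa>/4))) ^ (n + j))" for n j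
  proof -
    define N where "N = n + j"
    define \<epsilon> :: real where "\<epsilon> = 2 powr (- (\<kappa>/4) * real N)"
    define m :: nat where "m = 2 ^ (16 * N + 2)"
    let ?g = "\<lambda>i l \<omega>. cmod (block_field \<alpha> n j \<omega> (- 2 + 4 * real i / real m) (2 * pi * real l / real
      m)) ^ (2 * p)"
    have \<epsilon>0: "0 < \<epsilon>" by (simp add: \<epsilon>_def)
    have \<epsilon>p: "(1 / \<epsilon>) ^ (2 * p) = 2 powr (\<kappa> / 2 * real N * real p)"
    proof -
      have "(1 / \<epsilon>) ^ (2 * p) = (2 powr ((\<kappa>/4) * real N)) ^ (2 * p)"
        by (simp add: \<epsilon>_def powr_minus_divide)
      also have "\<dots> = 2 powr ((\<kappa>/4) * real N * real (2 * p))" by (simp add: powr_realpow[symmetric]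
        powr_powr del: of_nat_mult)
      finally show ?thesis by (simp add: mult_ac)
    qed
    have "(\<integral>\<^sup>+\<omega>. ennreal (grid_bound \<alpha> \<epsilon> L p n j \<omega>) \<partial>M) =
      (\<integral>\<^sup>+\<omega>. ennreal \<epsilon> + (\<Sum>i\<le>m. \<Sum>l\<le>m. ennreal ((1 / \<epsilon>) ^ (2 * p)) * ennreal (?g i l \<omega>))
        + ennreal ((16 * L + 25) / 2 ^ (8 * N + 1)) * ennreal (block_energy n j \<omega>) \<partial>M)"
    proof (rule nn_integral_cong)
      fix \<omega>
      have "grid_bound \<alpha> \<epsilon> L p n j \<omega> = \<epsilon> + (\<Sum>i\<le>m. \<Sum>l\<le>m. (1 / \<epsilon>) ^ (2 * p) * ?g i l \<omega>)
        + (16 * L + 25) / 2 ^ (8 * N + 1) * block_energy n j \<omega>"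
        unfolding grid_bound_def m_def N_def by (simp add: power_divide)
      then show "ennreal (grid_bound \<alpha> \<epsilon> L p n j \<omega>) = ennreal \<epsilon>
        + (\<Sum>i\<le>m. \<Sum>l\<le>m. ennreal ((1 / \<epsilon>) ^ (2 * p)) * ennreal (?g i l \<omega>))
        + ennreal ((16 * L + 25) / 2 ^ (8 * N + 1)) * ennreal (block_energy n j \<omega>)"
        using \<epsilon>0 L block_energy_nonneg[of n j \<omega>]
        by (simp add: ennreal_plus sum_nonneg ennreal_mult[symmetric] sum_ennreal del: power_divide)
    qed
    also have "\<dots> = ennreal \<epsilon> + (\<Sum>i\<le>m. \<Sum>l\<le>m. ennreal ((1 / \<epsilon>) ^ (2 * p)) * (\<integral>\<^sup>+\<omega>. ennreal (?g i l \<omega>)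
      \<partial>M)) + ennreal ((16 * L + 25) / 2 ^ (8 * N + 1)) * (\<integral>\<^sup>+\<omega>. ennreal (block_energy n j \<omega>) \<partial>M)"
      by (simp add: nn_integral_add nn_integral_sum nn_integral_cmult emeasure_space_1)
    also have "\<dots> \<le> ennreal \<epsilon> + (\<Sum>i\<le>m. \<Sum>l\<le>m. ennreal ((1 / \<epsilon>) ^ (2 * p)) * ennreal (moment_const p *
      (C * 2 powr (- \<kappa> * real N)) ^ p)) + ennreal ((16 * L + 25) / 2 ^ (8 * N + 1)) * ennreal
      (CE * 2 ^ (7 * N))"
    proof -
      have "(\<integral>\<^sup>+\<omega>. ennreal (?g i l \<omega>) \<partial>M) \<le> ennreal (moment_const p * (C * 2 powr (- \<kappa> * real N)) ^
        p)" for i l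
        unfolding N_def
        by (rule order_trans[OF block_field_moment[OF p1]])
           (intro ennreal_leI mult_left_mono power_mono v sq_norm_nonneg moment_const_nonneg)
      then show ?thesis using CE(3)[of n j] unfolding N_def
        by (intro add_mono sum_mono mult_left_mono order_refl) auto
    qed
    also have "\<dots> = ennreal (\<epsilon> + real (m + 1) * (real (m + 1) * ((1 / \<epsilon>) ^ (2 * p) * (moment_const
      p * (C * 2 powr (- \<kappa> * real N)) ^ p))) + (16 * L + 25) / 2 ^ (8 * N + 1) *
      (CE * 2 ^ (7 * N)))"
    proof -
      have "(\<Sum>i\<le>m. \<Sum>l\<le>m. ennreal ((1 / \<epsilon>) ^ (2 * p)) * ennreal (moment_const p *
        (C * 2 powr (- \<kappa> * real N)) ^ p)) =
        ennreal (\<Sum>i\<le>m. \<Sum>l\<le>m. (1 / \<epsilon>) ^ (2 * p) * (moment_const p * (C * 2 powr (- \<kappa> * real N)) ^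
          p))"
        using \<epsilon>0 C moment_const_nonneg by (simp add: ennreal_mult[symmetric] sum_ennreal sum_nonneg
          del: sum_constant power_divide)
      then show ?thesis using \<epsilon>0 C L CE(1) moment_const_nonneg
        by (simp add: ennreal_plus ennreal_mult[symmetric] del: power_divide)
    qed
    also have "\<dots> \<le> ennreal (C' * (2 powr (- (\<kappa>/4))) ^ (n + j))"
    proof (rule ennreal_leI)
      have e: "(2 powr (- (\<kappa>/4))) ^ (n + j) = \<epsilon>"
        unfolding \<epsilon>_def N_def by (simp add: powr_realpow[symmetric] powr_powr)
      have eN: "2 powr (- real N) \<le> \<epsilon>"
      proof -
        have "(\<kappa>/4) * real N \<le> 1 * real N" by (rule mult_right_mono) (use \<kappa> in auto)
        then show ?thesis unfolding \<epsilon>_def by (intro powr_mono) auto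
      qed
      have mm: "real (m + 1) * real (m + 1) \<le> 64 * 2 powr (32 * real N)"
      proof -
        have "0 < m" by (simp add: m_def)
        then have "real (m + 1) \<le> 2 * real m" by simp
        then have "real (m + 1) * real (m + 1) \<le> (2 * real m) * (2 * real m)" by (intro mult_mono)
          auto
        also have "\<dots> = 64 * 2 ^ (32 * N)" unfolding m_def by (simp add: power_add[symmetric]
          power_add)
        also have "(2::real) ^ (32 * N) = 2 powr (32 * real N)"
          by (simp add: powr_realpow[symmetric])
        finally show ?thesis .
      qed
      have "real (m + 1) * (real (m + 1) * ((1 / \<epsilon>) ^ (2 * p) * (moment_const p *
        (C * 2 powr (- \<kappa> * real N)) ^ p)))
         = (real (m + 1) * real (m + 1)) * ((moment_const p * C ^ p) *
           (2 powr (\<kappa> / 2 * real N * real p) * 2 powr (- \<kappa> * real N * real p)))"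
        unfolding \<epsilon>p by (simp add: power_mult_distrib powr_realpow[symmetric] powr_powr)
      also have "\<dots> \<le> (64 * 2 powr (32 * real N)) * ((moment_const p * C ^ p) *
        (2 powr (\<kappa> / 2 * real N * real p) * 2 powr (- \<kappa> * real N * real p)))"
        using C moment_const_nonneg[of p] by (intro mult_right_mono mm) auto
      also have "\<dots> = 64 * (moment_const p * C ^ p) * 2 powr (real N * (32 - \<kappa> * real p / 2))"
        by (simp add: powr_add[symmetric] algebra_simps)
      also have "\<dots> \<le> 64 * (moment_const p * C ^ p) * 2 powr (real N * (-1))"
        using p C moment_const_nonneg[of p] by (intro mult_left_mono powr_mono) auto
      also have "\<dots> \<le> 64 * (moment_const p * C ^ p) * \<epsilon>"
        using C moment_const_nonneg[of p] eN by (intro mult_left_mono) auto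
      finally have 2: "real (m + 1) * (real (m + 1) * ((1 / \<epsilon>) ^ (2 * p) * (moment_const p *
        (C * 2 powr (- \<kappa> * real N)) ^ p))) \<le> 64 * (moment_const p * C ^ p) * \<epsilon>" .
      have "(16 * L + 25) / 2 ^ (8 * N + 1) * (CE * 2 ^ (7 * N)) \<le> (16 * L + 25) * CE * (1 / 2 ^ N)"
      proof -
        have "(2::real) ^ (7 * N) / 2 ^ (8 * N + 1) \<le> 1 / 2 ^ N"
          by (simp add: divide_le_eq le_divide_eq power_add[symmetric] field_simps)
        then have "((16 * L + 25) * CE) * (2 ^ (7 * N) / 2 ^ (8 * N + 1)) \<le> ((16 * L + 25) * CE) *
          (1 / 2 ^ N)"
          using L CE(1) by (intro mult_left_mono) auto
        then show ?thesis by simp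
      qed
      also have "1 / 2 ^ N = (2::real) powr (- real N)" by (simp add: powr_minus_divide
        powr_realpow)
      also have "(16 * L + 25) * CE * 2 powr (- real N) \<le> (16 * L + 25) * CE * \<epsilon>"
        using L CE(1) eN by (intro mult_left_mono) auto
      finally have 3: "(16 * L + 25) / 2 ^ (8 * N + 1) * (CE * 2 ^ (7 * N)) \<le> (16 * L + 25) * CE *
        \<epsilon>" .
      show "\<epsilon> + real (m + 1) * (real (m + 1) * ((1 / \<epsilon>) ^ (2 * p) * (moment_const p *
        (C * 2 powr (- \<kappa> * real N)) ^ p))) + (16 * L + 25) / 2 ^ (8 * N + 1) * (CE * 2 ^ (7 * N))
        \<le> C' * (2 powr (- (\<kappa>/4))) ^ (n + j)"
        unfolding e C'_def using 2 3 by (simp add: algebra_simps)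
    qed
    finally show ?thesis unfolding \<epsilon>_def N_def .
  qed
  moreover have "0 \<le> C'" using C L CE(1) moment_const_nonneg by (simp add: C'_def)
  ultimately show ?thesis by blast
qed

section \<open>Almost sure convergence above the critical exponent\<close>

lemma C_sobolev_tendsto_shift:
  assumes "C_sobolev_tendsto s p (\<lambda>n. PsiN n \<omega>) v"
  shows "C_sobolev_tendsto s p (\<lambda>n. Psi chi (B n \<omega>)) v"
proof -
  have e: "Psi chi (B n \<omega>) = PsiN n \<omega>" if "n \<ge> 1" for n using that
    by (auto simp: PsiN_def fun_eq_iff)
  have "uniform_limit K (\<lambda>n t. sobolev_norm s p (\<lambda>k. Psi chi (B n \<omega>) t k - v t k)) (\<lambda>_. 0)
    sequentially"
    if "compact K" for K
  proof (rule uniform_limit_cong[THEN iffD1])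
    show "uniform_limit K (\<lambda>n t. sobolev_norm s p (\<lambda>k. PsiN n \<omega> t k - v t k)) (\<lambda>_. 0) sequentially"
      using assms that by (simp add: C_sobolev_tendsto_def)
    show "\<forall>\<^sub>F n in sequentially. \<forall>t\<in>K. sobolev_norm s p (\<lambda>k. PsiN n \<omega> t k - v t k)
      = sobolev_norm s p (\<lambda>k. Psi chi (B n \<omega>) t k - v t k)"
      using eventually_ge_at_top[of 1] by eventually_elim (simp add: e)
  qed simp
  then show ?thesis using assms e by (simp add: C_sobolev_tendsto_def)
qed

proposition Psi_converges:
  assumes \<alpha>: "2 - (2 * H0 + H1) < \<alpha>" and s: "3/2 < 2 * H0 + H1" "2 * H0 + H1 < 2"
  shows "\<exists>\<Psi>. AE \<omega> in M. \<forall>p\<ge>1. C_sobolev_tendsto (- \<alpha>) p (\<lambda>n. Psi chi (B n \<omega>)) (\<Psi> \<omega>)"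
proof -
  \<comment> \<open>From 2 H0 + H1 < 2; it bounds the characters by 1 in the modulus
    estimate.\<close>
  have \<alpha>0: "0 \<le> \<alpha>" using \<alpha> s by linarith
  obtain C \<kappa>0 where C: "C \<ge> 0" and k0: "\<kappa>0 > 0" and v0: "\<And>n j t x. sq_norm (psi_increment n t
    (block j) (character \<alpha> x)) \<le> C * 2 powr (- \<kappa>0 * real (n + j))"
    using sq_norm_block_le[OF \<alpha> s(1)] by blast
  \<comment> \<open>Capping at 1 only weakens the variance bound and keeps \<epsilon> above 2^(-(n +
    j)).\<close>
  define \<kappa> where "\<kappa> = min \<kappa>0 1"
  have \<kappa>: "0 < \<kappa>" "\<kappa> \<le> 1" using k0 by (auto simp: \<kappa>_def)
  have v: "sq_norm (psi_increment n t (block j) (character \<alpha> x)) \<le> C * 2 powr (- \<kappa> * real (n + j))"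
    for n j t x
  proof -
    have "2 powr (- \<kappa>0 * real (n + j)) \<le> 2 powr (- \<kappa> * real (n + j))"
      by (intro powr_mono mult_right_mono) (auto simp: \<kappa>_def)
    then show ?thesis using v0[of n t j x] C by (meson mult_left_mono order_trans)
  qed
  obtain L where lip: "L-lipschitz_on {-2..2} chi"
    using chi_lipschitz by blast
  note L = lipschitz_on_nonneg[OF lip]
  obtain p :: nat where p: "66 / \<kappa> \<le> real p" using real_arch_simple by blast
  then have p66: "66 \<le> \<kappa> * real p" using \<kappa> by (simp add: field_simps)
  have p1: "1 \<le> p"
  proof (rule ccontr)
    assume "\<not> 1 \<le> p" then have "p = 0" by simp
    then show False using p66 by simp
  qed
  define \<epsilon> where "\<epsilon> n j = 2 powr (- (\<kappa>/4) * real (n + j))" for n j :: nat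
  have \<epsilon>: "0 < \<epsilon> n j" "\<epsilon> n j \<le> 1" for n j
    using powr_mono[of "- (\<kappa>/4) * real (n + j)" 0 2] \<kappa> by (auto simp: \<epsilon>_def)
  let ?U = "\<lambda>n j. grid_bound \<alpha> (\<epsilon> n j) L p n j"
  obtain C' where C': "C' \<ge> 0" "\<And>n j. (\<integral>\<^sup>+\<omega>. ennreal (?U n j \<omega>) \<partial>M)
    \<le> ennreal (C' * (2 powr (- (\<kappa>/4))) ^ (n + j))"
    using grid_bound_expectation[OF v C \<kappa> p66 L] unfolding \<epsilon>_def by blast
  have nn: "0 \<le> ?U n j \<omega>" for n j \<omega>
    unfolding grid_bound_def using \<epsilon>[of n j] L block_energy_nonneg[of n j \<omega>]
    by (intro add_nonneg_nonneg sum_nonneg mult_nonneg_nonneg) auto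
  have r: "2 powr (- (\<kappa>/4)) < (1::real)" using \<kappa> powr_less_mono[of "- (\<kappa>/4)" 0 2] by simp
  have "AE \<omega> in M. (\<forall>n. summable (\<lambda>j. ?U n j \<omega>)) \<and> summable (\<lambda>n. \<Sum>j. ?U n j \<omega>)"
    by (rule AE_summable_double[OF grid_bound_measurable nn C'(1) _ r C'(2)]) simp
  moreover have "AE \<omega> in M. \<forall>n j t x. cmod (block_field \<alpha> n j \<omega> t x) \<le> ?U n j \<omega>"
    unfolding AE_all_countable using block_field_le_grid_bound[OF \<alpha>0 lip \<epsilon> p1] by blast
  moreover have "AE \<omega> in M. \<forall>n k. continuous_on UNIV (\<lambda>t. PsiN n \<omega> t k)"
  proof (subst AE_all_countable, rule allI)
    fix n
    show "AE \<omega> in M. \<forall>k. continuous_on UNIV (\<lambda>t. PsiN n \<omega> t k)"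
      using PsiN_path[OF lip, of n] by eventually_elim blast
  qed
  ultimately have "AE \<omega> in M. \<exists>v. \<forall>p\<ge>1. C_sobolev_tendsto (- \<alpha>) p (\<lambda>n. PsiN n \<omega>) v"
  proof eventually_elim
    case (elim \<omega>)
    show ?case
    proof (rule C_sobolev_tendsto_blocks[OF finite_block disjoint_block UN_block])
      show "cmod (\<Sum>k\<in>block j. complex_of_real (bracket k powr (- \<alpha>)) * (PsiN (Suc n) \<omega> t k - PsiN n
        \<omega> t k) * cis (real_of_int k * x)) \<le> ?U n j \<omega>" for n j t x
      proof -
        have "(\<Sum>k\<in>block j. complex_of_real (bracket k powr (- \<alpha>)) * (PsiN (Suc n) \<omega> t k - PsiN n \<omega> t
          k) * cis (real_of_int k * x)) = block_field \<alpha> n j \<omega> t x"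
          unfolding block_field_def character_def by (intro sum.cong refl) (simp add: mult_ac)
        then show ?thesis using elim by simp
      qed
    qed (use elim in \<open>auto simp: PsiN_def[of 0]\<close>)
  qed
  then have ae: "AE \<omega> in M. \<exists>v. \<forall>p\<ge>1. C_sobolev_tendsto (- \<alpha>) p (\<lambda>n. Psi chi (B n \<omega>)) v"
    by eventually_elim (use C_sobolev_tendsto_shift in blast)
  \<comment> \<open>The limit is chosen path by path, after the quantifier over \<open>p\<close>, so
    one \<Psi> and one event serve all \<open>p\<close>.\<close>
  let ?V = "\<lambda>\<omega>. SOME v. \<forall>p\<ge>1. C_sobolev_tendsto (- \<alpha>) p (\<lambda>n. Psi chi (B n \<omega>)) v"
  have "AE \<omega> in M. \<forall>p\<ge>1. C_sobolev_tendsto (- \<alpha>) p (\<lambda>n. Psi chi (B n \<omega>)) (?V \<omega>)"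
    using ae
  proof eventually_elim
    case (elim \<omega>)
    then show ?case by (rule someI_ex)
  qed
  then show ?thesis by (intro exI[of _ ?V])
qed

end

section \<open>Divergence below the critical exponent\<close>

lemma interval_integral_cis_near:
  assumes "0 \<le> T"
  shows "cmod ((LBINT r=ereal 0..ereal T. cis (r * \<zeta>)) - of_real T) \<le> T * (T * \<bar>\<zeta>\<bar>)"
proof -
  have i: "interval_lebesgue_integrable lborel (ereal 0) (ereal T) (\<lambda>r. cis (r * \<zeta>))"
    "interval_lebesgue_integrable lborel (ereal 0) (ereal T) (\<lambda>r. 1 :: complex)"
    by (rule interval_integrable_isCont, intro continuous_on_interior[where S=UNIV]
      continuous_intros, auto)+
  have "(LBINT r=ereal 0..ereal T. cis (r * \<zeta>)) - (LBINT r=ereal 0..ereal T. 1)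
    = (LBINT r=ereal 0..ereal T. cis (r * \<zeta>) - 1)"
    by (rule interval_lebesgue_integral_diff(2)[OF i, symmetric])
  moreover have "(LBINT r=ereal 0..ereal T. 1 :: complex) = of_real T"
    unfolding interval_integral_Icc[OF assms] integral_Icc_eq_HK(1)[OF continuous_on_const]
    using assms by (simp add: scaleR_conv_of_real)
  moreover have "cmod (LBINT r=ereal 0..ereal T. cis (r * \<zeta>) - 1) \<le> (T * \<bar>\<zeta>\<bar>) * \<bar>T - 0\<bar>"
  proof (rule interval_integral_norm_le)
    fix r assume r: "r \<in> {min 0 T..max 0 T}"
    have "cmod (cis (r * \<zeta>) - cis 0) \<le> \<bar>r * \<zeta> - 0\<bar>" by (rule cmod_cis_diff_le)
    also have "\<dots> \<le> T * \<bar>\<zeta>\<bar>" using r assms by (auto simp: abs_mult intro!: mult_right_mono)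
    finally show "cmod (cis (r * \<zeta>) - 1) \<le> T * \<bar>\<zeta>\<bar>" by simp
  qed (intro continuous_intros)
  ultimately show ?thesis using assms by (simp add: mult_ac)
qed

text \<open>The frequency error is so small that 2 pi |u| \<le> 8/16, hence the integral over the
  period stays within pi of 2 pi.\<close>

lemma window_ge:
  assumes "\<bar>\<eta> - of_int k\<bar> \<le> 1/16"
  shows "1/2 \<le> cmod (window k \<eta>)"
proof -
  define u where "u = \<eta> - of_int k"
  let ?I = "LBINT x=ereal 0..ereal (2*pi). cis (x * u)"
  have w: "window k \<eta> = ?I / (2 * pi)"
    unfolding window_def fourier_coeff_def zero_ereal_def u_def
      by (simp add: cis_mult algebra_simps)
  have "cmod (?I - of_real (2*pi)) \<le> 2*pi * (2*pi * \<bar>u\<bar>)" by (rule interval_integral_cis_near) simp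
  also have "\<dots> \<le> 2*pi * (1/2)"
  proof -
    have "2*pi * \<bar>u\<bar> \<le> (2*4) * (1/16)" using assms pi_less_4 by (intro mult_mono) (auto simp: u_def)
    then show ?thesis by (intro mult_left_mono) auto
  qed
  finally have "cmod (?I - of_real (2*pi)) \<le> pi" by simp
  moreover have "cmod (of_real (2*pi)) \<le> cmod ?I + cmod (?I - of_real (2*pi))"
    using norm_triangle_sub[of "of_real (2*pi)" ?I] by (simp add: norm_minus_commute)
  ultimately have "pi \<le> cmod ?I" by simp
  then show ?thesis unfolding w by (simp add: norm_divide norm_mult field_simps)
qed

text \<open>Each of the n - 1 dyadic ranges contributes at least 1/2. Linear growth in the level is
  all that the divergence uses.\<close>

lemma dyadic_harmonic_ge:
  "1 \<le> n \<Longrightarrow> real (n - 1) / 2 \<le> (\<Sum>k\<in>{2..<(2::int) ^ n}. 1 / real_of_int k)"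
proof (induction n rule: dec_induct)
  case base then show ?case by simp
next
  case (step n)
  have "(2::int) ^ 1 \<le> 2 ^ n" using step by (intro power_increasing) auto
  then have "{2..<(2::int) ^ Suc n} = {2..<2 ^ n} \<union> {2 ^ n..<2 ^ Suc n}" by auto
  then have s1: "(\<Sum>k\<in>{2..<(2::int) ^ Suc n}. 1 / real_of_int k) = (\<Sum>k\<in>{2..<2 ^ n}. 1 / real_of_int
    k) + (\<Sum>k\<in>{2 ^ n..<2 ^ Suc n}. 1 / real_of_int k)"
    by (simp only:) (rule sum.union_disjoint, auto)
  have s2: "1/2 \<le> (\<Sum>k\<in>{2 ^ n..<(2::int) ^ Suc n}. 1 / real_of_int k)"
  proof -
    have "(\<Sum>k\<in>{2 ^ n..<(2::int) ^ Suc n}. 1 / 2 ^ Suc n) \<le> (\<Sum>k\<in>{2 ^ n..<(2::int) ^ Suc n}. 1 /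
      real_of_int k)"
    proof (rule sum_mono)
      fix k :: int assume k: "k \<in> {2 ^ n..<2 ^ Suc n}"
      have "real_of_int k < real_of_int (2 ^ Suc n)" using k by (simp only: of_int_less_iff) simp
      moreover have "(0::int) < 2 ^ n" by simp
      then have "0 < k" using k by (simp only: atLeastLessThan_iff) linarith
      ultimately show "1 / 2 ^ Suc n \<le> 1 / real_of_int k" by (intro divide_left_mono) auto
    qed
    moreover have "(\<Sum>k\<in>{2 ^ n..<(2::int) ^ Suc n}. 1 / (2::real) ^ Suc n) = 1/2"
      by (simp add: of_nat_nat)
    ultimately show ?thesis by simp
  qed
  have s3: "real (Suc n - 1) / 2 = real (n - 1) / 2 + 1 / 2" using step(1)
    by (simp add: add_divide_distrib[symmetric])
  show ?case unfolding s1 s3 by (rule add_mono[OF step.IH s2])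
qed

lemma H_norm_sq_ge:
  assumes "finite K"
  shows "(\<Sum>k\<in>K. ennreal (bracket k powr (2 * s) * (cmod (u k))\<^sup>2)) \<le> H_norm_sq s u"
proof -
  have "(\<Sum>k\<in>K. ennreal (bracket k powr (2 * s) * (cmod (u k))\<^sup>2))
    = (\<Sum>\<^sub>\<infinity>k\<in>K. ennreal (bracket k powr (2 * s) * (cmod (u k))\<^sup>2))"
    using assms by (rule infsum_finite[symmetric])
  also have "\<dots> \<le> H_norm_sq s u"
    unfolding H_norm_sq_def
    by (rule infsum_mono_neutral) (auto intro: nonneg_summable_on_complete)
  finally show ?thesis .
qed

section \<open>Lower bounds near resonance and divergence of the energy\<close>

context sheet
begin

text \<open>For times in [0, 1] the cutoff is 1, and with |\<zeta>| \<le> 1/2 the phase stays within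
  1/2 of 1.\<close>

lemma osc_ge:
  assumes t: "0 \<le> t" "t \<le> 1" and \<zeta>: "\<bar>\<zeta>\<bar> \<le> 1/2"
  shows "t / 2 \<le> cmod (of_real (chi t) * osc chi t \<zeta>)"
proof -
  have "osc chi t \<zeta> = (LBINT r=ereal 0..ereal t. cis (r * \<zeta>))"
    unfolding osc_def zero_ereal_def
    by (rule interval_integral_cong) (use t chi_bounds(4) in \<open>auto simp: einterval_def\<close>)
  then have "cmod (osc chi t \<zeta> - of_real t) \<le> t * (t * \<bar>\<zeta>\<bar>)" using interval_integral_cis_near[OF
    t(1)] by simp
  also have "\<dots> \<le> t * (1 * (1/2))" using t \<zeta> by (intro mult_left_mono mult_mono) auto
  finally have "cmod (osc chi t \<zeta> - of_real t) \<le> t / 2" by simp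
  moreover have "cmod (of_real t) \<le> cmod (osc chi t \<zeta>) + cmod (osc chi t \<zeta> - of_real t)"
    using norm_triangle_sub[of "of_real t" "osc chi t \<zeta>"] by (simp add: norm_minus_commute)
  ultimately have "t / 2 \<le> cmod (osc chi t \<zeta>)" using t by simp
  then show ?thesis using chi_bounds(4)[of t] t by simp
qed

text \<open>On a rectangle around (k^2, k) neither the window nor the time integral oscillates. The
  condition k < 2^n keeps the rectangle inside the band, and k \<ge> 2 keeps it away from the axes,
  so that powers of \<xi> and \<eta> are comparable with those of k^2 and k for either sign of the
  exponent.\<close>

lemma sq_norm_psi_kernel_ge:
  "\<exists>C>0. \<forall>n k t. 2 \<le> k \<longrightarrow> k < 2 ^ n \<longrightarrow> 0 \<le> t \<longrightarrow> t \<le> 1 \<longrightarrow>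
     C * t\<^sup>2 * real_of_int k powr (3 - 2 * (2 * H0 + H1)) \<le> sq_norm (psi_kernel c H0 H1 chi n k t)"
proof -
  define a where "a = 1 - 2 * H0"
  define b where "b = 1 - 2 * H1"
  define D where "D = 2 powr (- \<bar>a\<bar>) * 2 powr (- \<bar>b\<bar>)"
  \<comment> \<open>The 128 is 16 times 8: the squares of 1/2 and t/2 give t^2/16, and the rectangle
    has area 1/8.\<close>
  define C where "C = c\<^sup>2 * D / 128"
  have "C * t\<^sup>2 * real_of_int k powr (3 - 2 * (2 * H0 + H1)) \<le> sq_norm (psi_kernel c H0 H1 chi n k
    t)"
    if k: "2 \<le> k" "k < 2 ^ n" and t: "0 \<le> t" "t \<le> 1" for n k t
  proof -
    have n: "n \<noteq> 0" using k by (cases n) auto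
    define x where "x = real_of_int k"
    have x2: "2 \<le> x" using k(1) by (simp add: x_def)
    have xn: "x + 1 \<le> 2 ^ n"
    proof -
      have "k + 1 \<le> 2 ^ n" using k(2) by simp
      then have "real_of_int (k + 1) \<le> real_of_int (2 ^ n)" by (simp only: of_int_le_iff)
      then show ?thesis by (simp add: x_def)
    qed
    have xx: "4 \<le> x\<^sup>2" using power_mono[OF x2, of 2] by simp
    have xn2: "x\<^sup>2 + 1 \<le> 2 ^ (2 * n)"
    proof -
      have "x\<^sup>2 + 1 \<le> (x + 1)\<^sup>2" using x2 by (simp add: power2_eq_square algebra_simps)
      also have "\<dots> \<le> (2 ^ n)\<^sup>2" using xn x2 by (intro power_mono) auto
      finally show ?thesis by (simp add: power_mult[symmetric] mult.commute)
    qed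
    let ?E = "c\<^sup>2 * (D * (x\<^sup>2) powr a * x powr b) * (t\<^sup>2 / 16)"
    have E0: "0 \<le> ?E" by (simp add: D_def)
    have pw: "?E \<le> (cmod (psi_kernel c H0 H1 chi n k t (\<xi>, \<eta>)))\<^sup>2"
      if \<xi>: "\<xi> \<in> {x\<^sup>2 - 1/2..x\<^sup>2 + 1/2}" and \<eta>: "\<eta> \<in> {x - 1/16..x + 1/16}" for \<xi> \<eta>
    proof -
      have p: "0 < \<xi>" "0 < \<eta>" using \<xi> \<eta> xx x2 by auto
      have band: "(\<xi>, \<eta>) \<in> band n" using n \<xi> \<eta> xn xn2 p by (auto simp: band_def)
      have 1: "2 powr (- \<bar>a\<bar>) * (x\<^sup>2) powr a \<le> \<bar>\<xi>\<bar> powr a"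
      proof -
        have "(x\<^sup>2) powr a \<le> 2 powr \<bar>a\<bar> * \<bar>\<xi>\<bar> powr a"
          by (rule powr_comparable) (use \<xi> p xx in auto)
        then have "2 powr (- \<bar>a\<bar>) * (x\<^sup>2) powr a \<le> 2 powr (- \<bar>a\<bar>) * (2 powr \<bar>a\<bar> * \<bar>\<xi>\<bar> powr a)"
          by (intro mult_left_mono) auto
        then show ?thesis by (simp add: mult.assoc[symmetric] powr_add[symmetric])
      qed
      have 2: "2 powr (- \<bar>b\<bar>) * x powr b \<le> \<bar>\<eta>\<bar> powr b"
      proof -
        have "x powr b \<le> 2 powr \<bar>b\<bar> * \<bar>\<eta>\<bar> powr b"
          by (rule powr_comparable) (use \<eta> p x2 in auto)
        then have "2 powr (- \<bar>b\<bar>) * x powr b \<le> 2 powr (- \<bar>b\<bar>) * (2 powr \<bar>b\<bar> * \<bar>\<eta>\<bar> powr b)"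
          by (intro mult_left_mono) auto
        then show ?thesis by (simp add: mult.assoc[symmetric] powr_add[symmetric])
      qed
      have "\<bar>\<eta> - of_int k\<bar> \<le> 1/16" using \<eta> by (simp only: abs_le_iff atLeastAtMost_iff x_def)
        linarith
      then have 3: "(1/2)\<^sup>2 \<le> (cmod (window k \<eta>))\<^sup>2" by (intro power_mono window_ge) auto
      have "\<bar>\<xi> - (of_int k)\<^sup>2\<bar> \<le> 1/2" using \<xi> by (simp only: abs_le_iff atLeastAtMost_iff x_def)
        linarith
      then have 4: "(t/2)\<^sup>2 \<le> (cmod (of_real (chi t) * osc chi t (\<xi> - (of_int k)\<^sup>2)))\<^sup>2"
        by (intro power_mono osc_ge) (use t in auto)
      have "(cmod (psi_kernel c H0 H1 chi n k t (\<xi>, \<eta>)))\<^sup>2 = c\<^sup>2 * (\<bar>\<xi>\<bar> powr a * \<bar>\<eta>\<bar> powr b) *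
        ((cmod (window k \<eta>))\<^sup>2 * (cmod (of_real (chi t) * osc chi t (\<xi> - (of_int k)\<^sup>2)))\<^sup>2)"
        using c_pos band unfolding psi_kernel_def a_def b_def
        by (simp add: norm_mult norm_amp power_mult_distrib powr_square right_diff_distrib)
      moreover have "?E = c\<^sup>2 * ((2 powr (- \<bar>a\<bar>) * (x\<^sup>2) powr a) * (2 powr (- \<bar>b\<bar>) * x powr b)) *
        ((1/2)\<^sup>2 * (t/2)\<^sup>2)"
        by (simp add: D_def power2_eq_square)
      moreover have "c\<^sup>2 * ((2 powr (- \<bar>a\<bar>) * (x\<^sup>2) powr a) * (2 powr (- \<bar>b\<bar>) * x powr b)) *
        ((1/2)\<^sup>2 * (t/2)\<^sup>2) \<le>
         c\<^sup>2 * (\<bar>\<xi>\<bar> powr a * \<bar>\<eta>\<bar> powr b) * ((cmod (window k \<eta>))\<^sup>2 * (cmod (of_real (chi t) * osc chi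
           t (\<xi> - (of_int k)\<^sup>2)))\<^sup>2)"
        by (intro mult_mono mult_left_mono 1 2 3 4) auto
      ultimately show ?thesis by linarith
    qed
    have "ennreal (?E * (1/8)) = ennreal ?E * ((\<integral>\<^sup>+y. indicator {x\<^sup>2 - 1/2..x\<^sup>2 + 1/2} y \<partial>lborel) *
      (\<integral>\<^sup>+y. indicator {x - 1/16..x + 1/16} y \<partial>lborel))"
      using E0 by (simp add: ennreal_mult[symmetric] del: ennreal_1)
    also have "\<dots> = (\<integral>\<^sup>+z. ennreal ?E * (indicator {x\<^sup>2 - 1/2..x\<^sup>2 + 1/2} (fst z) * indicator
      {x - 1/16..x + 1/16} (snd z)) \<partial>lborel)"
      by (subst nn_integral_cmult, measurable) (subst nn_integral_lborel_prod_mult, auto)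
    also have "\<dots> \<le> (\<integral>\<^sup>+z. ennreal ((cmod (psi_kernel c H0 H1 chi n k t z))\<^sup>2) \<partial>lborel)"
    proof (rule nn_integral_mono)
      fix z :: "real \<times> real"
      show "ennreal ?E * (indicator {x\<^sup>2 - 1/2..x\<^sup>2 + 1/2} (fst z) * indicator {x - 1/16..x + 1/16}
        (snd z)) \<le> ennreal ((cmod (psi_kernel c H0 H1 chi n k t z))\<^sup>2)"
      proof (cases "fst z \<in> {x\<^sup>2 - 1/2..x\<^sup>2 + 1/2} \<and> snd z \<in> {x - 1/16..x + 1/16}")
        case True
        then have "ennreal ?E \<le> ennreal ((cmod (psi_kernel c H0 H1 chi n k t (fst z, snd z)))\<^sup>2)"
          by (intro ennreal_leI pw) auto
        moreover have "indicator {x\<^sup>2 - 1/2..x\<^sup>2 + 1/2} (fst z) * indicator {x - 1/16..x + 1/16}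
          (snd z) = (1 :: ennreal)" using True by simp
        ultimately show ?thesis by (simp only: prod.collapse mult_1_right)
      qed (auto simp: indicator_def)
    qed
    also have "\<dots> = ennreal (sq_norm (psi_kernel c H0 H1 chi n k t))"
      unfolding sq_norm_def using psi_kernel_square_integrable[of n k t]
      by (intro nn_integral_eq_integral) (auto simp: square_integrable_def)
    finally have "?E * (1/8) \<le> sq_norm (psi_kernel c H0 H1 chi n k t)"
      by (simp add: ennreal_le_iff sq_norm_nonneg)
    moreover have "?E * (1/8) = C * t\<^sup>2 * x powr (2 * a + b)"
    proof -
      have "x\<^sup>2 = x powr 2" using x2 by (simp add: powr_numeral)
      then have "(x\<^sup>2) powr a * x powr b = x powr (2 * a + b)" by (simp add: powr_powr powr_add)
      then show ?thesis by (simp add: C_def mult_ac)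
    qed
    moreover have "2 * a + b = 3 - 2 * (2 * H0 + H1)" by (simp add: a_def b_def)
    ultimately show ?thesis by (simp only: x_def)
  qed
  moreover have "0 < C" using c_pos by (simp add: C_def D_def)
  ultimately show ?thesis by blast
qed

text \<open>Finitely many frequencies bound the norm from below. For them expectation and time
  integral are exchanged through jointly measurable versions and evaluated by the isometry;
  monotonicity then passes to the full norm.\<close>

lemma Psi_energy_ge:
  assumes n: "n \<ge> 1" and fin: "finite K" and T: "0 \<le> T0" "T0 \<le> T1" "T1 \<le> T"
    and ge: "\<And>k t. k \<in> K \<Longrightarrow> t \<in> {T0..T1} \<Longrightarrow> w k \<le> sq_norm (psi_kernel c H0 H1 chi n k t)" and w:
      "\<And>k. k \<in> K \<Longrightarrow> 0 \<le> w k"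
  shows "ennreal ((T1 - T0) * (\<Sum>k\<in>K. bracket k powr (2 * s) * w k)) \<le>
    (\<integral>\<^sup>+\<omega>. (\<integral>\<^sup>+t\<in>{0..T}. H_norm_sq s (Psi chi (B n \<omega>) t) \<partial>lborel) \<partial>M)"
proof -
  interpret P: pair_sigma_finite M lborel ..
  obtain L where lip: "L-lipschitz_on {-2..2} chi" using chi_lipschitz by blast
  have "\<exists>Z. (\<lambda>(\<omega>, r). Z \<omega> r) \<in> borel_measurable (M \<Otimes>\<^sub>M lborel) \<and> (AE \<omega> in M. Z \<omega>
    = (\<lambda>t. PsiN n \<omega> t k))" for k
  proof -
    have "AE \<omega> in M. continuous_on UNIV (\<lambda>t. PsiN n \<omega> t k)"
      using PsiN_path[OF lip, of n] by eventually_elim blast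
    from caratheodory_version[OF PsiN_measurable this] show ?thesis by blast
  qed
  then obtain Z where Z: "\<And>k. (\<lambda>(\<omega>, r). Z k \<omega> r) \<in> borel_measurable (M \<Otimes>\<^sub>M lborel)"
    "\<And>k. AE \<omega> in M. Z k \<omega> = (\<lambda>t. PsiN n \<omega> t k)"
    by metis
  note [measurable] = Z(1)
  have aeZ: "AE \<omega> in M. \<forall>k\<in>K. Z k \<omega> = (\<lambda>t. PsiN n \<omega> t k)" by (rule AE_finite_allI[OF fin Z(2)])
  let ?b = "\<lambda>k. bracket k powr (2 * s)"
  have "ennreal ((T1 - T0) * (\<Sum>k\<in>K. ?b k * w k)) = (\<Sum>k\<in>K. ennreal (?b k) * (ennreal (w k) * ennreal
    (T1 - T0)))"
  proof -
    have "(T1 - T0) * (\<Sum>k\<in>K. ?b k * w k) = (\<Sum>k\<in>K. ?b k * (w k * (T1 - T0)))"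
      by (simp add: sum_distrib_left mult_ac)
    then have "ennreal ((T1 - T0) * (\<Sum>k\<in>K. ?b k * w k))
      = (\<Sum>k\<in>K. ennreal (?b k * (w k * (T1 - T0))))"
      using w T by (subst sum_ennreal) auto
    also have "\<dots> = (\<Sum>k\<in>K. ennreal (?b k) * (ennreal (w k) * ennreal (T1 - T0)))"
      using w T by (intro sum.cong refl) (simp add: ennreal_mult[symmetric])
    finally show ?thesis .
  qed
  also have "\<dots> \<le> (\<Sum>k\<in>K. ennreal (?b k) * (\<integral>\<^sup>+\<omega>. (\<integral>\<^sup>+t. ennreal ((cmod (Z k \<omega> t))\<^sup>2) * indicator
    {T0..T1} t \<partial>lborel) \<partial>M))"
  proof (intro sum_mono mult_left_mono)
    fix k assume k: "k \<in> K"
    have "ennreal (w k) * ennreal (T1 - T0) = (\<integral>\<^sup>+t. ennreal (w k) * indicator {T0..T1} t \<partial>lborel)"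
      using T by (simp add: nn_integral_cmult_indicator)
    also have "\<dots> \<le> (\<integral>\<^sup>+t. (\<integral>\<^sup>+\<omega>. ennreal ((cmod (Z k \<omega> t))\<^sup>2) * indicator {T0..T1} t \<partial>M) \<partial>lborel)"
    proof (rule nn_integral_mono)
      fix t :: real
      have "(\<integral>\<^sup>+\<omega>. ennreal ((cmod (Z k \<omega> t))\<^sup>2) \<partial>M)
        = (\<integral>\<^sup>+\<omega>. ennreal ((cmod (W (psi_kernel c H0 H1 chi n k t) \<omega>))\<^sup>2) \<partial>M)"
        by (rule nn_integral_cong_AE) (use Z(2)[of k] PsiN_W[of n t k] in \<open>eventually_elim, simp\<close>)
      also have "\<dots> = ennreal (sq_norm (psi_kernel c H0 H1 chi n k t))"
        by (rule W_nn_isometry[OF psi_kernel_square_integrable])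
      finally show "ennreal (w k) * indicator {T0..T1} t \<le> (\<integral>\<^sup>+\<omega>. ennreal ((cmod (Z k \<omega> t))\<^sup>2) *
        indicator {T0..T1} t \<partial>M)"
        using ge[OF k, of t] by (auto simp: indicator_def intro: ennreal_leI)
    qed
    also have "\<dots> = (\<integral>\<^sup>+\<omega>. (\<integral>\<^sup>+t. ennreal ((cmod (Z k \<omega> t))\<^sup>2) * indicator {T0..T1} t \<partial>lborel) \<partial>M)"
      by (rule P.Fubini') measurable
    finally show "ennreal (w k) * ennreal (T1 - T0) \<le> (\<integral>\<^sup>+\<omega>. (\<integral>\<^sup>+t. ennreal ((cmod (Z k \<omega> t))\<^sup>2) *
      indicator {T0..T1} t \<partial>lborel) \<partial>M)" .
  qed simp
  also have "\<dots> = (\<integral>\<^sup>+\<omega>. (\<integral>\<^sup>+t. (\<Sum>k\<in>K. ennreal (?b k) * (ennreal ((cmod (Z k \<omega> t))\<^sup>2) * indicator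
    {T0..T1} t)) \<partial>lborel) \<partial>M)"
  proof -
    have m: "(\<lambda>t. ennreal ((cmod (Z k \<omega> t))\<^sup>2) * indicator {T0..T1} t) \<in> borel_measurable lborel" if
      "\<omega> \<in> space M" for k \<omega>
    proof -
      have "(\<lambda>t. Z k \<omega> t) \<in> borel_measurable lborel" using measurable_compose_Pair1[OF that
        Z(1)[of k]] by simp
      then show ?thesis by measurable
    qed
    have "(\<integral>\<^sup>+\<omega>. (\<integral>\<^sup>+t. (\<Sum>k\<in>K. ennreal (?b k) * (ennreal ((cmod (Z k \<omega> t))\<^sup>2) * indicator {T0..T1}
      t)) \<partial>lborel) \<partial>M) =
      (\<integral>\<^sup>+\<omega>. (\<Sum>k\<in>K. ennreal (?b k) * (\<integral>\<^sup>+t. ennreal ((cmod (Z k \<omega> t))\<^sup>2) * indicator {T0..T1} t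
        \<partial>lborel)) \<partial>M)"
      by (intro nn_integral_cong) (simp add: nn_integral_sum nn_integral_cmult m)
    also have "\<dots> = (\<Sum>k\<in>K. ennreal (?b k) * (\<integral>\<^sup>+\<omega>. (\<integral>\<^sup>+t. ennreal ((cmod (Z k \<omega> t))\<^sup>2) * indicator
      {T0..T1} t \<partial>lborel) \<partial>M))"
      by (subst nn_integral_sum, measurable) (intro sum.cong refl nn_integral_cmult, measurable)
    finally show ?thesis by simp
  qed
  also have "\<dots> \<le> (\<integral>\<^sup>+\<omega>. (\<integral>\<^sup>+t\<in>{0..T}. H_norm_sq s (Psi chi (B n \<omega>) t) \<partial>lborel) \<partial>M)"
  proof (rule nn_integral_mono_AE)
    show "AE \<omega> in M. (\<integral>\<^sup>+t. (\<Sum>k\<in>K. ennreal (?b k) * (ennreal ((cmod (Z k \<omega> t))\<^sup>2) * indicator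
      {T0..T1} t)) \<partial>lborel) \<le> (\<integral>\<^sup>+t\<in>{0..T}. H_norm_sq s (Psi chi (B n \<omega>) t) \<partial>lborel)"
      using aeZ
    proof eventually_elim
      case (elim \<omega>)
      show ?case
      proof (rule nn_integral_mono)
        fix t :: real
        show "(\<Sum>k\<in>K. ennreal (?b k) * (ennreal ((cmod (Z k \<omega> t))\<^sup>2) * indicator {T0..T1} t))
          \<le> H_norm_sq s (Psi chi (B n \<omega>) t) * indicator {0..T} t"
        proof (cases "t \<in> {T0..T1}")
          case True
          have "(\<Sum>k\<in>K. ennreal (?b k) * (ennreal ((cmod (Z k \<omega> t))\<^sup>2) * indicator {T0..T1} t))
            = (\<Sum>k\<in>K. ennreal (?b k * (cmod (Psi chi (B n \<omega>) t k))\<^sup>2))"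
            using True n elim by (intro sum.cong refl) (simp add: ennreal_mult PsiN_def)
          also have "\<dots> \<le> H_norm_sq s (Psi chi (B n \<omega>) t)" by (rule H_norm_sq_ge[OF fin])
          finally show ?thesis using True T by simp
        qed simp
      qed
    qed
  qed
  finally show ?thesis .
qed

proposition Psi_diverges:
  assumes \<alpha>: "\<alpha> < 2 - (2 * H0 + H1)" and T: "0 < T"
  shows "(\<lambda>n. \<integral>\<^sup>+\<omega>. (\<integral>\<^sup>+t\<in>{0..T}. H_norm_sq (- \<alpha>) (Psi chi (B n \<omega>) t) \<partial>lborel) \<partial>M) \<longlonglongrightarrow> \<infinity>"
proof -
  obtain C where C: "0 < C" "\<And>n k t. 2 \<le> k \<Longrightarrow> k < 2 ^ n \<Longrightarrow> 0 \<le> t \<Longrightarrow> t \<le> 1 \<Longrightarrow>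
     C * t\<^sup>2 * real_of_int k powr (3 - 2 * (2 * H0 + H1)) \<le> sq_norm (psi_kernel c H0 H1 chi n k t)"
    using sq_norm_psi_kernel_ge by blast
  \<comment> \<open>Times are restricted to [T1/2, T1], inside [0, 1] where the lower bound holds,
    and away from 0 so that t^2 is at least (T1/2)^2.\<close>
  define T1 where "T1 = min T 1"
  have T1: "0 < T1" "T1 \<le> 1" "T1 \<le> T" using T by (auto simp: T1_def)
  define e where "e = 3 - 2 * (2 * H0 + H1)"
  define G where "G = (T1/2) * (C * (T1/2)\<^sup>2) * 2 powr (- \<bar>2 * \<alpha>\<bar>)"
  have G: "0 < G" using T1 C by (simp add: G_def)
  have lower: "ennreal (G * (real (n - 1) / 2))
    \<le> (\<integral>\<^sup>+\<omega>. (\<integral>\<^sup>+t\<in>{0..T}. H_norm_sq (- \<alpha>) (Psi chi (B n \<omega>) t) \<partial>lborel) \<partial>M)" if n: "n \<ge> 1" for n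
  proof -
    let ?K = "{2..<(2::int) ^ n}"
    let ?w = "\<lambda>k. C * (T1/2)\<^sup>2 * real_of_int k powr e"
    have "ennreal ((T1 - T1/2) * (\<Sum>k\<in>?K. bracket k powr (2 * (- \<alpha>)) * ?w k))
      \<le> (\<integral>\<^sup>+\<omega>. (\<integral>\<^sup>+t\<in>{0..T}. H_norm_sq (- \<alpha>) (Psi chi (B n \<omega>) t) \<partial>lborel) \<partial>M)"
    proof (rule Psi_energy_ge[OF n])
      fix k t assume k: "k \<in> ?K" and t: "t \<in> {T1/2..T1}"
      have "?w k \<le> C * t\<^sup>2 * real_of_int k powr e"
        using t T1 C(1) by (intro mult_right_mono mult_left_mono power_mono) auto
      also have "\<dots> \<le> sq_norm (psi_kernel c H0 H1 chi n k t)"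
        unfolding e_def by (rule C(2)) (use k t T1 in auto)
      finally show "?w k \<le> sq_norm (psi_kernel c H0 H1 chi n k t)" .
    qed (use T1 C(1) in auto)
    moreover have "G * (real (n - 1) / 2) \<le> (T1 - T1/2) * (\<Sum>k\<in>?K. bracket k powr (2 * (- \<alpha>)) * ?w
      k)"
    proof -
      have "G * (real (n - 1) / 2) \<le> G * (\<Sum>k\<in>?K. 1 / real_of_int k)"
        using G by (intro mult_left_mono dyadic_harmonic_ge n) auto
      also have "\<dots> = (\<Sum>k\<in>?K. G * (1 / real_of_int k))" by (rule sum_distrib_left)
      also have "\<dots> \<le> (\<Sum>k\<in>?K. (T1 - T1/2) * (bracket k powr (2 * (- \<alpha>)) * ?w k))"
      proof (rule sum_mono)
        fix k assume k: "k \<in> ?K"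
        define x where "x = real_of_int k"
        have x: "2 \<le> x" using k by (simp add: x_def)
        have "1 / x = x powr (-1)" using x by (simp add: powr_minus_divide)
        \<comment> \<open>Below the critical exponent -2 \<alpha> + 3 - 2 (2 H0 + H1) > -1, so the
          summand dominates a multiple of the harmonic series.\<close>
        also have "\<dots> \<le> x powr (- 2 * \<alpha> + e)" using x \<alpha> by (intro powr_mono) (auto simp: e_def)
        also have "\<dots> = x powr (- 2 * \<alpha>) * x powr e" by (rule powr_add)
        also have "x powr (- 2 * \<alpha>) \<le> 2 powr \<bar>- 2 * \<alpha>\<bar> * bracket k powr (- 2 * \<alpha>)"
          by (rule powr_comparable) (use bracket_comparable[of k] bracket_ge_1[of k] x in \<open>auto
            simp: x_def\<close>)
        finally have "1 / x \<le> 2 powr \<bar>2 * \<alpha>\<bar> * bracket k powr (- 2 * \<alpha>) * x powr e"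
          by (simp add: mult_right_mono)
        then have "G * (1 / x) \<le> G * (2 powr \<bar>2 * \<alpha>\<bar> * bracket k powr (- 2 * \<alpha>) * x powr e)"
          using G by (intro mult_left_mono) auto
        also have "\<dots> = (T1/2) * (C * (T1/2)\<^sup>2) * (2 powr (- \<bar>2 * \<alpha>\<bar>) * 2 powr \<bar>2 * \<alpha>\<bar>) *
          (bracket k powr (- 2 * \<alpha>) * x powr e)"
          by (simp add: G_def mult_ac)
        also have "2 powr (- \<bar>2 * \<alpha>\<bar>) * 2 powr \<bar>2 * \<alpha>\<bar> = (1::real)"
          by (simp add: powr_add[symmetric])
        finally show "G * (1 / real_of_int k) \<le> (T1 - T1/2) * (bracket k powr (2 * (- \<alpha>)) * ?w k)"
          by (simp add: x_def mult_ac)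
      qed
      also have "\<dots> = (T1 - T1/2) * (\<Sum>k\<in>?K. bracket k powr (2 * (- \<alpha>)) * ?w k)"
        by (rule sum_distrib_left[symmetric])
      finally show ?thesis .
    qed
    ultimately show ?thesis using ennreal_leI order_trans by blast
  qed
  have "filterlim (\<lambda>n. G * (real (n - 1) / 2)) at_top sequentially"
  proof (rule filterlim_tendsto_pos_mult_at_top[OF tendsto_const G])
    have "filterlim (\<lambda>n. 1/2 * real n) at_top sequentially"
      by (rule filterlim_tendsto_pos_mult_at_top[OF tendsto_const _ filterlim_real_sequentially])
        simp
    then show "filterlim (\<lambda>n. real (n - 1) / 2) at_top sequentially"
      by (subst filterlim_sequentially_Suc[symmetric]) simp
  qed
  then have "(\<lambda>n. ennreal (G * (real (n - 1) / 2))) \<longlonglongrightarrow> \<infinity>"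
    by (simp add: ennreal_tendsto_top_eq_at_top)
  then show ?thesis
  proof (rule tendsto_sandwich[rotated 2])
    show "\<forall>\<^sub>F n in sequentially. ennreal (G * (real (n - 1) / 2))
      \<le> (\<integral>\<^sup>+\<omega>. (\<integral>\<^sup>+t\<in>{0..T}. H_norm_sq (- \<alpha>) (Psi chi (B n \<omega>) t) \<partial>lborel) \<partial>M)"
      using eventually_ge_at_top[of 1] by eventually_elim (rule lower)
    show "\<forall>\<^sub>F n in sequentially. (\<integral>\<^sup>+\<omega>. (\<integral>\<^sup>+t\<in>{0..T}. H_norm_sq (- \<alpha>) (Psi chi (B n \<omega>) t) \<partial>lborel)
      \<partial>M) \<le> \<infinity>"
      by simp
  qed simp
qed

end

theorem proposition2p2:
  fixes M :: "'a measure"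
    and What :: "(real \<times> real \<Rightarrow> complex) \<Rightarrow> 'a \<Rightarrow> complex"
    and B :: "nat \<Rightarrow> 'a \<Rightarrow> real \<Rightarrow> real \<Rightarrow> complex"
    and chi :: "real \<Rightarrow> real"
    and c H0 H1 :: real
  assumes "prob_space M" and "complete_measure M"
    and "fourier_white_noise M What"
    and "cutoff chi"
    and "0 < c"
    and "0 < H0" "H0 < 1" "0 < H1" "H1 < 1"
    and "3 / 2 < 2 * H0 + H1" "2 * H0 + H1 < 2"
    and "\<And>n. n \<ge> 1 \<Longrightarrow> sheet_approx M What c H0 H1 n (B n)"
  shows "(\<forall>\<alpha> > 2 - (2 * H0 + H1). \<exists>\<Psi> :: 'a \<Rightarrow> real \<Rightarrow> torus_distr.
            AE \<omega> in M. \<forall>p\<ge>1. C_sobolev_tendsto (- \<alpha>) p (\<lambda>n. Psi chi (B n \<omega>)) (\<Psi> \<omega>)) \<and>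
         (\<forall>\<alpha> < 2 - (2 * H0 + H1). \<forall>T > 0.
            (\<lambda>n. \<integral>\<^sup>+\<omega>. (\<integral>\<^sup>+t\<in>{0..T}. H_norm_sq (- \<alpha>) (Psi chi (B n \<omega>) t) \<partial>lborel) \<partial>M)
              \<longlonglongrightarrow> \<infinity>)"
proof -
  interpret prob_space M by fact
  interpret complete_measure M by fact
  interpret sheet M What c H0 H1 chi B
    by unfold_locales (use assms in auto)
  show ?thesis using Psi_converges Psi_diverges assms(10,11) by blast
qed

end
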